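(* Let $k\in\mathbb N_0$. Any $v_h=(v_{\mathcal T},v_{\mathcal F})\in V_h$ and $T\in\mathcal T$ satisfy $$C^{-1}\,\tilde s_T(v_h,v_h)\le\sum_{F\in\mathcal F(T)}h_F^{-1}\|S_{TF}v_h\|_{L^2(F)}^2\le C'\,\tilde s_T(v_h,v_h),$$ where $$\tilde s_T(v_h,v_h):=h_T^{-2}\|\Pi_{T,k}(v_{\mathcal T}-Rv_h)\|_{L^2(T)}^2+\sum_{F\in\mathcal F(T)}h_F^{-1}\|\Pi_{F,k}(v_{\mathcal F}-Rv_h|_T)\|_{L^2(F)}^2 .$$ The constants $C$ and $C'$ exclusively depend on the polynomial degree $k$ and the shape regularity of $\mathcal T$.
   Context: Let $\Omega\subset\mathbb R^n$, $n\in\{2,3\}$, be a bounded polyhedral Lipschitz domain and $\mathcal T$ a shape-regular (conforming) triangulation of $\Omega$ into closed $n$-simplices with facets $\mathcal F$, interior facets $\mathcal F(\Omega)$, and $\mathcal F(T)$ the facets of $T$; $h_K=\operatorname{diam}(K)$. $P_k(\mathcal T)$, $P_k(\mathcal F)$ are the piecewise polynomials of degree at most $k$ on $\mathcal T$, $\mathcal F$; $P_k(\mathcal F(\Omega))$ is the subspace of those in $P_k(\mathcal F)$ vanishing on boundary facets. $\Pi_k,\Pi_{T,k},\Pi_{F,k}$ are the $L^2$ projections onto $P_k(\mathcal T),P_k(T),P_k(F)$. The subscript pw denotes piecewise differentiation. $V_h=P_k(\mathcal T)\times P_k(\mathcal F(\Omega))$. For $v_h=(v_{\mathcal T},v_{\mathcal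 F})\in V_h$, $Rv_h\in P_{k+1}(\mathcal T)$ is the unique function with $\Pi_0(Rv_h-v_{\mathcal T})=0$ and, for all $w\in P_{k+1}(\mathcal T)$, $(\nabla_{\rm pw}Rv_h,\nabla_{\rm pw}w)_{L^2(\Omega)}=(\nabla_{\rm pw}v_{\mathcal T},\nabla_{\rm pw}w)_{L^2(\Omega)}-\sum_{T\in\mathcal T}\langle v_{\mathcal T}|_T-v_{\mathcal F},\nabla w|_T\cdot\nu_T\rangle_{L^2(\partial T)}$, with $\nu_T$ the outer unit normal of $T$. For $F\in\mathcal F(T)$, $S_{TF}v_h=\Pi_{F,k}\big((v_{\mathcal T}+(1-\Pi_{T,k})Rv_h)|_T\big)-v_{\mathcal F}|_F$. *)

theory Defs
  imports "HOL-Analysis.Analysis"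
begin

section \<open>Domains and triangulations\<close>

definition lipschitz_domain :: "'a::euclidean_space set \<Rightarrow> bool" where
  "lipschitz_domain \<Omega> \<longleftrightarrow> open \<Omega> \<and> connected \<Omega> \<and> \<Omega> \<noteq> {} \<and>
     (\<forall>x\<in>frontier \<Omega>. \<exists>r>0. \<exists>e \<phi> L. norm e = 1 \<and> L-lipschitz_on {z. z \<bullet> e = 0} \<phi> \<and>
        \<Omega> \<inter> ball x r = {y \<in> ball x r. y \<bullet> e < \<phi> (y - (y \<bullet> e) *\<^sub>R e)})"

definition bounded_polyhedral_lipschitz_domain :: "'a::euclidean_space set \<Rightarrow> bool" where
  "bounded_polyhedral_lipschitz_domain \<Omega> \<longleftrightarrow> bounded \<Omega> \<and> lipschitz_domain \<Omega> \<and>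
     (\<exists>\<P>. finite \<P> \<and> (\<forall>P\<in>\<P>. polytope P) \<and> closure \<Omega> = \<Union>\<P>)"

text \<open>Conformity (two elements meet in a common face) is part of the library notion
  \<^const>\<open>triangulation\<close>.\<close>

definition triangulation_of :: "'a::euclidean_space set set \<Rightarrow> 'a set \<Rightarrow> bool" where
  "triangulation_of \<T> \<Omega> \<longleftrightarrow> triangulation \<T> \<and> (\<forall>T\<in>\<T>. int DIM('a) simplex T) \<and> \<Union>\<T> = closure \<Omega>"

text \<open>\<open>\<gamma>\<close> is the shape regularity constant: each element \<open>T\<close> contains a ball whose diameter is at
  least \<open>h\<^sub>T / \<gamma>\<close>.\<close>

definition shape_regular :: "real \<Rightarrow> 'a::euclidean_space set set \<Rightarrow> bool" where
  "shape_regular \<gamma> \<T> \<longleftrightarrow> (\<forall>T\<in>\<T>. \<exists>x r. 0 < r \<and> cball x r \<subseteq> T \<and> diameter T \<le> \<gamma> * (2 * r))"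

definition facets :: "'a::euclidean_space set \<Rightarrow> 'a set set" where
  "facets T = {F. F facet_of T}"

definition mesh_facets :: "'a::euclidean_space set set \<Rightarrow> 'a set set" where
  "mesh_facets \<T> = (\<Union>T\<in>\<T>. facets T)"

definition boundary_facets :: "'a::euclidean_space set \<Rightarrow> 'a set set \<Rightarrow> 'a set set" where
  "boundary_facets \<Omega> \<T> = {F \<in> mesh_facets \<T>. F \<subseteq> frontier \<Omega>}"

definition outer_normal :: "'a::euclidean_space set \<Rightarrow> 'a set \<Rightarrow> 'a" where
  "outer_normal T F = (THE \<nu>. norm \<nu> = 1 \<and> (\<forall>x\<in>F. \<forall>y\<in>T. (y - x) \<bullet> \<nu> \<le> 0))"

section \<open>Integration on flat pieces, gradients, projections\<close>

text \<open>The Lebesgue measure of the affine hull of \<open>F\<close> (hence the surface measure if \<open>F\<close> is a facet),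
  restricted to \<open>F\<close>. As in the library theorem \<open>lborel_eq\<close>, it is the image of a product of
  one-dimensional Lebesgue measures under an orthonormal parametrisation; it does not depend on the
  choice of the base point \<open>a\<close> and of the orthonormal basis \<open>B\<close> of the direction space.\<close>

definition surface_measure :: "'a::euclidean_space set \<Rightarrow> 'a measure" where
  "surface_measure F =
     (let a = (SOME a. a \<in> F);
          B = (SOME B. pairwise orthogonal B \<and> (\<forall>b\<in>B. norm b = 1) \<and>
                 span B = span {x - y | x y. x \<in> F \<and> y \<in> F})
      in restrict_space
           (distr (\<Pi>\<^sub>M b\<in>B. lborel) borel (\<lambda>c. a + (\<Sum>b\<in>B. c b *\<^sub>R b))) F)"

definition L2_norm :: "'a measure \<Rightarrow> ('a \<Rightarrow> real) \<Rightarrow> real" where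
  "L2_norm M f = sqrt (\<integral>x. (f x)\<^sup>2 \<partial>M)"

definition L2_projection :: "'a measure \<Rightarrow> ('a \<Rightarrow> real) set \<Rightarrow> ('a \<Rightarrow> real) \<Rightarrow> 'a \<Rightarrow> real" where
  "L2_projection M S f = (THE p. p \<in> S \<and> (\<forall>q\<in>S. (\<integral>x. (f x - p x) * q x \<partial>M) = 0))"

definition grad :: "('a::euclidean_space \<Rightarrow> real) \<Rightarrow> 'a \<Rightarrow> 'a" where
  "grad f x = (THE D. GDERIV f x :> D)"

section \<open>Polynomial spaces\<close>

definition polys :: "nat \<Rightarrow> (real^'n \<Rightarrow> real) set" where
  "polys k = {p. \<exists>c :: ('n \<Rightarrow> nat) \<Rightarrow> real.
     p = (\<lambda>x. \<Sum>\<alpha> | (\<Sum>i\<in>UNIV. \<alpha> i) \<le> k. c \<alpha> * (\<Prod>i\<in>UNIV. (x $ i) ^ \<alpha> i))}"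

text \<open>A polynomial on an element \<open>T\<close> (which has interior points) is identified with its unique
  polynomial extension to the whole space, so that \<open>P\<^sub>k(T)\<close> is \<^term>\<open>polys k\<close>. On a facet, where the
  extension is not unique, polynomials are restrictions; a polynomial of degree at most \<open>k\<close> in
  coordinates of the hyperplane is the restriction of one in the ambient coordinates.\<close>

definition facet_polys :: "nat \<Rightarrow> (real^'n) set \<Rightarrow> (real^'n \<Rightarrow> real) set" where
  "facet_polys k F = (\<lambda>p. restrict p F) ` polys k"

text \<open>A piecewise polynomial is multivalued on element interfaces and is therefore a family
  indexed by the elements (or the facets); \<open>v T\<close> is the restriction of \<open>v\<close> to \<open>T\<close>. Families are
  extensional, so that equality is equality of piecewise polynomials.\<close>

definition pw_polys :: "nat \<Rightarrow> (real^'n) set set \<Rightarrow> ((real^'n) set \<Rightarrow> real^'n \<Rightarrow> real) set" where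
  "pw_polys k \<T> = (\<Pi>\<^sub>E T\<in>\<T>. polys k)"

definition skeleton_polys ::
  "nat \<Rightarrow> (real^'n) set \<Rightarrow> (real^'n) set set \<Rightarrow> ((real^'n) set \<Rightarrow> real^'n \<Rightarrow> real) set" where
  "skeleton_polys k \<Omega> \<T> =
     {v \<in> (\<Pi>\<^sub>E F\<in>mesh_facets \<T>. facet_polys k F). \<forall>F\<in>boundary_facets \<Omega> \<T>. \<forall>x\<in>F. v F x = 0}"

definition elem_proj :: "nat \<Rightarrow> (real^'n) set \<Rightarrow> (real^'n \<Rightarrow> real) \<Rightarrow> real^'n \<Rightarrow> real" where
  "elem_proj k T = L2_projection (lebesgue_on T) (polys k)"

definition facet_proj :: "nat \<Rightarrow> (real^'n) set \<Rightarrow> (real^'n \<Rightarrow> real) \<Rightarrow> real^'n \<Rightarrow> real" where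
  "facet_proj k F = L2_projection (surface_measure F) (facet_polys k F)"

section \<open>Discrete space, reconstruction and stabilisation\<close>

type_synonym 'n pw_fun = "(real^'n) set \<Rightarrow> real^'n \<Rightarrow> real"

definition V_h :: "nat \<Rightarrow> (real^'n) set \<Rightarrow> (real^'n) set set \<Rightarrow> ('n pw_fun \<times> 'n pw_fun) set" where
  "V_h k \<Omega> \<T> = pw_polys k \<T> \<times> skeleton_polys k \<Omega> \<T>"

definition pw_grad_inner :: "(real^'n) set set \<Rightarrow> 'n pw_fun \<Rightarrow> 'n pw_fun \<Rightarrow> real" where
  "pw_grad_inner \<T> u w = (\<Sum>T\<in>\<T>. \<integral>x. grad (u T) x \<bullet> grad (w T) x \<partial>lebesgue_on T)"

text \<open>The projection \<open>\<Pi>\<^sub>0\<close> onto piecewise constants acts elementwise.\<close>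

definition reconstruction ::
  "nat \<Rightarrow> (real^'n) set set \<Rightarrow> 'n pw_fun \<times> 'n pw_fun \<Rightarrow> 'n pw_fun" where
  "reconstruction k \<T> = (\<lambda>(vT, vF). THE R. R \<in> pw_polys (k + 1) \<T> \<and>
     (\<forall>T\<in>\<T>. elem_proj 0 T (\<lambda>x. R T x - vT T x) = (\<lambda>x. 0)) \<and>
     (\<forall>w\<in>pw_polys (k + 1) \<T>.
        pw_grad_inner \<T> R w = pw_grad_inner \<T> vT w -
          (\<Sum>T\<in>\<T>. \<Sum>F\<in>facets T.
             \<integral>x. (vT T x - vF F x) * (grad (w T) x \<bullet> outer_normal T F) \<partial>surface_measure F)))"

definition S_TF ::
  "nat \<Rightarrow> (real^'n) set set \<Rightarrow> (real^'n) set \<Rightarrow> (real^'n) set \<Rightarrow>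
     'n pw_fun \<times> 'n pw_fun \<Rightarrow> real^'n \<Rightarrow> real" where
  "S_TF k \<T> T F vh = (\<lambda>x.
     let R = reconstruction k \<T> vh
     in facet_proj k F (\<lambda>y. fst vh T y + (R T y - elem_proj k T (R T) y)) x - snd vh F x)"

definition s_tilde ::
  "nat \<Rightarrow> (real^'n) set set \<Rightarrow> (real^'n) set \<Rightarrow> 'n pw_fun \<times> 'n pw_fun \<Rightarrow> real" where
  "s_tilde k \<T> T vh =
     (let R = reconstruction k \<T> vh
      in (L2_norm (lebesgue_on T) (elem_proj k T (\<lambda>x. fst vh T x - R T x)))\<^sup>2 / (diameter T)\<^sup>2 +
         (\<Sum>F\<in>facets T.
            (L2_norm (surface_measure F) (facet_proj k F (\<lambda>x. snd vh F x - R T x)))\<^sup>2 / diameter F))"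

end

(* On T put e = v_T - Pi_T R, where R is the reconstruction, and g = Pi_F (v_F - R) on each facet F.
   Then S_TF = e - g on F, and e and g are the two quantities measured by the modified stabilisation.
   The upper bound is the triangle inequality with the discrete trace inequality for e. For the lower
   bound it remains to control e by S_TF. Green's formula for R - Pi_T R, which is orthogonal to P_k,
   and the equation defining R give
     (grad e, grad w)_T = sum over F of (S_TF, grad w . nu)_F   for all w in P_(k+1),
   so that w = e, the trace inequality and the Poincare inequality (e has mean zero) suffice.
   The uniform constants come from a single estimate on balls: if cball x r is contained in T, which
   is contained in cball x (M r), then p(y)^2 <= C r^(-n) int_T p^2 on the larger ball for p in P_k.
   The divergence theorem on a simplex is proved in edge directions a - b: all facets except those
   opposite a and b are parallel to a - b, and Fubini along this direction gives the boundary terms. *)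

theory Submission
  imports Defs
begin

section \<open>Semi-inner products on function spaces\<close>

text \<open>No reference simplex enters. The only normalisation is the translation and dilation
  taking the inscribed ball to the unit ball, and shape regularity is used as the bound of the
  diameter of T by M r. What ties the facets to the same scale is 2 r \<le> h_F, obtained by
  projecting a chord of the inscribed ball from the opposite vertex; this needs a direction parallel
  to the facet, hence n \<ge> 2. Normals, projections and the reconstruction are definite
  descriptions, so each needs existence and uniqueness before it can be used. For projections and
  the reconstruction, existence is a Riesz argument that must tolerate a degenerate product, since a
  nonzero polynomial may vanish on a facet. The surface measure rests on an arbitrary choice of base
  point and orthonormal basis; one Fubini identity, valid in every direction transversal to the
  hyperplane, makes it usable. The identity for grad e closes because v_F and grad w . \<nu> both
  have degree at most k on F, so that Pi_F may be inserted in the facet integrals. The choice w = e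
  is admissible because e has degree at most k.\<close>

locale semi_inner_product =
  fixes X :: "('a \<Rightarrow> real) set" and B :: "('a \<Rightarrow> real) \<Rightarrow> ('a \<Rightarrow> real) \<Rightarrow> real"
  assumes zero_closed: "(\<lambda>x. 0) \<in> X"
    and add_closed: "f \<in> X \<Longrightarrow> g \<in> X \<Longrightarrow> (\<lambda>x. f x + g x) \<in> X"
    and scale_closed: "f \<in> X \<Longrightarrow> (\<lambda>x. c * f x) \<in> X"
    and add_left: "f \<in> X \<Longrightarrow> g \<in> X \<Longrightarrow> h \<in> X \<Longrightarrow> B (\<lambda>x. f x + g x) h = B f h + B g h"
    and scale_left: "f \<in> X \<Longrightarrow> h \<in> X \<Longrightarrow> B (\<lambda>x. c * f x) h = c * B f h"
    and sym: "f \<in> X \<Longrightarrow> g \<in> X \<Longrightarrow> B f g = B g f"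
    and nonneg: "f \<in> X \<Longrightarrow> 0 \<le> B f f"

text \<open>The generators need not be linearly independent. Induction on the finite index set adds
  one generator at a time, and the family of monomials up to degree k yields exactly
  \<open>polys k\<close>.\<close>

definition lin_span :: "('i \<Rightarrow> 'a \<Rightarrow> real) \<Rightarrow> 'i set \<Rightarrow> ('a \<Rightarrow> real) set" where
  "lin_span b I = range (\<lambda>c x. \<Sum>i\<in>I. c i * b i x)"

lemma lin_spanI: "f = (\<lambda>x. \<Sum>i\<in>I. c i * b i x) \<Longrightarrow> f \<in> lin_span b I"
  unfolding lin_span_def by (rule range_eqI[where x = c])

lemma lin_span_insert:
  assumes "finite I" "j \<notin> I"
  shows "f \<in> lin_span b (insert j I) \<longleftrightarrow> (\<exists>s\<in>lin_span b I. \<exists>c. f = (\<lambda>x. s x + c * b j x))"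
proof -
  have upd: "(\<Sum>i\<in>insert j I. (c(j := d)) i * b i x) = (\<Sum>i\<in>I. c i * b i x) + d * b j x" for c d x
  proof -
    have "(\<Sum>i\<in>I. (c(j := d)) i * b i x) = (\<Sum>i\<in>I. c i * b i x)"
      using assms by (intro sum.cong) auto
    then show ?thesis using assms by simp
  qed
  show ?thesis
  proof
    assume "f \<in> lin_span b (insert j I)"
    then obtain c where "f = (\<lambda>x. \<Sum>i\<in>insert j I. c i * b i x)" by (auto simp: lin_span_def)
    then have "f = (\<lambda>x. (\<Sum>i\<in>I. c i * b i x) + c j * b j x)"
      using assms by (simp add: add.commute)
    moreover have "(\<lambda>x. \<Sum>i\<in>I. c i * b i x) \<in> lin_span b I" by (auto simp: lin_span_def)
    ultimately show "\<exists>s\<in>lin_span b I. \<exists>c. f = (\<lambda>x. s x + c * b j x)"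
      by (rule_tac bexI) (rule exI)
  next
    assume "\<exists>s\<in>lin_span b I. \<exists>c. f = (\<lambda>x. s x + c * b j x)"
    then obtain c d where "f = (\<lambda>x. (\<Sum>i\<in>I. c i * b i x) + d * b j x)"
      by (auto simp: lin_span_def)
    then have "f = (\<lambda>x. \<Sum>i\<in>insert j I. (c(j := d)) i * b i x)" by (simp only: upd)
    then show "f \<in> lin_span b (insert j I)" by (rule lin_spanI)
  qed
qed

lemma lin_span_scale: "f \<in> lin_span b I \<Longrightarrow> (\<lambda>x. c * f x) \<in> lin_span b I"
proof -
  assume "f \<in> lin_span b I"
  then obtain d where "f = (\<lambda>x. \<Sum>i\<in>I. d i * b i x)" by (auto simp: lin_span_def)
  then have "(\<lambda>x. c * f x) = (\<lambda>x. \<Sum>i\<in>I. (c * d i) * b i x)"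
    by (simp add: sum_distrib_left mult.assoc)
  then show ?thesis by (rule lin_spanI)
qed

lemma lin_span_add:
  assumes "f \<in> lin_span b I" "g \<in> lin_span b I"
  shows "(\<lambda>x. f x + g x) \<in> lin_span b I"
proof -
  obtain c d where "f = (\<lambda>x. \<Sum>i\<in>I. c i * b i x)" "g = (\<lambda>x. \<Sum>i\<in>I. d i * b i x)"
    using assms by (auto simp: lin_span_def)
  then have "(\<lambda>x. f x + g x) = (\<lambda>x. \<Sum>i\<in>I. (c i + d i) * b i x)"
    by (simp add: sum.distrib distrib_right)
  then show ?thesis by (rule lin_spanI)
qed

context semi_inner_product
begin

lemma add_right: "f \<in> X \<Longrightarrow> g \<in> X \<Longrightarrow> h \<in> X \<Longrightarrow> B h (\<lambda>x. f x + g x) = B h f + B h g"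
  using sym[of h "\<lambda>x. f x + g x"] add_left[of f g h] add_closed[of f g] sym[of h f] sym[of h g] by simp

lemma scale_right: "f \<in> X \<Longrightarrow> h \<in> X \<Longrightarrow> B h (\<lambda>x. c * f x) = c * B h f"
  using sym[of h "\<lambda>x. c * f x"] scale_left[of f h c] scale_closed[of f c] sym[of h f] by simp

lemma diff_closed: "f \<in> X \<Longrightarrow> g \<in> X \<Longrightarrow> (\<lambda>x. f x - g x) \<in> X"
  using add_closed[OF _ scale_closed[of g "-1"], of f] by simp

lemma diff_left: "f \<in> X \<Longrightarrow> g \<in> X \<Longrightarrow> h \<in> X \<Longrightarrow> B (\<lambda>x. f x - g x) h = B f h - B g h"
  using add_left[OF _ scale_closed[of g "-1"], of f h] scale_left[of g h "-1"] by simp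

lemma zero_left: "h \<in> X \<Longrightarrow> B (\<lambda>x. 0) h = 0"
  using scale_left[OF zero_closed, of h 0] by simp

lemma lin_span_subset:
  assumes "finite I" "b ` I \<subseteq> X"
  shows "lin_span b I \<subseteq> X"
  using assms
proof (induction I)
  case empty
  then show ?case by (auto simp: lin_span_def zero_closed)
next
  case (insert j I)
  then show ?case by (auto simp: lin_span_insert intro!: add_closed scale_closed)
qed

text \<open>If \<open>B f f = 0\<close>, then \<open>B\<close> of g + t f with itself is affine in
  t, and an affine function bounded below by 0 has slope zero. This degenerate case of
  Cauchy-Schwarz makes the functionals \<open>B h\<close> admissible in
  \<open>riesz\<close>.\<close>

lemma null_orthogonal:
  assumes f: "f \<in> X" and g: "g \<in> X" and "B f f = 0"
  shows "B f g = 0"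
proof (rule ccontr)
  assume ne: "B f g \<noteq> 0"
  \<comment> \<open>At this t the affine function takes the value -1.\<close>
  define t where "t = - (B g g + 1) / (2 * B f g)"
  have tf: "(\<lambda>x. t * f x) \<in> X" by (intro scale_closed f)
  have "0 \<le> B (\<lambda>x. g x + t * f x) (\<lambda>x. g x + t * f x)"
    by (intro nonneg add_closed g tf)
  also have "\<dots> = B g g + 2 * t * B f g"
    using assms tf sym[OF g f] by (simp add: add_left add_right scale_left scale_right add_closed)
  also have "\<dots> = -1" using ne by (simp add: t_def field_simps)
  finally show False by simp
qed

lemma null_orthogonal': "f \<in> X \<Longrightarrow> g \<in> X \<Longrightarrow> B f f = 0 \<Longrightarrow> B g f = 0"
  using null_orthogonal[of f g] sym[of f g] by simp

text \<open>Subtracting an element r of the old span from the new generator leaves the enlarged span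
  unchanged. With r the projection of \<open>b j\<close> this is a Gram-Schmidt step.\<close>

lemma orthogonal_complement_step:
  assumes "finite I" "j \<notin> I" and r: "r \<in> lin_span b I" and q: "q \<in> lin_span b (insert j I)"
  obtains s c where "s \<in> lin_span b I" "q = (\<lambda>x. s x + c * (b j x - r x))"
proof -
  obtain s c where s: "s \<in> lin_span b I" and q: "q = (\<lambda>x. s x + c * b j x)"
    using q unfolding lin_span_insert[OF assms(1,2)] by (elim bexE exE)
  have "(\<lambda>x. s x + c * r x) \<in> lin_span b I"
    by (intro lin_span_add lin_span_scale s r)
  moreover have "q = (\<lambda>x. (s x + c * r x) + c * (b j x - r x))"
    by (simp add: q algebra_simps)
  ultimately show ?thesis by (rule that)
qed

text \<open>Definiteness is replaced by the requirement that L vanish on null vectors. When a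
  generator is added, its part d orthogonal to the old span corrects the representer without
  disturbing its values on the old span.\<close>

lemma riesz:
  assumes "finite I" "b ` I \<subseteq> X"
    and "\<And>f g. f \<in> X \<Longrightarrow> g \<in> X \<Longrightarrow> L (\<lambda>x. f x + g x) = L f + L g"
    and "\<And>f c. f \<in> X \<Longrightarrow> L (\<lambda>x. c * f x) = c * L f"
    and "\<And>f. f \<in> X \<Longrightarrow> B f f = 0 \<Longrightarrow> L f = 0"
  shows "\<exists>p\<in>lin_span b I. \<forall>q\<in>lin_span b I. B p q = L q"
  using assms
proof (induction I arbitrary: L)
  case empty
  then have "L (\<lambda>x. 0) = 0" using zero_closed empty.prems(3)[of "\<lambda>x. 0" 0] by simp
  then show ?case by (auto simp: lin_span_def zero_left zero_closed)
next
  case (insert j I)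
  have bj: "b j \<in> X" and bI: "b ` I \<subseteq> X" using insert.prems by auto
  note sub = lin_span_subset[OF insert.hyps(1) bI]
  \<comment> \<open>The projection r of \<open>b j\<close> onto the old span is the representer of
    the functional \<open>B (b j)\<close>.\<close>
  have "\<exists>p\<in>lin_span b I. \<forall>q\<in>lin_span b I. B p q = B (b j) q"
    by (rule insert.IH[where L = "B (b j)", OF bI])
       (simp_all add: add_right scale_right bj null_orthogonal')
  then obtain r where r: "r \<in> lin_span b I" "\<And>q. q \<in> lin_span b I \<Longrightarrow> B r q = B (b j) q" by (elim bexE) auto
  have "\<exists>p\<in>lin_span b I. \<forall>q\<in>lin_span b I. B p q = L q"
    by (rule insert.IH[where L = L, OF bI]) (simp_all add: insert.prems)
  then obtain p where p: "p \<in> lin_span b I" "\<And>q. q \<in> lin_span b I \<Longrightarrow> B p q = L q" by (elim bexE) auto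
  have rX: "r \<in> X" and pX: "p \<in> X" using r p sub by auto
  define d where "d = (\<lambda>x. b j x - r x)"
  have dX: "d \<in> X" unfolding d_def by (rule diff_closed[OF bj rX])
  have orth: "B d q = 0" if q: "q \<in> lin_span b I" for q
    unfolding d_def diff_left[OF bj rX subsetD[OF sub q]] r(2)[OF q] by simp
  define t where "t = L d / B d d"
  \<comment> \<open>If \<open>B d d = 0\<close>, then t is 0 by the convention for division, and
    \<open>L d = 0\<close> by the assumption on null vectors.\<close>
  have t: "t * B d d = L d" using insert.prems(4)[OF dX] by (cases "B d d = 0") (auto simp: t_def)
  have "(\<lambda>x. p x + t * d x) = (\<lambda>x. (p x + (- t) * r x) + t * b j x)"
    by (simp add: d_def algebra_simps)
  moreover have "(\<lambda>x. p x + (- t) * r x) \<in> lin_span b I"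
    by (intro lin_span_add lin_span_scale p r)
  ultimately have mem: "(\<lambda>x. p x + t * d x) \<in> lin_span b (insert j I)"
    unfolding lin_span_insert[OF insert.hyps] by (intro bexI exI)
  have "B (\<lambda>x. p x + t * d x) q = L q" if qmem: "q \<in> lin_span b (insert j I)" for q
  proof -
    obtain s c where s: "s \<in> lin_span b I" and q: "q = (\<lambda>x. s x + c * d x)"
      using orthogonal_complement_step[OF insert.hyps r(1) qmem] unfolding d_def by metis
    have sX: "s \<in> X" using s sub by auto
    have cd: "(\<lambda>x. c * d x) \<in> X" and td: "(\<lambda>x. t * d x) \<in> X" by (auto intro: scale_closed dX)
    have "B (\<lambda>x. p x + t * d x) q = (B p s + c * B p d) + t * (B d s + c * B d d)"
      unfolding q using sX dX pX cd td by (simp add: add_left add_right scale_left scale_right add_closed distrib_left)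
    also have "\<dots> = L s + c * L d"
      unfolding sym[OF pX dX] orth[OF s] orth[OF p(1)] p(2)[OF s] t[symmetric] by simp
    also have "\<dots> = L q" unfolding q insert.prems(2)[OF sX cd] insert.prems(3)[OF dX] ..
    finally show ?thesis .
  qed
  then show ?case by (intro bexI[OF _ mem] ballI)
qed

text \<open>Gram--Schmidt replaces the usual compactness argument for the equivalence of norms.\<close>

lemma evaluation_bounded:
  assumes "finite I" "b ` I \<subseteq> X"
    and def: "\<And>f x. f \<in> X \<Longrightarrow> B f f = 0 \<Longrightarrow> x \<in> K \<Longrightarrow> f x = 0"
    and bdd: "\<And>f. f \<in> X \<Longrightarrow> bounded (f ` K)"
  shows "\<exists>C\<ge>0. \<forall>p\<in>lin_span b I. \<forall>x\<in>K. (p x)\<^sup>2 \<le> C * B p p"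
  using assms(1,2)
proof (induction I)
  case empty
  then show ?case by (auto simp: lin_span_def zero_left zero_closed)
next
  case (insert j I)
  have bj: "b j \<in> X" and bI: "b ` I \<subseteq> X" using insert.prems by auto
  note sub = lin_span_subset[OF insert.hyps(1) bI]
  obtain C where C: "C \<ge> 0" "\<And>p x. p \<in> lin_span b I \<Longrightarrow> x \<in> K \<Longrightarrow> (p x)\<^sup>2 \<le> C * B p p"
    using insert.IH[OF bI] by blast
  have "\<exists>p\<in>lin_span b I. \<forall>q\<in>lin_span b I. B p q = B (b j) q"
    by (rule riesz[where L = "B (b j)", OF insert.hyps(1) bI])
       (simp_all add: add_right scale_right bj null_orthogonal')
  then obtain r where r: "r \<in> lin_span b I" "\<And>q. q \<in> lin_span b I \<Longrightarrow> B r q = B (b j) q" by (elim bexE) auto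
  have rX: "r \<in> X" using r sub by auto
  define d where "d = (\<lambda>x. b j x - r x)"
  have dX: "d \<in> X" unfolding d_def by (rule diff_closed[OF bj rX])
  have orth: "B d q = 0" if q: "q \<in> lin_span b I" for q
    unfolding d_def diff_left[OF bj rX subsetD[OF sub q]] r(2)[OF q] by simp
  obtain M where M: "\<And>x. x \<in> K \<Longrightarrow> \<bar>d x\<bar> \<le> M"
    using bdd[OF dX] by (auto simp: bounded_iff)
  \<comment> \<open>The factors 2 come from (s + c d)^2 \<le> 2 s^2 + 2 c^2 d^2, where
    \<open>B p p\<close> is the orthogonal sum of both parts. For \<open>B d d = 0\<close> the
    quotient is 0, which is correct because d then vanishes on \<open>K\<close>.\<close>
  define D where "D = 2 * C + 2 * M\<^sup>2 / B d d"
  have D: "D \<ge> 0" using C(1) nonneg[OF dX] by (simp add: D_def)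
  have "(p x)\<^sup>2 \<le> D * B p p" if pmem: "p \<in> lin_span b (insert j I)" and x: "x \<in> K" for p x
  proof -
    obtain s c where s: "s \<in> lin_span b I" and p: "p = (\<lambda>x. s x + c * d x)"
      using orthogonal_complement_step[OF insert.hyps r(1) pmem] unfolding d_def by metis
    have sX: "s \<in> X" using s sub by auto
    have cd: "(\<lambda>x. c * d x) \<in> X" by (auto intro: scale_closed dX)
    have pp: "B p p = B s s + c\<^sup>2 * B d d"
      unfolding p using sX dX cd orth[OF s] sym[OF sX dX]
      by (simp add: add_left add_right scale_left scale_right add_closed power2_eq_square)
    have dd: "(d x)\<^sup>2 \<le> M\<^sup>2 / B d d * B d d"
    proof (cases "B d d = 0")
      case True
      then show ?thesis using def[OF dX _ x] by simp
    next
      case False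
      then show ?thesis using M[OF x] by (simp add: abs_le_square_iff[symmetric])
    qed
    have "(p x)\<^sup>2 \<le> 2 * (s x)\<^sup>2 + 2 * (c * d x)\<^sup>2"
      unfolding p using sum_squares_bound[of "s x" "c * d x"] by (simp add: power2_sum)
    also have "\<dots> \<le> 2 * (C * B s s) + 2 * (c\<^sup>2 * (M\<^sup>2 / B d d * B d d))"
      using C(2)[OF s x] mult_left_mono[OF dd, of "c\<^sup>2"] by (simp add: power_mult_distrib)
    also have "\<dots> \<le> D * B p p"
      using C(1) nonneg[OF sX] nonneg[OF dX] 
      unfolding D_def pp distrib_left distrib_right
      by (simp add: algebra_simps)
    finally show ?thesis .
  qed
  with D show ?case by blast
qed

end

section \<open>Polynomials\<close>

definition monom_fun :: "('n \<Rightarrow> nat) \<Rightarrow> real^'n \<Rightarrow> real" where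
  "monom_fun \<alpha> x = (\<Prod>i\<in>UNIV. (x $ i) ^ \<alpha> i)"

abbreviation multi_indices :: "nat \<Rightarrow> ('n::finite \<Rightarrow> nat) set" where
  "multi_indices k \<equiv> {\<alpha>. (\<Sum>i\<in>UNIV. \<alpha> i) \<le> k}"

lemma finite_multi_indices: "finite (multi_indices k :: ('n::finite \<Rightarrow> nat) set)"
proof (rule finite_subset)
  show "{\<alpha> :: 'n \<Rightarrow> nat. (\<Sum>i\<in>UNIV. \<alpha> i) \<le> k} \<subseteq> Pi\<^sub>E UNIV (\<lambda>_. {..k})"
  proof
    fix \<alpha> :: "'n \<Rightarrow> nat" assume "\<alpha> \<in> {\<alpha>. (\<Sum>i\<in>UNIV. \<alpha> i) \<le> k}"
    then show "\<alpha> \<in> Pi\<^sub>E UNIV (\<lambda>_. {..k})"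
      using member_le_sum[of _ UNIV \<alpha>] by (auto intro: order_trans)
  qed
  show "finite (Pi\<^sub>E (UNIV :: 'n set) (\<lambda>_. {..k}))"
    by (intro finite_PiE) auto
qed

lemma polys_eq_lin_span: "polys k = lin_span monom_fun (multi_indices k)"
  unfolding polys_def lin_span_def monom_fun_def by auto

lemma polys_add: "p \<in> polys k \<Longrightarrow> q \<in> polys k \<Longrightarrow> (\<lambda>x. p x + q x) \<in> polys k"
  unfolding polys_eq_lin_span by (rule lin_span_add)

lemma polys_scale: "p \<in> polys k \<Longrightarrow> (\<lambda>x. c * p x) \<in> polys k"
  unfolding polys_eq_lin_span by (rule lin_span_scale)

lemma polys_diff: "p \<in> polys k \<Longrightarrow> q \<in> polys k \<Longrightarrow> (\<lambda>x. p x - q x) \<in> polys k"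
  using polys_add[OF _ polys_scale[of q k "-1"], of p] by simp

lemma polys_zero: "(\<lambda>x. 0) \<in> polys k"
  unfolding polys_eq_lin_span by (rule lin_spanI[of _ "\<lambda>_. 0"]) simp

lemma polys_sum: "finite A \<Longrightarrow> (\<And>a. a \<in> A \<Longrightarrow> f a \<in> polys k) \<Longrightarrow> (\<lambda>x. \<Sum>a\<in>A. f a x) \<in> polys k"
  by (induction A rule: finite_induct) (auto simp: polys_zero intro!: polys_add)

lemma polys_monom: 
  assumes "(\<Sum>i\<in>UNIV. \<alpha> i) \<le> k"
  shows "monom_fun \<alpha> \<in> polys k"
  unfolding polys_eq_lin_span
proof (rule lin_spanI[of _ "\<lambda>\<beta>. if \<beta> = \<alpha> then 1 else 0"], rule ext)
  fix x
  have "(\<Sum>\<beta> | (\<Sum>i\<in>UNIV. \<beta> i) \<le> k. (if \<beta> = \<alpha> then 1 else 0) * monom_fun \<beta> x)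
      = (\<Sum>\<beta> | (\<Sum>i\<in>UNIV. \<beta> i) \<le> k. if \<beta> = \<alpha> then monom_fun \<beta> x else 0)"
    by (intro sum.cong) auto
  also have "\<dots> = monom_fun \<alpha> x" using assms by (simp add: sum.delta[OF finite_multi_indices])
  finally show "monom_fun \<alpha> x = (\<Sum>\<beta> | (\<Sum>i\<in>UNIV. \<beta> i) \<le> k. (if \<beta> = \<alpha> then 1 else 0) * monom_fun \<beta> x)"
    by simp
qed

text \<open>Structural induction over the span of the monomials. Membership in
  \<open>polys k\<close> is supplied in the steps for sums and multiples, so that closure properties
  and rules for gradients stay usable there.\<close>

lemma polys_induct [consumes 1, case_names zero add scale monom]:
  assumes "p \<in> polys k"
    and "P (\<lambda>x. 0)"
    and add: "\<And>p q. p \<in> polys k \<Longrightarrow> q \<in> polys k \<Longrightarrow> P p \<Longrightarrow> P q \<Longrightarrow> P (\<lambda>x. p x + q x)"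
    and "\<And>c p. p \<in> polys k \<Longrightarrow> P p \<Longrightarrow> P (\<lambda>x. c * p x)"
    and "\<And>\<alpha>. (\<Sum>i\<in>UNIV. \<alpha> i) \<le> k \<Longrightarrow> P (monom_fun \<alpha>)"
  shows "P p"
proof -
  obtain c where p: "p = (\<lambda>x. \<Sum>\<alpha> | (\<Sum>i\<in>UNIV. \<alpha> i) \<le> k. c \<alpha> * monom_fun \<alpha> x)"
    using assms(1) by (auto simp: polys_eq_lin_span lin_span_def)
  have "P (\<lambda>x. \<Sum>\<alpha>\<in>A. c \<alpha> * monom_fun \<alpha> x) \<and> (\<lambda>x. \<Sum>\<alpha>\<in>A. c \<alpha> * monom_fun \<alpha> x) \<in> polys k"
    if "finite A" "A \<subseteq> (multi_indices k)" for A
    using that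
  proof (induction A rule: finite_induct)
    case empty
    then show ?case using assms(2) by (simp add: polys_zero)
  next
    case (insert \<alpha> A)
    have m: "monom_fun \<alpha> \<in> polys k" using insert by (auto intro: polys_monom)
    have "P (\<lambda>x. c \<alpha> * monom_fun \<alpha> x + (\<Sum>\<alpha>\<in>A. c \<alpha> * monom_fun \<alpha> x))"
      by (rule add) (use insert m in \<open>auto intro!: assms(4,5) polys_scale\<close>)
    moreover have "(\<lambda>x. c \<alpha> * monom_fun \<alpha> x + (\<Sum>\<alpha>\<in>A. c \<alpha> * monom_fun \<alpha> x)) \<in> polys k"
      by (rule polys_add) (use insert m in \<open>auto intro!: polys_scale\<close>)
    ultimately show ?case using insert by simp
  qed
  then show ?thesis unfolding p using finite_multi_indices by blast
qed

lemma polys_mono: "p \<in> polys j \<Longrightarrow> j \<le> k \<Longrightarrow> p \<in> polys k"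
  by (induction p rule: polys_induct) (auto intro: polys_zero polys_add polys_scale polys_monom)

lemma polys_const: "(\<lambda>x. c) \<in> polys k"
proof -
  have "monom_fun (\<lambda>_. 0) \<in> polys k" by (rule polys_monom) simp
  then show ?thesis using polys_scale[of "monom_fun (\<lambda>_. 0)" k c] by (simp add: monom_fun_def)
qed

lemma monom_fun_add: "monom_fun (\<lambda>i. \<alpha> i + \<beta> i) x = monom_fun \<alpha> x * monom_fun \<beta> x"
  by (simp add: monom_fun_def power_add prod.distrib)

lemma monom_fun_unit: "monom_fun (\<lambda>j. if j = i then 1 else 0) x = x $ i"
proof -
  have "monom_fun (\<lambda>j. if j = i then 1 else 0) x = (\<Prod>j\<in>UNIV. if j = i then x $ j else 1)"
    unfolding monom_fun_def by (intro prod.cong) auto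
  then show ?thesis by simp
qed

lemma polys_component: 
  assumes "1 \<le> k" shows "(\<lambda>x. x $ i) \<in> polys k"
proof -
  have "monom_fun (\<lambda>j. if j = i then 1 else 0) \<in> polys k"
    using assms by (intro polys_monom) simp
  then show ?thesis by (simp add: monom_fun_unit[abs_def])
qed

lemma polys_mult: "p \<in> polys j \<Longrightarrow> q \<in> polys k \<Longrightarrow> (\<lambda>x. p x * q x) \<in> polys (j + k)"
proof (induction p rule: polys_induct)
  case zero
  then show ?case by (simp add: polys_zero)
next
  case (add p q)
  then show ?case by (auto simp: distrib_right intro!: polys_add)
next
  case (scale c p)
  then show ?case by (auto simp: mult.assoc intro!: polys_scale)
next
  case (monom \<alpha>)
  from monom(2,1) show ?case
  proof (induction q rule: polys_induct)
    case zero
    then show ?case by (simp add: polys_zero)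
  next
    case (add p q)
    then show ?case by (auto simp: distrib_left intro!: polys_add)
  next
    case (scale c p)
    then show ?case by (auto simp: mult.left_commute[of _ c] intro!: polys_scale)
  next
    case (monom \<beta>)
    then have "monom_fun (\<lambda>i. \<alpha> i + \<beta> i) \<in> polys (j + k)"
      by (intro polys_monom) (simp add: sum.distrib)
    then show ?case by (simp add: monom_fun_add[abs_def])
  qed
qed

lemma polys_power: "p \<in> polys 1 \<Longrightarrow> (\<lambda>x. p x ^ m) \<in> polys m"
proof (induction m)
  case 0
  show ?case using polys_const[of 1 0] by simp
next
  case (Suc m)
  then show ?case using polys_mult[of p 1 "\<lambda>x. p x ^ m" m] by simp
qed

lemma polys_prod_power:
  assumes "finite A" "\<And>i. i \<in> A \<Longrightarrow> l i \<in> polys 1"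
  shows "(\<lambda>x. \<Prod>i\<in>A. l i x ^ \<alpha> i) \<in> polys (\<Sum>i\<in>A. \<alpha> i)"
  using assms
proof (induction A rule: finite_induct)
  case empty
  show ?case using polys_const[of 1 0] by simp
next
  case (insert a A)
  then show ?case using polys_mult[OF polys_power[of "l a" "\<alpha> a"]] by simp
qed

text \<open>A monomial turns into a product of powers of functions of degree one, with the same
  total degree. This serves for dilations and for oblique projections onto hyperplanes.\<close>

lemma polys_compose_affine:
  assumes "p \<in> polys k" and l: "\<And>i. (\<lambda>x. f x $ i) \<in> polys 1"
  shows "(\<lambda>x. p (f x)) \<in> polys k"
  using assms(1)
proof (induction p rule: polys_induct)
  case (monom \<alpha>)
  then show ?case
    using polys_mono[OF polys_prod_power[of UNIV "\<lambda>i x. f x $ i" \<alpha>]] l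
    by (simp add: monom_fun_def)
qed (auto intro: polys_zero polys_add polys_scale)

lemma polys_affine_inner: "(\<lambda>x. a \<bullet> x + c) \<in> polys 1" for a :: "real^'n"
  unfolding inner_vec_def
  by (intro polys_add polys_const polys_sum) (auto intro!: polys_scale polys_component)

lemma polys_translate_scale:
  assumes "p \<in> polys k" shows "(\<lambda>x. p (a + r *\<^sub>R x)) \<in> polys k"
  by (rule polys_compose_affine[OF assms])
     (auto intro!: polys_add polys_const polys_scale polys_component)

section \<open>Gradients of polynomials\<close>

lemma monom_fun_Suc:
  fixes \<alpha> :: "'n::finite \<Rightarrow> nat"
  assumes "(\<Sum>i\<in>UNIV. \<alpha> i) \<le> Suc k" "\<alpha> i \<noteq> 0"
  obtains \<beta> where "monom_fun \<alpha> = (\<lambda>x. x $ i * monom_fun \<beta> x)" "(\<Sum>i\<in>UNIV. \<beta> i) \<le> k"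
proof
  let ?\<beta> = "\<alpha>(i := \<alpha> i - 1)"
  have eq: "\<alpha> = (\<lambda>j. (if j = i then 1 else 0) + ?\<beta> j)" using assms by auto
  show "monom_fun \<alpha> = (\<lambda>x. x $ i * monom_fun ?\<beta> x)"
    by (subst eq) (simp only: monom_fun_add[abs_def] monom_fun_unit)
  have "(\<Sum>i\<in>UNIV. \<alpha> i) = 1 + (\<Sum>i\<in>UNIV. ?\<beta> i)"
    by (subst (1) eq) (simp only: sum.distrib, simp)
  then show "(\<Sum>i\<in>UNIV. ?\<beta> i) \<le> k" using assms by simp
qed

lemma monom_fun_cases:
  fixes \<alpha> :: "'n::finite \<Rightarrow> nat"
  obtains "monom_fun \<alpha> = (\<lambda>x. 1)" | i where "\<alpha> i \<noteq> 0"
proof (cases "\<forall>i. \<alpha> i = 0")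
  case True
  then have "monom_fun \<alpha> = (\<lambda>x. 1)" by (simp add: monom_fun_def[abs_def])
  then show ?thesis by (rule that(1))
qed (use that(2) in blast)

text \<open>A nonconstant monomial is a coordinate times a monomial of lower degree, so the product
  rule and the induction hypothesis give its gradient. The existential form avoids an explicit
  formula and yields the degree bound at the same time.\<close>

lemma polys_GDERIV_ex:
  fixes p :: "real^'n \<Rightarrow> real"
  assumes "p \<in> polys (Suc k)"
  shows "\<exists>g. (\<forall>x. GDERIV p x :> g x) \<and> (\<forall>i. (\<lambda>x. g x $ i) \<in> polys k)"
  using assms
proof (induction k arbitrary: p)
  \<comment> \<open>Linearity and the constant monomial are the same in the base case and the step.
    What remains is a coordinate times some q of degree at most k.\<close>
  have common: "\<exists>g. (\<forall>x. GDERIV p x :> g x) \<and> (\<forall>i. (\<lambda>x. g x $ i) \<in> polys k)"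
    if p: "p \<in> polys (Suc k)" and mon: "\<And>i (q :: real^'n \<Rightarrow> real). q \<in> polys k \<Longrightarrow>
       \<exists>g. (\<forall>x. GDERIV (\<lambda>x. x $ i * q x) x :> g x) \<and> (\<forall>i. (\<lambda>x. g x $ i) \<in> polys k)"
    for p :: "real^'n \<Rightarrow> real" and k
    using p
  proof (induction p rule: polys_induct)
    case zero
    show ?case by (rule exI[of _ "\<lambda>x. 0"]) (auto simp: GDERIV_const polys_zero)
  next
    case (add p q)
    then obtain g h where "\<forall>x. GDERIV p x :> g x" "\<forall>i. (\<lambda>x. g x $ i) \<in> polys k"
      "\<forall>x. GDERIV q x :> h x" "\<forall>i. (\<lambda>x. h x $ i) \<in> polys k" by blast
    then show ?case by (intro exI[of _ "\<lambda>x. g x + h x"]) (auto intro: GDERIV_add polys_add)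
  next
    case (scale c p)
    then obtain g where g: "\<forall>x. GDERIV p x :> g x" "\<forall>i. (\<lambda>x. g x $ i) \<in> polys k" by blast
    have "GDERIV (\<lambda>x. c * p x) x :> c *\<^sub>R g x" for x
      using GDERIV_mult[OF GDERIV_const[of c x] g(1)[rule_format, of x]] by simp
    with g show ?case by (intro exI[of _ "\<lambda>x. c *\<^sub>R g x"]) (auto intro: polys_scale)
  next
    case (monom \<alpha>)
    show ?case
    proof (cases \<alpha> rule: monom_fun_cases)
      case 1
      show ?thesis unfolding 1 by (rule exI[of _ "\<lambda>x. 0"]) (auto simp: GDERIV_const polys_zero)
    next
      case (2 i)
      obtain \<beta> where \<beta>: "monom_fun \<alpha> = (\<lambda>x. x $ i * monom_fun \<beta> x)" "(\<Sum>i\<in>UNIV. \<beta> i) \<le> k"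
        using monom_fun_Suc[of \<alpha> k i] monom 2 by metis
      show ?thesis unfolding \<beta>(1) by (rule mon[OF polys_monom[OF \<beta>(2)]])
    qed
  qed
  have comp: "GDERIV (\<lambda>x. x $ i) x :> axis i 1" for x :: "real^'n" and i
    unfolding gderiv_def
    using bounded_linear.has_derivative[OF bounded_linear_vec_nth has_derivative_ident]
    by (simp add: inner_axis)
  {
    case 0
    show ?case
    proof (rule common[OF 0])
      fix i and q :: "real^'n \<Rightarrow> real" assume "q \<in> polys 0"
      then obtain c where q: "q = (\<lambda>x. c)"
        by (auto simp: polys_def)
      have "GDERIV (\<lambda>x. x $ i * c) x :> c *\<^sub>R axis i 1" for x :: "real^'n"
        using GDERIV_mult[OF comp GDERIV_const[of c x]] by simp
      then show "\<exists>g. (\<forall>x. GDERIV (\<lambda>x. x $ i * q x) x :> g x) \<and> (\<forall>i. (\<lambda>x. g x $ i) \<in> polys 0)"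
        unfolding q by (intro exI[of _ "\<lambda>x. c *\<^sub>R axis i 1"]) (auto intro: polys_const)
    qed
  next
    case (Suc k)
    show ?case
    proof (rule common[OF Suc(2)])
      fix i and q :: "real^'n \<Rightarrow> real" assume q: "q \<in> polys (Suc k)"
      obtain g where g: "\<forall>x. GDERIV q x :> g x" "\<forall>i. (\<lambda>x. g x $ i) \<in> polys k"
        using Suc(1)[OF q] by blast
      have d: "GDERIV (\<lambda>x. x $ i * q x) x :> x $ i *\<^sub>R g x + q x *\<^sub>R axis i 1" for x
        using GDERIV_mult[OF comp g(1)[rule_format, of x]] .
      have "(\<lambda>x. x $ i * g x $ j) \<in> polys (Suc k)" for j
        using polys_mult[OF polys_component[of 1 i] g(2)[rule_format, of j]] by simp
      moreover have "(\<lambda>x. q x * axis i 1 $ j) \<in> polys (Suc k)" for j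
        using polys_scale[OF q, of "axis i 1 $ j"] by (simp add: mult.commute)
      ultimately show "\<exists>g. (\<forall>x. GDERIV (\<lambda>x. x $ i * q x) x :> g x) \<and> (\<forall>i. (\<lambda>x. g x $ i) \<in> polys (Suc k))"
        using d by (intro exI[of _ "\<lambda>x. x $ i *\<^sub>R g x + q x *\<^sub>R axis i 1"]) (auto intro!: polys_add)
    qed
  }
qed

lemma grad_eq: "GDERIV p x :> D \<Longrightarrow> grad p x = D"
  unfolding grad_def
proof (rule the_equality)
  fix E assume "GDERIV p x :> D" "GDERIV p x :> E"
  then have "(\<lambda>h. h \<bullet> D) = (\<lambda>h. h \<bullet> E)"
    unfolding gderiv_def by (rule has_derivative_unique)
  then have "h \<bullet> (D - E) = 0" for h by (metis inner_diff_right right_minus_eq)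
  then show "E = D" by (metis inner_eq_zero_iff right_minus_eq)
qed

lemma polys_GDERIV_grad:
  fixes p :: "real^'n \<Rightarrow> real"
  assumes "p \<in> polys k" shows "GDERIV p x :> grad p x"
proof -
  have "p \<in> polys (Suc k)" using assms by (rule polys_mono) simp
  then show ?thesis using polys_GDERIV_ex[of p k] grad_eq by metis
qed

lemma polys_grad:
  fixes p :: "real^'n \<Rightarrow> real"
  assumes "p \<in> polys (Suc k)" shows "(\<lambda>x. grad p x $ i) \<in> polys k"
proof -
  obtain g where g: "\<forall>x. GDERIV p x :> g x" "(\<lambda>x. g x $ i) \<in> polys k"
    using polys_GDERIV_ex[OF assms] by blast
  then have "grad p = g" by (auto intro: grad_eq)
  with g show ?thesis by simp
qed

lemma polys_grad':
  fixes p :: "real^'n \<Rightarrow> real"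
  assumes "p \<in> polys k" shows "(\<lambda>x. grad p x $ i) \<in> polys k"
  by (rule polys_grad[OF polys_mono[OF assms]]) simp

lemma polys_grad_inner:
  fixes p :: "real^'n \<Rightarrow> real"
  assumes "p \<in> polys (Suc k)" shows "(\<lambda>x. grad p x \<bullet> v) \<in> polys k"
proof -
  have "(\<lambda>x. \<Sum>i\<in>UNIV. v $ i * grad p x $ i) \<in> polys k"
    by (intro polys_sum polys_scale polys_grad assms) auto
  then show ?thesis by (simp add: inner_vec_def mult.commute)
qed

lemma continuous_on_polys:
  fixes p :: "real^'n \<Rightarrow> real"
  assumes "p \<in> polys k" shows "continuous_on S p"
  using assms
  by (induction p rule: polys_induct) (auto simp: monom_fun_def[abs_def] intro!: continuous_intros)

lemma grad_add:
  fixes p :: "real^'n \<Rightarrow> real"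
  assumes "p \<in> polys j" "q \<in> polys k" shows "grad (\<lambda>x. p x + q x) x = grad p x + grad q x"
  by (intro grad_eq GDERIV_add) (auto intro: polys_GDERIV_grad assms)

lemma grad_scale:
  fixes p :: "real^'n \<Rightarrow> real"
  assumes "p \<in> polys j" shows "grad (\<lambda>x. c * p x) x = c *\<^sub>R grad p x"
proof (rule grad_eq)
  show "GDERIV (\<lambda>x. c * p x) x :> c *\<^sub>R grad p x"
    using GDERIV_mult[OF GDERIV_const[of c x] polys_GDERIV_grad[OF assms]] by simp
qed

lemma grad_mult:
  fixes p :: "real^'n \<Rightarrow> real"
  assumes "p \<in> polys j" "q \<in> polys k"
  shows "grad (\<lambda>x. p x * q x) x = p x *\<^sub>R grad q x + q x *\<^sub>R grad p x"
  by (intro grad_eq GDERIV_mult) (auto intro: polys_GDERIV_grad assms)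

lemma grad_const: "grad (\<lambda>x. c) x = 0"
  by (intro grad_eq GDERIV_const)

section \<open>Polynomials along lines\<close>

lemma polys_line_derivative:
  fixes p :: "real^'n \<Rightarrow> real"
  assumes "p \<in> polys k"
  shows "((\<lambda>t. p (x + t *\<^sub>R v)) has_real_derivative grad p (x + t *\<^sub>R v) \<bullet> v) (at t within S)"
proof -
  have d: "((\<lambda>t. x + t *\<^sub>R v) has_derivative (\<lambda>h. h *\<^sub>R v)) (at t within S)"
    by (auto intro!: derivative_eq_intros)
  have "((\<lambda>t. p (x + t *\<^sub>R v)) has_derivative (\<lambda>h. (h *\<^sub>R v) \<bullet> grad p (x + t *\<^sub>R v))) (at t within S)"
    using has_derivative_compose[OF d, of p "\<lambda>h. h \<bullet> grad p (x + t *\<^sub>R v)"]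
      polys_GDERIV_grad[OF assms, of "x + t *\<^sub>R v"]
    unfolding gderiv_def .
  then show ?thesis
    unfolding has_field_derivative_def
    by (rule has_derivative_eq_rhs) (simp add: fun_eq_iff inner_commute)
qed

lemma polys_line_poly:
  fixes p :: "real^'n \<Rightarrow> real"
  assumes "p \<in> polys k"
  shows "\<exists>q :: real poly. \<forall>t. p (x + t *\<^sub>R v) = poly q t"
  using assms
proof (induction p rule: polys_induct)
  case zero
  show ?case by (rule exI[of _ 0]) simp
next
  case (add p q)
  then show ?case by (metis poly_add)
next
  case (scale c p)
  then show ?case by (metis poly_smult)
next
  case (monom \<alpha>)
  show ?case
    by (rule exI[of _ "\<Prod>i\<in>UNIV. [: x $ i, v $ i :] ^ \<alpha> i"])
       (simp add: monom_fun_def poly_prod algebra_simps)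
qed

text \<open>On the line from the centre through an arbitrary y, the polynomial is univariate with
  infinitely many roots near the centre. It is therefore zero, and its value at parameter 1 is
  \<open>p y\<close>.\<close>

lemma polys_zero_on_ball:
  fixes p :: "real^'n \<Rightarrow> real"
  assumes p: "p \<in> polys k" and r: "0 < r" and z: "\<And>x. x \<in> ball a r \<Longrightarrow> p x = 0"
  shows "p = (\<lambda>x. 0)"
proof
  fix y
  obtain q :: "real poly" where q: "\<And>t. p (a + t *\<^sub>R (y - a)) = poly q t"
    using polys_line_poly[OF p] by blast
  \<comment> \<open>The summand 1 covers the case y = a and keeps all parameters below s strictly
    inside the ball.\<close>
  define s where "s = r / (norm (y - a) + 1)"
  have s: "0 < s" using r by (simp add: s_def add_nonneg_pos)
  have "poly q t = 0" if "t \<in> {0..<s}" for t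
  proof -
    have "norm (t *\<^sub>R (y - a)) \<le> t * (norm (y - a) + 1)" using that by (simp add: mult_left_mono)
    also have "\<dots> < s * (norm (y - a) + 1)" using that by (intro mult_strict_right_mono) (auto simp: add_nonneg_pos)
    also have "\<dots> = r" by (simp add: s_def add_nonneg_eq_0_iff)
    finally show ?thesis using z[of "a + t *\<^sub>R (y - a)"] q by (simp add: dist_norm)
  qed
  then have "{0..<s} \<subseteq> {t. poly q t = 0}" by blast
  then have "infinite {t. poly q t = 0}"
    using s infinite_Ico[of 0 s] by (metis finite_subset)
  then have "q = 0" using poly_roots_finite by blast
  then show "p y = 0" using q[of 1] by simp
qed

section \<open>Volume integrals of polynomials\<close>

text \<open>The volume terms are integrals over \<open>lebesgue_on\<close>, whereas the Fubini and
  transformation arguments run over \<open>lborel\<close>. Integrals with an indicator are the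
  common form.\<close>

lemma lebesgue_on_compact:
  fixes f :: "'a::euclidean_space \<Rightarrow> real"
  assumes "compact S" "continuous_on S f"
  shows "integrable (lebesgue_on S) f"
    and "integral\<^sup>L (lebesgue_on S) f = (\<integral>x. indicator S x * f x \<partial>lborel)"
    and "integrable lborel (\<lambda>x. indicator S x * f x)"
proof -
  have S: "S \<in> sets lebesgue" using assms(1) by (simp add: lmeasurable_compact fmeasurableD)
  have i: "integrable lborel (\<lambda>x. indicator S x * f x)"
    using borel_integrable_compact[OF assms] by simp
  then show "integrable lborel (\<lambda>x. indicator S x * f x)" .
  have m: "(\<lambda>x. indicator S x * f x) \<in> borel_measurable lborel"
    using i by (rule borel_measurable_integrable)
  show "integrable (lebesgue_on S) f"
    using i integrable_completion[OF m] S by (simp add: integrable_restrict_space)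
  show "integral\<^sup>L (lebesgue_on S) f = (\<integral>x. indicator S x * f x \<partial>lborel)"
    using integral_completion[OF m] S by (simp add: integral_restrict_space)
qed

lemma integral_lebesgue_on_mono_set:
  fixes f :: "'a::euclidean_space \<Rightarrow> real"
  assumes "compact S" "compact T" "S \<subseteq> T" "continuous_on T f" "\<And>x. x \<in> T \<Longrightarrow> 0 \<le> f x"
  shows "integral\<^sup>L (lebesgue_on S) f \<le> integral\<^sup>L (lebesgue_on T) f"
proof -
  have cS: "continuous_on S f" using assms(3,4) continuous_on_subset by blast
  show ?thesis
    unfolding lebesgue_on_compact(2)[OF assms(1) cS] lebesgue_on_compact(2)[OF assms(2,4)]
    by (rule integral_mono[OF lebesgue_on_compact(3)[OF assms(1) cS] lebesgue_on_compact(3)[OF assms(2,4)]])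
       (use assms(3,5) in \<open>auto simp: indicator_def\<close>)
qed

lemma integrable_polys:
  "compact S \<Longrightarrow> p \<in> polys k \<Longrightarrow> integrable (lebesgue_on S) p"
  by (rule lebesgue_on_compact(1)[OF _ continuous_on_polys])

lemma integrable_polys_mult:
  "compact S \<Longrightarrow> p \<in> polys j \<Longrightarrow> q \<in> polys k \<Longrightarrow> integrable (lebesgue_on S) (\<lambda>x. p x * q x)"
  by (rule integrable_polys[OF _ polys_mult])

text \<open>Integrability is assumed in every degree because products have degree up to 2 m. Being
  only semidefinite, the product may also be taken over a facet, where nonzero polynomials can
  vanish.\<close>

lemma semi_inner_product_polys:
  fixes M :: "(real^'n) measure"
  assumes M: "\<And>p k. p \<in> polys k \<Longrightarrow> integrable M p"
  shows "semi_inner_product (polys m) (\<lambda>p q. \<integral>x. p x * q x \<partial>M)"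
proof
  fix p q r :: "real^'n \<Rightarrow> real" and c :: real
  assume p: "p \<in> polys m" and q: "q \<in> polys m" and r: "r \<in> polys m"
  show "(\<integral>x. (p x + q x) * r x \<partial>M) = (\<integral>x. p x * r x \<partial>M) + (\<integral>x. q x * r x \<partial>M)"
    using M[OF polys_mult[OF p r]] M[OF polys_mult[OF q r]] by (simp add: distrib_right)
  show "(\<integral>x. c * p x * r x \<partial>M) = c * (\<integral>x. p x * r x \<partial>M)"
    by (simp add: mult.assoc)
qed (auto simp: polys_zero mult.commute intro: polys_add polys_scale)

text \<open>\<open>riesz\<close> represents the functional given by integration against f, inside a
  space that contains both f and \<open>polys k\<close>. Uniqueness depends on the measure: it holds
  for polynomials on an element, but only for their restrictions on a facet.\<close>

lemma L2_projection_exists: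
  fixes M :: "(real^'n) measure"
  assumes M: "\<And>p k. p \<in> polys k \<Longrightarrow> integrable M p" and f: "f \<in> polys m"
  obtains p where "p \<in> polys k" "\<forall>q\<in>polys k. (\<integral>x. (f x - p x) * q x \<partial>M) = 0"
proof -
  interpret semi_inner_product "polys (m + k)" "\<lambda>p q :: real^'n \<Rightarrow> real. \<integral>x. p x * q x \<partial>M"
    by (rule semi_inner_product_polys[OF M])
  have fm: "f \<in> polys (m + k)" using f by (rule polys_mono) simp
  have "\<exists>p\<in>lin_span monom_fun (multi_indices k). \<forall>q\<in>lin_span monom_fun (multi_indices k).
      (\<integral>x. p x * q x \<partial>M) = (\<integral>x. f x * q x \<partial>M)"
  proof (rule riesz[where L = "\<lambda>q. \<integral>x. f x * q x \<partial>M", OF finite_multi_indices])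
    show "monom_fun ` {\<alpha>. sum \<alpha> (UNIV :: 'n set) \<le> k} \<subseteq> polys (m + k)" by (auto intro: polys_monom)
  qed (use fm add_right scale_right null_orthogonal' in auto)
  then obtain p where p: "p \<in> polys k" "\<And>q. q \<in> polys k \<Longrightarrow> (\<integral>x. p x * q x \<partial>M) = (\<integral>x. f x * q x \<partial>M)"
    unfolding polys_eq_lin_span[symmetric] by blast
  have "\<forall>q\<in>polys k. (\<integral>x. (f x - p x) * q x \<partial>M) = 0"
    using p(2) M[OF polys_mult[OF f]] M[OF polys_mult[OF p(1)]] by (simp add: left_diff_distrib)
  with p(1) show ?thesis by (rule that)
qed

text \<open>The integrand is nonnegative, so p vanishes almost everywhere on the ball. Its zero set
  is closed, so p vanishes at every point of the ball, and hence identically.\<close>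

lemma polys_L2_definite:
  fixes p :: "real^'n \<Rightarrow> real"
  assumes "compact S" "ball a r \<subseteq> S" "0 < r" "p \<in> polys k"
    and 0: "(\<integral>x. p x * p x \<partial>lebesgue_on S) = 0"
  shows "p = (\<lambda>x. 0)"
proof (rule polys_zero_on_ball[OF assms(4,3)])
  fix x assume x: "x \<in> ball a r"
  have cont: "continuous_on S (\<lambda>x. p x * p x)"
    by (intro continuous_intros continuous_on_polys[OF assms(4)])
  note i = lebesgue_on_compact[OF assms(1) cont]
  have "AE x in lborel. indicator S x * (p x * p x) = 0"
    using integral_nonneg_eq_0_iff_AE[OF i(3)] 0 i(2) by simp
  then have "AE x in lebesgue. indicator S x * (p x * p x) = 0"
    by (rule AE_completion)
  then have "AE x\<in>ball a r in lebesgue. x \<in> {x. p x = 0}"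
    by eventually_elim (use assms(2) in \<open>auto simp: indicator_def split: if_splits\<close>)
  moreover have "closed {x. p x = 0}"
    using continuous_on_polys[OF assms(4)] by (intro closed_Collect_eq) (auto intro: continuous_intros)
  ultimately show "p x = 0"
    using mem_closed_if_AE_lebesgue_open[OF open_ball _ _ x] by blast
qed

section \<open>Pointwise bounds by norms on balls\<close>

lemma integral_cball_scale:
  fixes f :: "'a::euclidean_space \<Rightarrow> real"
  assumes r: "0 < r" and f: "continuous_on UNIV f"
  shows "(\<integral>x. f x \<partial>lebesgue_on (cball a r))
    = r ^ DIM('a) * (\<integral>x. f (a + r *\<^sub>R x) \<partial>lebesgue_on (cball 0 1))"
proof -
  have c1: "continuous_on (cball a r) f" using f continuous_on_subset by blast
  have c2: "continuous_on (cball 0 1) (\<lambda>x. f (a + r *\<^sub>R x))"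
    by (rule continuous_on_compose2[OF f]) (auto intro!: continuous_intros)
  have [measurable]: "f \<in> borel_measurable borel" using f by (rule borel_measurable_continuous_onI)
  have [measurable]: "(\<lambda>x. indicator (cball a r) x * f x) \<in> borel_measurable borel"
    by (intro borel_measurable_times borel_measurable_indicator) simp_all
  have ind: "indicator (cball a r) (a + r *\<^sub>R x) = (indicator (cball 0 1) x :: real)" for x :: 'a
    using r by (auto simp: indicator_def dist_norm)
  have "(\<integral>x. indicator (cball a r) x * f x \<partial>lborel)
      = (\<integral>x. indicator (cball a r) x * f x \<partial>density (distr lborel borel (\<lambda>x. a + r *\<^sub>R x)) (\<lambda>_. ennreal (\<bar>r\<bar> ^ DIM('a))))"
    using r by (intro arg_cong2[where f = "integral\<^sup>L"] lborel_affine refl) simp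
  also have "\<dots> = (\<integral>x. r ^ DIM('a) * (indicator (cball a r) (a + r *\<^sub>R x) * f (a + r *\<^sub>R x)) \<partial>lborel)"
    using r by (subst integral_density) (auto simp: integral_distr ennreal_power)
  also have "\<dots> = r ^ DIM('a) * (\<integral>x. indicator (cball 0 1) x * f (a + r *\<^sub>R x) \<partial>lborel)"
    unfolding ind by simp
  finally show ?thesis
    using lebesgue_on_compact(2)[OF compact_cball c1] lebesgue_on_compact(2)[OF compact_cball c2] by simp
qed

text \<open>In finite dimension the norm on the unit ball controls the values on a ball of any
  radius M, with a constant depending only on k, n and M.\<close>

lemma polys_pointwise_bound_unit_ball:
  "\<exists>C\<ge>0. \<forall>p\<in>polys k. \<forall>x\<in>cball (0 :: real^'n) M. (p x)\<^sup>2 \<le> C * (\<integral>x. p x * p x \<partial>lebesgue_on (cball 0 1))"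
proof -
  interpret semi_inner_product "polys k" "\<lambda>p q :: real^'n \<Rightarrow> real. \<integral>x. p x * q x \<partial>lebesgue_on (cball 0 1)"
    by (rule semi_inner_product_polys) (rule integrable_polys[OF compact_cball])
  have "\<exists>C\<ge>0. \<forall>p\<in>lin_span monom_fun (multi_indices k). \<forall>x\<in>cball (0 :: real^'n) M.
      (p x)\<^sup>2 \<le> C * (\<integral>x. p x * p x \<partial>lebesgue_on (cball 0 1))"
  proof (rule evaluation_bounded[OF finite_multi_indices])
    show "monom_fun ` {\<alpha>. sum \<alpha> (UNIV :: 'n set) \<le> k} \<subseteq> polys k"
      by (auto intro: polys_monom)
    fix f :: "real^'n \<Rightarrow> real" and x assume f: "f \<in> polys k"
    show "bounded (f ` cball 0 M)"
      by (intro compact_imp_bounded compact_continuous_image continuous_on_polys[OF f] compact_cball)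
    assume "(\<integral>x. f x * f x \<partial>lebesgue_on (cball 0 1)) = 0"
    then show "f x = 0"
      using polys_L2_definite[OF compact_cball ball_subset_cball zero_less_one f] by metis
  qed
  then show ?thesis unfolding polys_eq_lin_span .
qed

text \<open>Dilation to the unit ball produces the factor r^(-n). The integral is enlarged from the
  inscribed ball to T only afterwards, so the shape of T does not influence the constant.\<close>

lemma polys_pointwise_bound:
  obtains C where "C > 0"
    "\<And>p (a :: real^'n) r T x. p \<in> polys k \<Longrightarrow> 0 < r \<Longrightarrow> cball a r \<subseteq> T \<Longrightarrow> compact T \<Longrightarrow> x \<in> cball a (M * r)
      \<Longrightarrow> (p x)\<^sup>2 \<le> C / r ^ CARD('n) * (\<integral>x. (p x)\<^sup>2 \<partial>lebesgue_on T)"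
proof -
  obtain C where C: "C \<ge> 0" "\<And>(p :: real^'n \<Rightarrow> real) x. p \<in> polys k \<Longrightarrow> x \<in> cball 0 M \<Longrightarrow>
    (p x)\<^sup>2 \<le> C * (\<integral>x. p x * p x \<partial>lebesgue_on (cball 0 1))"
    using polys_pointwise_bound_unit_ball[of k M] by blast
  show ?thesis
  proof (rule that)
    \<comment> \<open>The summand 1 makes the constant strictly positive.\<close>
    show "C + 1 > 0" using C by simp
    fix p :: "real^'n \<Rightarrow> real" and a :: "real^'n" and r :: real and T :: "(real^'n) set" and x :: "real^'n"
    assume p: "p \<in> polys k" and r: "0 < r" and T: "cball a r \<subseteq> T" "compact T" and x: "x \<in> cball a (M * r)"
    have cont: "continuous_on S (\<lambda>x. (p x)\<^sup>2)" for S by (intro continuous_intros continuous_on_polys[OF p])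
    have "dist a x \<le> M * r" using x by simp
    then have y: "(1 / r) *\<^sub>R (x - a) \<in> cball 0 M"
      using r by (simp add: dist_norm norm_minus_commute divide_le_eq)
    have "(p x)\<^sup>2 \<le> C * (\<integral>x. (p (a + r *\<^sub>R x))\<^sup>2 \<partial>lebesgue_on (cball 0 1))"
      using C(2)[OF polys_translate_scale[OF p, of a r] y] r by (simp add: power2_eq_square)
    also have "\<dots> = C / r ^ CARD('n) * (\<integral>x. (p x)\<^sup>2 \<partial>lebesgue_on (cball a r))"
      using r by (subst integral_cball_scale[OF r cont]) simp
    also have "\<dots> \<le> C / r ^ CARD('n) * (\<integral>x. (p x)\<^sup>2 \<partial>lebesgue_on T)"
      using C(1) r by (intro mult_left_mono integral_lebesgue_on_mono_set T cont) auto
    also have "\<dots> \<le> (C + 1) / r ^ CARD('n) * (\<integral>x. (p x)\<^sup>2 \<partial>lebesgue_on T)"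
      using r by (intro mult_right_mono divide_right_mono) auto
    finally show "(p x)\<^sup>2 \<le> (C + 1) / r ^ CARD('n) * (\<integral>x. (p x)\<^sup>2 \<partial>lebesgue_on T)" .
  qed
qed

text \<open>Both measures are compared on boxes: the preimage of a box is the image of a translated
  box under the inverse matrix B, which scales volume by |det B|. As an identity of measures the
  result composes with further image measures.\<close>

lemma lborel_linear:
  fixes A :: "real^'n::{finite,wellorder}^'n::_"
  assumes d: "det A \<noteq> 0"
  shows "lborel = density (distr lborel borel (\<lambda>x. a + A *v x)) (\<lambda>_. ennreal \<bar>det A\<bar>)" (is "_ = ?D")
proof (rule lborel_eqI)
  obtain B where B: "A ** B = mat 1" "B ** A = mat 1"
    using d invertible_det_nz[of A] by (auto simp: invertible_def)
  have detB: "det A * det B = 1" using B(1) det_mul[of A B] by simp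
  have [measurable]: "(\<lambda>x. a + A *v x) \<in> borel \<rightarrow>\<^sub>M borel"
    by (intro borel_measurable_continuous_onI continuous_intros matrix_vector_mult_linear_continuous_on)
  fix l u :: "real^'n::_" assume le: "\<And>b. b \<in> Basis \<Longrightarrow> l \<bullet> b \<le> u \<bullet> b"
  have pre: "(\<lambda>x. a + A *v x) -` box l u = (*v) B ` box (l - a) (u - a)"
  proof (intro set_eqI iffI)
    fix x assume "x \<in> (\<lambda>x. a + A *v x) -` box l u"
    then have "A *v x \<in> box (l - a) (u - a)" by (auto simp: box_def inner_diff_left inner_add_left algebra_simps)
    moreover have "x = B *v (A *v x)" by (simp add: matrix_vector_mul_assoc B)
    ultimately show "x \<in> (*v) B ` box (l - a) (u - a)" by blast
  next
    fix x assume "x \<in> (*v) B ` box (l - a) (u - a)"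
    then obtain y where "x = B *v y" "y \<in> box (l - a) (u - a)" by blast
    then show "x \<in> (\<lambda>x. a + A *v x) -` box l u"
      by (auto simp: matrix_vector_mul_assoc B box_def inner_diff_left inner_add_left algebra_simps)
  qed
  have lm: "(*v) B ` box (l - a) (u - a) \<in> lmeasurable"
    and m: "measure lebesgue ((*v) B ` box (l - a) (u - a)) = \<bar>det B\<bar> * measure lebesgue (box (l - a) (u - a))"
    using measurable_linear_image[of "(*v) B" "box (l - a) (u - a)"] measure_linear_image[of "(*v) B" "box (l - a) (u - a)"]
    by simp_all
  have S: "(\<lambda>x. a + A *v x) -` box l u \<in> sets borel"
    using measurable_sets_borel[of "\<lambda>x. a + A *v x" borel "box l u"] by simp
  have "emeasure ?D (box l u) = \<bar>det A\<bar> * emeasure lborel ((\<lambda>x. a + A *v x) -` box l u)"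
    by (simp add: emeasure_density emeasure_distr nn_integral_cmult)
  also have "\<dots> = \<bar>det A\<bar> * emeasure lebesgue ((*v) B ` box (l - a) (u - a))"
    using S pre by (simp add: emeasure_completion)
  also have "\<dots> = ennreal (\<bar>det A\<bar> * (\<bar>det B\<bar> * measure lebesgue (box (l - a) (u - a))))"
    using lm m by (simp add: emeasure_eq_measure2 ennreal_mult)
  also have "\<bar>det A\<bar> * (\<bar>det B\<bar> * measure lebesgue (box (l - a) (u - a))) = measure lebesgue (box (l - a) (u - a))"
    using detB by (simp add: abs_mult[symmetric] mult.assoc[symmetric])
  also have "\<dots> = (\<Prod>b\<in>Basis. (u - l) \<bullet> b)"
    using le by (subst measure_completion) (auto simp: measure_lborel_box_eq inner_diff_left)
  finally show "emeasure ?D (box l u) = (\<Prod>b\<in>Basis. (u - l) \<bullet> b)" .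
qed simp

section \<open>Parametrisation of flat pieces\<close>

text \<open>This makes the predicate under \<open>SOME\<close> in \<open>surface_measure\<close>
  satisfiable.\<close>

lemma exists_orthonormal_basis:
  fixes V :: "'a::euclidean_space set"
  shows "\<exists>B. pairwise orthogonal B \<and> (\<forall>b\<in>B. norm b = 1) \<and> span B = span V"
proof -
  obtain B where "pairwise orthogonal B" "\<And>b. b \<in> B \<Longrightarrow> norm b = 1" "span B = span V"
    using orthonormal_basis_subspace[OF subspace_span[of V]] by metis
  then show ?thesis by blast
qed

text \<open>This is Cramer's lemma for the identity matrix.\<close>

lemma det_replace_column:
  fixes w :: "real^'n"
  shows "det (\<chi> i k. if k = j then w $ i else if i = k then 1 else 0) = w $ j"
proof -
  have "(\<chi> i k. if k = j then w $ i else if i = k then 1 else 0)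
      = ((\<chi> i k. if k = j then ((mat 1 :: real^'n^'n) *v w) $ i else (mat 1 :: real^'n^'n) $ i $ k) :: real^'n^'n)"
    unfolding matrix_vector_mul_lid by (simp add: vec_eq_iff mat_def)
  then show ?thesis using cramer_lemma[of j "mat 1 :: real^'n^'n" w] by simp
qed

text \<open>Multiplying by the transpose of the orthogonal matrix with columns \<open>g i\<close> and \<open>\<nu>\<close> leaves the
  unit matrix with its \<open>j\<close>-th column replaced.\<close>

lemma det_orthonormal_columns:
  fixes g :: "'n \<Rightarrow> real^'n" and e \<nu> :: "real^'n"
  assumes g: "\<And>i k. i \<noteq> j \<Longrightarrow> k \<noteq> j \<Longrightarrow> g i \<bullet> g k = (if i = k then 1 else 0)"
    and gn: "\<And>i. i \<noteq> j \<Longrightarrow> g i \<bullet> \<nu> = 0" and n: "\<nu> \<bullet> \<nu> = 1"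
  shows "\<bar>det (\<chi> r i. (if i = j then e else g i) $ r)\<bar> = \<bar>\<nu> \<bullet> e\<bar>"
proof -
  define M where "M e = (\<chi> r i. (if i = j then e else g i) $ r)" for e :: "real^'n"
  have *: "det (transpose (M \<nu>)) * det (M e) = \<nu> \<bullet> e" for e
  proof -
    define w where "w = (\<chi> i. (if i = j then \<nu> else g i) \<bullet> e)"
    have ent: "(transpose (M \<nu>) ** M e) $ i $ k = (if i = j then \<nu> else g i) \<bullet> (if k = j then e else g k)" for i k
      unfolding matrix_matrix_mult_def transpose_def M_def inner_vec_def by simp
    have "transpose (M \<nu>) ** M e = (\<chi> i k. if k = j then w $ i else if i = k then 1 else 0)"
    proof (intro vec_eq_iff[THEN iffD2] allI)
      fix i k
      show "(transpose (M \<nu>) ** M e) $ i $ k = (\<chi> i k. if k = j then w $ i else if i = k then 1 else 0) $ i $ k"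
        unfolding ent w_def using g[of i k] gn[of k] by (auto simp: inner_commute[of \<nu>])
    qed
    then have "det (transpose (M \<nu>) ** M e) = w $ j" by (simp only: det_replace_column)
    then show ?thesis by (simp add: det_mul w_def)
  qed
  have "det (M \<nu>) * det (M \<nu>) = 1" using *[of \<nu>] n by simp
  then have "\<bar>det (M \<nu>)\<bar> = 1" by (auto simp: square_eq_1_iff)
  moreover have "\<bar>det (M \<nu>)\<bar> * \<bar>det (M e)\<bar> = \<bar>\<nu> \<bullet> e\<bar>" using *[of e] by (simp add: abs_mult[symmetric])
  ultimately have "\<bar>det (M e)\<bar> = \<bar>\<nu> \<bullet> e\<bar>" by simp
  then show ?thesis by (simp only: M_def)
qed

lemma prod_Basis_vec: "(\<Prod>b\<in>(Basis :: (real^'n) set). f b) = (\<Prod>i\<in>UNIV. f (axis i 1))"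
proof -
  have *: "(Basis :: (real^'n) set) = range (\<lambda>i. axis i 1)" by (auto simp: Basis_vec_def)
  have "inj (\<lambda>i :: 'n. axis i (1 :: real))" by (auto simp: inj_def axis_eq_axis)
  then show ?thesis unfolding * by (subst prod.reindex) auto
qed

lemma measurable_product_coordinates:
  fixes g :: "'n::finite \<Rightarrow> 'b" and B :: "'b set" and j :: 'n
  assumes bij: "bij_betw g (UNIV - {j}) B"
  shows "(\<lambda>(c, s). \<chi> i. if i = j then s else c (g i)) \<in> (\<Pi>\<^sub>M b\<in>B. lborel) \<Otimes>\<^sub>M lborel \<rightarrow>\<^sub>M (borel :: (real^'n) measure)"
    (is "?T \<in> ?P \<rightarrow>\<^sub>M _")
proof -
  have gB: "g i \<in> B" if "i \<noteq> j" for i using bij that by (auto simp: bij_betw_def)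
  show ?thesis
    unfolding borel_measurable_euclidean_space[of ?T]
  proof
    fix b :: "real^'n" assume "b \<in> Basis"
    then obtain i where b: "b = axis i 1" by (auto simp: Basis_vec_def)
    show "(\<lambda>x. ?T x \<bullet> b) \<in> borel_measurable ?P"
    proof (cases "i = j")
      case True
      then have "(\<lambda>x. ?T x \<bullet> b) = snd" by (auto simp: b inner_axis fun_eq_iff)
      then show ?thesis using measurable_snd[of "\<Pi>\<^sub>M b\<in>B. lborel" "lborel :: real measure"] by (simp add: measurable_lborel1)
    next
      case False
      then have "(\<lambda>x. ?T x \<bullet> b) = (\<lambda>x. fst x (g i))" by (auto simp: b inner_axis fun_eq_iff)
      moreover have "(\<lambda>c. c (g i)) \<in> (\<Pi>\<^sub>M b\<in>B. lborel) \<rightarrow>\<^sub>M (lborel :: real measure)"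
        by (rule measurable_component_singleton[OF gB[OF False]])
      from measurable_compose[OF measurable_fst this]
      have "(\<lambda>x. fst x (g i)) \<in> ?P \<rightarrow>\<^sub>M (lborel :: real measure)" .
      ultimately show ?thesis by (simp add: measurable_lborel1)
    qed
  qed
qed

text \<open>Both measures agree on boxes. The product is indexed by basis vectors because the one in
  \<open>surface_measure\<close> is; g relabels them by the coordinates other than j, and coordinate
  j is kept for the transversal direction.\<close>

lemma lborel_eq_distr_product:
  fixes g :: "'n::finite \<Rightarrow> 'b" and B :: "'b set" and j :: 'n
  assumes bij: "bij_betw g (UNIV - {j}) B"
  shows "(lborel :: (real^'n) measure)
    = distr ((\<Pi>\<^sub>M b\<in>B. lborel) \<Otimes>\<^sub>M lborel) borel (\<lambda>(c, s). \<chi> i. if i = j then s else c (g i))" (is "_ = distr ?P borel ?T")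
proof (rule lborel_eqI)
  have fB: "finite B" using bij by (metis bij_betw_finite finite)
  interpret product_sigma_finite "\<lambda>_ :: 'b. lborel :: real measure" by standard
  interpret N: sigma_finite_measure "\<Pi>\<^sub>M b\<in>B. (lborel :: real measure)" by (rule sigma_finite[OF fB])
  have gB: "g i \<in> B" if "i \<noteq> j" for i using bij that by (auto simp: bij_betw_def)
  have T[measurable]: "?T \<in> ?P \<rightarrow>\<^sub>M borel"
    by (rule measurable_product_coordinates[OF bij])
  show "sets (distr ?P borel ?T) = sets borel" by simp
  fix l u :: "real^'n" assume le: "\<And>b. b \<in> Basis \<Longrightarrow> l \<bullet> b \<le> u \<bullet> b"
  have le': "l $ i \<le> u $ i" for i using le[of "axis i 1"] by (simp add: inner_axis axis_in_Basis_iff)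
  define h where "h = the_inv_into (UNIV - {j}) g"
  have hg: "h (g i) = i" if "i \<noteq> j" for i
    using bij that unfolding h_def bij_betw_def by (intro the_inv_into_f_f) auto
  have pre: "?T -` box l u \<inter> space ?P = (\<Pi>\<^sub>E b\<in>B. {l $ h b <..< u $ h b}) \<times> {l $ j <..< u $ j}"
  proof (intro set_eqI iffI)
    fix x assume "x \<in> ?T -` box l u \<inter> space ?P"
    then obtain c s where x: "x = (c, s)" and c: "c \<in> extensional B"
      and box: "(\<chi> i. if i = j then s else c (g i)) \<in> box l u"
      by (cases x) (auto simp: space_pair_measure space_PiM PiE_def)
    have "l $ h b < c b \<and> c b < u $ h b" if bB: "b \<in> B" for b
    proof -
      obtain i where "i \<noteq> j" "b = g i" using bij bB unfolding bij_betw_def by blast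
      then show ?thesis using box hg by (auto simp: mem_box_cart dest: spec[of _ i])
    qed
    moreover have "l $ j < s \<and> s < u $ j" using box by (auto simp: mem_box_cart dest: spec[of _ j])
    ultimately show "x \<in> (\<Pi>\<^sub>E b\<in>B. {l $ h b <..< u $ h b}) \<times> {l $ j <..< u $ j}"
      using c by (auto simp: x PiE_def)
  next
    fix x assume "x \<in> (\<Pi>\<^sub>E b\<in>B. {l $ h b <..< u $ h b}) \<times> {l $ j <..< u $ j}"
    then obtain c s where x: "x = (c, s)" and c: "c \<in> (\<Pi>\<^sub>E b\<in>B. {l $ h b <..< u $ h b})"
      and s: "l $ j < s" "s < u $ j" by auto
    have "l $ i < c (g i) \<and> c (g i) < u $ i" if "i \<noteq> j" for i
      using PiE_mem[OF c gB[OF that]] hg[OF that] by simp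
    then show "x \<in> ?T -` box l u \<inter> space ?P"
      using c s by (auto simp: x mem_box_cart space_pair_measure space_PiM PiE_def)
  qed
  have "emeasure (distr ?P borel ?T) (box l u) = emeasure ?P ((\<Pi>\<^sub>E b\<in>B. {l $ h b <..< u $ h b}) \<times> {l $ j <..< u $ j})"
    using pre by (subst emeasure_distr) auto
  also have "\<dots> = emeasure (\<Pi>\<^sub>M b\<in>B. lborel) (\<Pi>\<^sub>E b\<in>B. {l $ h b <..< u $ h b}) * emeasure lborel {l $ j <..< u $ j}"
    by (rule lborel.emeasure_pair_measure_Times) (auto intro!: sets_PiM_I_finite fB)
  also have "\<dots> = (\<Prod>b\<in>B. ennreal (u $ h b - l $ h b)) * ennreal (u $ j - l $ j)"
    using le' by (subst emeasure_PiM[OF fB]) auto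
  also have "(\<Prod>b\<in>B. ennreal (u $ h b - l $ h b)) = (\<Prod>i\<in>UNIV - {j}. ennreal (u $ i - l $ i))"
    by (subst prod.reindex_bij_betw[OF bij, symmetric]) (auto simp: hg)
  also have "\<dots> * ennreal (u $ j - l $ j) = (\<Prod>i\<in>UNIV. ennreal (u $ i - l $ i))"
    by (subst (2) prod.remove[of _ j]) (auto simp: mult.commute)
  also have "\<dots> = ennreal (\<Prod>b\<in>Basis. (u - l) \<bullet> b)"
    using le' by (simp add: prod_Basis_vec inner_axis prod_ennreal)
  finally show "emeasure (distr ?P borel ?T) (box l u) = ennreal (\<Prod>b\<in>Basis. (u - l) \<bullet> b)" .
qed

text \<open>\<open>N\<close> and \<open>\<psi>\<close> are the product measure and the
  parametrisation inside \<open>surface_measure\<close>. The factor |\<nu> . e| is the absolute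
  determinant of the matrix whose columns are the orthonormal basis of the hyperplane and e. The
  direction e stays free because both normals and edges of a simplex are used for it.\<close>

lemma surface_measure_parametrization:
  fixes F :: "(real^'n::{finite,wellorder}) set"
  assumes ne: "F \<noteq> {}" and dir: "span {x - y | x y. x \<in> F \<and> y \<in> F} = {v. \<nu> \<bullet> v = 0}" and n: "norm \<nu> = 1"
  obtains N :: "(real^'n::_ \<Rightarrow> real) measure" and \<psi> :: "(real^'n::_ \<Rightarrow> real) \<Rightarrow> real^'n::_" where
    "sigma_finite_measure N" "\<psi> \<in> N \<rightarrow>\<^sub>M borel"
    "surface_measure F = restrict_space (distr N borel \<psi>) F"
    "\<forall>c. \<forall>a\<in>F. \<nu> \<bullet> (\<psi> c - a) = 0"
    "\<forall>e. \<nu> \<bullet> e \<noteq> 0 \<longrightarrow>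
      lborel = density (distr (N \<Otimes>\<^sub>M lborel) borel (\<lambda>(c, s). \<psi> c + s *\<^sub>R e)) (\<lambda>_. ennreal \<bar>\<nu> \<bullet> e\<bar>)"
proof -
  define a where "a = (SOME a. a \<in> F)"
  have aF: "a \<in> F" unfolding a_def using ne by (simp add: some_in_eq)
  define B where "B = (SOME B. pairwise orthogonal B \<and> (\<forall>b\<in>B. norm b = 1) \<and>
                 span B = span {x - y | x y. x \<in> F \<and> y \<in> F})"
  have B: "pairwise orthogonal B \<and> (\<forall>b\<in>B. norm b = 1) \<and> span B = {v. \<nu> \<bullet> v = 0}"
    unfolding B_def dir[symmetric] by (rule someI_ex[OF exists_orthonormal_basis])
  then have orth: "pairwise orthogonal B" and nB: "\<And>b. b \<in> B \<Longrightarrow> norm b = 1"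
    and sB: "span B = {v. \<nu> \<bullet> v = 0}"
    by simp_all
  have nn: "\<nu> \<bullet> \<nu> = 1" using n by (simp add: norm_eq_1)
  then have n0: "\<nu> \<noteq> 0" by auto
  have ind: "independent B"
    by (rule pairwise_orthogonal_independent[OF orth]) (use nB in force)
  then have fB: "finite B" by (rule independent_imp_finite)
  have "card B = dim (span B)" using ind by (simp add: dim_eq_card_independent)
  then have cB: "card B = CARD('n) - 1" by (simp add: sB dim_hyperplane[OF n0])
  have nuB: "\<nu> \<bullet> b = 0" if "b \<in> B" for b using span_base[OF that] sB by auto
  \<comment> \<open>Any coordinate can serve as the slot of the transversal direction.\<close>
  obtain j :: 'n where True by simp
  have "card (UNIV - {j}) = card B" by (simp add: cB)
  then obtain g where bij: "bij_betw g (UNIV - {j}) B"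
    using finite_same_card_bij[of "UNIV - {j}" B] fB by auto
  have gB: "g i \<in> B" if "i \<noteq> j" for i using bij that by (auto simp: bij_betw_def)
  have gg: "g i \<bullet> g k = (if i = k then 1 else 0)" if "i \<noteq> j" "k \<noteq> j" for i k
  proof (cases "i = k")
    case True
    then show ?thesis using nB[OF gB[OF that(1)]] by (simp add: norm_eq_1)
  next
    case False
    then have "g i \<noteq> g k" using bij that by (auto simp: bij_betw_def inj_on_def)
    then show ?thesis using orth gB that False by (auto simp: pairwise_def orthogonal_def)
  qed
  define N where "N = (\<Pi>\<^sub>M b\<in>B. (lborel :: real measure))"
  define \<psi> where "\<psi> = (\<lambda>c. a + (\<Sum>b\<in>B. c b *\<^sub>R b))"
  interpret product_sigma_finite "\<lambda>_ :: real^'n::_. lborel :: real measure" by standard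
  have sN: "sigma_finite_measure N" unfolding N_def by (rule sigma_finite[OF fB])
  have m[measurable]: "\<psi> \<in> N \<rightarrow>\<^sub>M borel"
    unfolding \<psi>_def N_def by measurable
  have surf: "surface_measure F = restrict_space (distr N borel \<psi>) F"
    unfolding surface_measure_def Let_def N_def \<psi>_def a_def B_def ..
  have hyp: "\<nu> \<bullet> (\<psi> c - a') = 0" if "a' \<in> F" for c a'
  proof -
    have "a - a' \<in> span {x - y | x y. x \<in> F \<and> y \<in> F}" using aF that by (intro span_base) blast
    then have "\<nu> \<bullet> (a - a') = 0" by (simp add: dir)
    then show ?thesis by (simp add: \<psi>_def inner_diff_right inner_add_right inner_sum_right nuB)
  qed
  have fub: "lborel = density (distr (N \<Otimes>\<^sub>M lborel) borel (\<lambda>(c, s). \<psi> c + s *\<^sub>R e)) (\<lambda>_. ennreal \<bar>\<nu> \<bullet> e\<bar>)"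
    if e: "\<nu> \<bullet> e \<noteq> 0" for e
  proof -
    define A :: "real^'n::_^'n::_" where "A = (\<chi> r i. (if i = j then e else g i) $ r)"
    have det: "\<bar>det A\<bar> = \<bar>\<nu> \<bullet> e\<bar>"
      unfolding A_def
    proof (rule det_orthonormal_columns)
      show "g i \<bullet> \<nu> = 0" if "i \<noteq> j" for i using nuB[OF gB[OF that]] by (simp only: inner_commute)
    qed (use gg nn in blast)+
    then have "det A \<noteq> 0" using e by auto
    note lin = lborel_linear[OF this, of a]
    define T :: "(real^'n::_ \<Rightarrow> real) \<times> real \<Rightarrow> real^'n::_" where "T = (\<lambda>(c, s). \<chi> i. if i = j then s else c (g i))"
    have lb: "(lborel :: (real^'n::_) measure) = distr (N \<Otimes>\<^sub>M lborel) borel T"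
      unfolding N_def T_def by (rule lborel_eq_distr_product[OF bij])
    have AT: "a + A *v T (c, s) = \<psi> c + s *\<^sub>R e" for c s
    proof -
      have "A *v T (c, s) = (\<Sum>i\<in>UNIV. T (c, s) $ i *\<^sub>R (if i = j then e else g i))"
        by (simp add: matrix_mult_sum A_def column_def scalar_mult_eq_scaleR)
      also have "\<dots> = s *\<^sub>R e + (\<Sum>i\<in>UNIV - {j}. c (g i) *\<^sub>R g i)"
        by (subst sum.remove[of _ j]) (auto simp: T_def)
      also have "(\<Sum>i\<in>UNIV - {j}. c (g i) *\<^sub>R g i) = (\<Sum>b\<in>B. c b *\<^sub>R b)"
        by (rule sum.reindex_bij_betw[OF bij])
      finally show ?thesis by (simp add: \<psi>_def)
    qed
    have Tm: "T \<in> N \<Otimes>\<^sub>M lborel \<rightarrow>\<^sub>M borel"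
      unfolding N_def T_def by (rule measurable_product_coordinates[OF bij])
    have Am: "(\<lambda>x. a + A *v x) \<in> borel \<rightarrow>\<^sub>M borel"
      by (intro borel_measurable_continuous_onI continuous_intros matrix_vector_mult_linear_continuous_on)
    have "distr lborel borel (\<lambda>x. a + A *v x) = distr (N \<Otimes>\<^sub>M lborel) borel ((\<lambda>x. a + A *v x) \<circ> T)"
      by (subst lb) (simp add: distr_distr[OF Am Tm])
    also have "(\<lambda>x. a + A *v x) \<circ> T = (\<lambda>(c, s). \<psi> c + s *\<^sub>R e)"
      using AT by (auto simp: fun_eq_iff)
    finally show ?thesis using lin det by simp
  qed
  show ?thesis by (rule that[OF sN m surf]) (use hyp fub in blast)+
qed

text \<open>Fubini along the lines in direction e through the hyperplane of F. Prescribing the line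
  integrals as h on F and as 0 on the rest of the hyperplane leaves an integral over F
  alone.\<close>

lemma surface_measure_fubini:
  fixes F :: "(real^'n::{finite,wellorder}) set"
  assumes F: "compact F" and dir: "span {x - y | x y. x \<in> F \<and> y \<in> F} = {v. \<nu> \<bullet> v = 0}"
    and n: "norm \<nu> = 1" and e: "\<nu> \<bullet> e \<noteq> 0" and a: "a \<in> F" and g: "integrable lborel g"
    and h: "\<And>y. y \<in> F \<Longrightarrow> (\<integral>s. g (y + s *\<^sub>R e) \<partial>lborel) = h y"
    and 0: "\<And>y. \<nu> \<bullet> (y - a) = 0 \<Longrightarrow> y \<notin> F \<Longrightarrow> (\<integral>s. g (y + s *\<^sub>R e) \<partial>lborel) = 0"
    and hm: "(\<lambda>y. indicator F y * h y) \<in> borel_measurable borel"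
  shows "integrable (surface_measure F) h"
    and "integral\<^sup>L lborel g = \<bar>\<nu> \<bullet> e\<bar> * integral\<^sup>L (surface_measure F) (h :: _ \<Rightarrow> real)"
proof -
  have "F \<noteq> {}" using a by auto
  obtain N :: "(real^'n::_ \<Rightarrow> real) measure" and \<psi> where N: "sigma_finite_measure N" and \<psi>[measurable]: "\<psi> \<in> N \<rightarrow>\<^sub>M borel"
    and surf: "surface_measure F = restrict_space (distr N borel \<psi>) F"
    and hyp': "\<forall>c. \<forall>a\<in>F. \<nu> \<bullet> (\<psi> c - a) = 0"
    and fub': "\<forall>e. \<nu> \<bullet> e \<noteq> 0 \<longrightarrow>
      lborel = density (distr (N \<Otimes>\<^sub>M lborel) borel (\<lambda>(c, s). \<psi> c + s *\<^sub>R e)) (\<lambda>_. ennreal \<bar>\<nu> \<bullet> e\<bar>)"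
    by (rule surface_measure_parametrization[OF \<open>F \<noteq> {}\<close> dir n]) (rule that)
  note hyp = hyp'[rule_format, OF a] and fub = fub'[rule_format, OF e]
  interpret N: sigma_finite_measure N by fact
  interpret P: pair_sigma_finite N lborel by standard
  have gm[measurable]: "g \<in> borel_measurable borel" using g by auto
  have \<Psi>[measurable]: "(\<lambda>(c, s). \<psi> c + s *\<^sub>R e) \<in> N \<Otimes>\<^sub>M lborel \<rightarrow>\<^sub>M borel" by measurable
  have FS: "F \<in> sets borel" using F by (rule borel_compact)
  have "integrable (density (distr (N \<Otimes>\<^sub>M lborel) borel (\<lambda>(c, s). \<psi> c + s *\<^sub>R e)) (\<lambda>_. ennreal \<bar>\<nu> \<bullet> e\<bar>)) g"
    unfolding fub[symmetric] by (rule g)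
  then have "integrable (distr (N \<Otimes>\<^sub>M lborel) borel (\<lambda>(c, s). \<psi> c + s *\<^sub>R e)) (\<lambda>x. \<bar>\<nu> \<bullet> e\<bar> *\<^sub>R g x)"
    by (subst (asm) integrable_density) auto
  then have "integrable (distr (N \<Otimes>\<^sub>M lborel) borel (\<lambda>(c, s). \<psi> c + s *\<^sub>R e)) g"
    using e by simp
  then have i: "integrable (N \<Otimes>\<^sub>M lborel) (\<lambda>(c, s). g (\<psi> c + s *\<^sub>R e))"
    by (subst (asm) integrable_distr_eq) (auto simp: split_beta')
  have eq: "(\<integral>s. g (\<psi> c + s *\<^sub>R e) \<partial>lborel) = indicator F (\<psi> c) * h (\<psi> c)" for c
    using h[of "\<psi> c"] 0[OF hyp, of c] by (auto simp: indicator_def)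
  have "integrable N (\<lambda>c. \<integral>s. g (\<psi> c + s *\<^sub>R e) \<partial>lborel)"
    using P.integrable_fst'[OF i] by simp
  then have ih: "integrable N (\<lambda>c. indicator F (\<psi> c) * h (\<psi> c))" unfolding eq .
  show "integrable (surface_measure F) h"
    unfolding surf using ih FS hm
    by (simp add: integrable_restrict_space integrable_distr_eq)
  have "integral\<^sup>L lborel g
    = integral\<^sup>L (density (distr (N \<Otimes>\<^sub>M lborel) borel (\<lambda>(c, s). \<psi> c + s *\<^sub>R e)) (\<lambda>_. ennreal \<bar>\<nu> \<bullet> e\<bar>)) g"
    by (rule arg_cong[OF fub])
  also have "\<dots> = \<bar>\<nu> \<bullet> e\<bar> * (\<integral>x. g x \<partial>distr (N \<Otimes>\<^sub>M lborel) borel (\<lambda>(c, s). \<psi> c + s *\<^sub>R e))"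
    by (subst integral_density) auto
  also have "(\<integral>x. g x \<partial>distr (N \<Otimes>\<^sub>M lborel) borel (\<lambda>(c, s). \<psi> c + s *\<^sub>R e))
    = (\<integral>x. (case x of (c, s) \<Rightarrow> g (\<psi> c + s *\<^sub>R e)) \<partial>(N \<Otimes>\<^sub>M lborel))"
    by (subst integral_distr) (auto simp: split_beta')
  also have "\<dots> = (\<integral>c. \<integral>s. g (\<psi> c + s *\<^sub>R e) \<partial>lborel \<partial>N)"
    using P.integral_fst'[OF i] by simp
  also have "\<dots> = integral\<^sup>L (surface_measure F) h"
    unfolding surf eq using FS hm by (simp add: integral_restrict_space integral_distr)
  finally show "integral\<^sup>L lborel g = \<bar>\<nu> \<bullet> e\<bar> * integral\<^sup>L (surface_measure F) h" .
qed

section \<open>Surface integrals on flat pieces\<close>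

text \<open>The condition on differences says that F lies in a hyperplane normal to \<nu> and also
  spans it, so that \<open>surface_measure F\<close> has dimension n - 1. The sign of \<nu> is left
  open.\<close>

locale flat_piece =
  fixes F :: "(real^'n::{finite,wellorder}) set" and \<nu> :: "real^'n::_"
  assumes compact: "compact F" and nonempty: "F \<noteq> {}"
    and direction: "span {x - y | x y. x \<in> F \<and> y \<in> F} = {v. \<nu> \<bullet> v = 0}" and unit: "norm \<nu> = 1"
begin

definition base_point :: "real^'n::_" where "base_point = (SOME a. a \<in> F)"

definition height :: "real^'n::_ \<Rightarrow> real^'n::_ \<Rightarrow> real" where
  "height e x = \<nu> \<bullet> (x - base_point) / (\<nu> \<bullet> e)"

definition proj_along :: "real^'n::_ \<Rightarrow> real^'n::_ \<Rightarrow> real^'n::_" where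
  "proj_along e x = x - height e x *\<^sub>R e"

text \<open>An oblique prism over F with edge e. Integrating over it functions that are constant
  along e turns surface integrals into volume integrals.\<close>

definition cylinder :: "real^'n::_ \<Rightarrow> (real^'n::_) set" where
  "cylinder e = (\<lambda>(y, t). y + t *\<^sub>R e) ` (F \<times> {0..1})"

lemma base_point_in: "base_point \<in> F"
  unfolding base_point_def using nonempty by (simp add: some_in_eq)

lemma normal_orthogonal: "x \<in> F \<Longrightarrow> y \<in> F \<Longrightarrow> \<nu> \<bullet> (x - y) = 0"
  using span_base[of "x - y" "{x - y | x y. x \<in> F \<and> y \<in> F}"] direction by blast

lemma height_in: "x \<in> F \<Longrightarrow> height e x = 0"
  using normal_orthogonal[OF _ base_point_in] by (simp add: height_def)

lemma height_line: "\<nu> \<bullet> e \<noteq> 0 \<Longrightarrow> height e (x + t *\<^sub>R e) = height e x + t"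
  by (simp add: height_def inner_diff_right inner_add_right field_simps)

lemma proj_line: "\<nu> \<bullet> e \<noteq> 0 \<Longrightarrow> proj_along e (x + t *\<^sub>R e) = proj_along e x"
  by (simp add: proj_along_def height_line scaleR_add_left)

lemma proj_in: "x \<in> F \<Longrightarrow> proj_along e x = x"
  by (simp add: proj_along_def height_in)

lemma proj_hyperplane: "\<nu> \<bullet> (x - base_point) = 0 \<Longrightarrow> proj_along e x = x"
  by (simp add: proj_along_def height_def)

lemma mem_cylinder:
  assumes "\<nu> \<bullet> e \<noteq> 0"
  shows "x \<in> cylinder e \<longleftrightarrow> proj_along e x \<in> F \<and> height e x \<in> {0..1}"
proof
  assume "x \<in> cylinder e"
  then obtain y t where "x = y + t *\<^sub>R e" "y \<in> F" "t \<in> {0..1}" by (auto simp: cylinder_def)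
  then show "proj_along e x \<in> F \<and> height e x \<in> {0..1}"
    using assms by (simp add: height_line proj_line proj_in height_in)
next
  assume *: "proj_along e x \<in> F \<and> height e x \<in> {0..1}"
  have "x = proj_along e x + height e x *\<^sub>R e" by (simp add: proj_along_def)
  with * show "x \<in> cylinder e"
    unfolding cylinder_def by (intro image_eqI[of _ _ "(proj_along e x, height e x)"]) auto
qed

lemma compact_cylinder: "compact (cylinder e)"
  unfolding cylinder_def
  by (intro compact_continuous_image compact_Times compact compact_Icc)
     (auto simp: split_beta' intro!: continuous_intros)

lemma continuous_height: "continuous_on S (height e)"
  unfolding height_def[abs_def] divide_inverse by (intro continuous_intros)

lemma continuous_proj: "continuous_on S (proj_along e)"
  unfolding proj_along_def[abs_def] by (intro continuous_intros continuous_height)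

lemma continuous_cylinder:
  assumes "\<nu> \<bullet> e \<noteq> 0" "continuous_on F f"
  shows "continuous_on (cylinder e) (\<lambda>x. f (proj_along e x))"
  by (rule continuous_on_compose2[OF assms(2) continuous_proj]) (auto simp: mem_cylinder[OF assms(1)])

text \<open>A line parallel to e that hits F meets the prism in a parameter interval of length one,
  on which the projection is constant. The point y need not lie in the hyperplane of F, so any
  transversal cross-section may be used later.\<close>

lemma cylinder_line_integral:
  fixes f :: "real^'n::_ \<Rightarrow> real"
  assumes "\<nu> \<bullet> e \<noteq> 0"
  shows "(\<integral>s. indicator (cylinder e) (y + s *\<^sub>R e) * f (proj_along e (y + s *\<^sub>R e)) \<partial>lborel)
    = indicator F (proj_along e y) * f (proj_along e y)"
proof -
  have "(\<integral>s. indicator (cylinder e) (y + s *\<^sub>R e) * f (proj_along e (y + s *\<^sub>R e)) \<partial>lborel)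
    = (\<integral>s. indicator {- height e y .. 1 - height e y} s *\<^sub>R (indicator F (proj_along e y) * f (proj_along e y)) \<partial>lborel)"
    by (intro Bochner_Integration.integral_cong)
       (auto simp: mem_cylinder[OF assms] height_line[OF assms] proj_line[OF assms] indicator_def)
  also have "\<dots> = indicator F (proj_along e y) * f (proj_along e y)"
    by (simp add: measure_def)
  finally show ?thesis .
qed

lemma borel_measurable_piece:
  fixes f :: "real^'n::_ \<Rightarrow> real"
  assumes "continuous_on F f"
  shows "(\<lambda>y. indicator F y * f y) \<in> borel_measurable borel"
  using borel_measurable_integrable[OF lebesgue_on_compact(3)[OF compact assms]] by simp

text \<open>The prism integral is evaluated over another cross-section G of the same bundle of lines
  parallel to e. Comparing two cross-sections gives the change of variables between two facets of a
  simplex.\<close>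

lemma surface_shear:
  fixes f :: "real^'n::_ \<Rightarrow> real"
  assumes G: "flat_piece G \<mu>" and e: "\<nu> \<bullet> e \<noteq> 0" "\<mu> \<bullet> e \<noteq> 0"
    and proj: "\<And>y. \<mu> \<bullet> (y - a) = 0 \<Longrightarrow> y \<in> G \<longleftrightarrow> proj_along e y \<in> F" and a: "a \<in> G"
    and f: "continuous_on F f"
  shows "integrable (surface_measure G) (\<lambda>y. f (proj_along e y))"
    and "(\<integral>x. indicator (cylinder e) x * f (proj_along e x) \<partial>lborel)
      = \<bar>\<mu> \<bullet> e\<bar> * (\<integral>y. f (proj_along e y) \<partial>surface_measure G)"
proof -
  interpret G: flat_piece G \<mu> by fact
  have aG: "\<mu> \<bullet> (y - a) = 0" if "y \<in> G" for y using G.normal_orthogonal[OF that a] .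
  have gi: "integrable lborel (\<lambda>x. indicator (cylinder e) x * f (proj_along e x))"
    by (rule lebesgue_on_compact(3)[OF compact_cylinder continuous_cylinder[OF e(1) f]])
  have 1: "(\<integral>s. indicator (cylinder e) (y + s *\<^sub>R e) * f (proj_along e (y + s *\<^sub>R e)) \<partial>lborel) = f (proj_along e y)"
    if "y \<in> G" for y
    using proj[OF aG[OF that]] that unfolding cylinder_line_integral[OF e(1)] by simp
  have 0: "(\<integral>s. indicator (cylinder e) (y + s *\<^sub>R e) * f (proj_along e (y + s *\<^sub>R e)) \<partial>lborel) = 0"
    if "\<mu> \<bullet> (y - a) = 0" "y \<notin> G" for y
    using proj[OF that(1)] that(2) unfolding cylinder_line_integral[OF e(1)] by simp
  have "continuous_on G (\<lambda>y. f (proj_along e y))"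
    by (rule continuous_on_compose2[OF f continuous_proj]) (use proj aG in auto)
  note m = G.borel_measurable_piece[OF this]
  show "integrable (surface_measure G) (\<lambda>y. f (proj_along e y))"
    by (rule surface_measure_fubini(1)[OF G.compact G.direction G.unit e(2) a gi 1 0 m])
  show "(\<integral>x. indicator (cylinder e) x * f (proj_along e x) \<partial>lborel)
      = \<bar>\<mu> \<bullet> e\<bar> * (\<integral>y. f (proj_along e y) \<partial>surface_measure G)"
    by (rule surface_measure_fubini(2)[OF G.compact G.direction G.unit e(2) a gi 1 0 m])
qed

lemma space_surface_measure: "space (surface_measure F) = F"
  unfolding surface_measure_def Let_def by (simp add: space_restrict_space)

lemma surface_integral_cong: "(\<And>x. x \<in> F \<Longrightarrow> f x = g x) \<Longrightarrow> integral\<^sup>L (surface_measure F) f = integral\<^sup>L (surface_measure F) g"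
  by (intro Bochner_Integration.integral_cong) (auto simp: space_surface_measure)

lemma surface_integrable_cong: "(\<And>x. x \<in> F \<Longrightarrow> f x = g x) \<Longrightarrow> integrable (surface_measure F) f \<longleftrightarrow> integrable (surface_measure F) g"
  by (intro Bochner_Integration.integrable_cong) (auto simp: space_surface_measure)

lemma cylinder_integral:
  fixes f :: "real^'n::_ \<Rightarrow> real"
  assumes e: "\<nu> \<bullet> e \<noteq> 0" and f: "continuous_on F f"
  shows "(\<integral>x. indicator (cylinder e) x * f (proj_along e x) \<partial>lborel)
      = \<bar>\<nu> \<bullet> e\<bar> * (\<integral>y. f y \<partial>surface_measure F)"
  using surface_shear(2)[OF flat_piece_axioms e e _ base_point_in f]
    surface_integral_cong[of f "\<lambda>y. f (proj_along e y)"] by (simp add: proj_hyperplane proj_in)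

lemma normal_self: "\<nu> \<bullet> \<nu> = 1" using unit by (simp add: norm_eq_1)

lemma integrable_surface:
  fixes f :: "real^'n::_ \<Rightarrow> real"
  assumes "continuous_on F f" shows "integrable (surface_measure F) f"
  using surface_shear(1)[OF flat_piece_axioms _ _ _ base_point_in assms, of \<nu>]
    surface_integrable_cong[of f "\<lambda>y. f (proj_along \<nu> y)"] normal_self by (simp add: proj_hyperplane proj_in)

text \<open>The area of F is bounded without being computed: the prism of height r over F lies in
  the ball of radius (R + 1) r, and its volume is r times the area.\<close>

lemma surface_integral_bound:
  fixes f :: "real^'n::_ \<Rightarrow> real"
  assumes r: "0 < r" and R: "0 \<le> R" and F: "F \<subseteq> cball x0 (R * r)" and f: "continuous_on F f"
    and c: "\<And>x. x \<in> F \<Longrightarrow> f x \<le> c" "0 \<le> c"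
  shows "(\<integral>x. f x \<partial>surface_measure F) \<le> c * (unit_ball_vol CARD('n) * (R + 1) ^ CARD('n)) * r ^ CARD('n) / r"
proof -
  have e: "\<nu> \<bullet> (r *\<^sub>R \<nu>) \<noteq> 0" and e': "\<bar>\<nu> \<bullet> (r *\<^sub>R \<nu>)\<bar> = r" using r normal_self by simp_all
  have sub: "cylinder (r *\<^sub>R \<nu>) \<subseteq> cball x0 ((R + 1) * r)"
  proof
    fix x assume "x \<in> cylinder (r *\<^sub>R \<nu>)"
    then obtain y t where y: "y \<in> F" "t \<in> {0..1}" "x = y + t *\<^sub>R r *\<^sub>R \<nu>" by (auto simp: cylinder_def)
    have "dist x0 x \<le> dist x0 y + dist y x" by (rule dist_triangle)
    also have "dist y x = t * r" using y r unit by (simp add: dist_norm abs_mult)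
    also have "t * r \<le> r" using y r by simp
    finally show "x \<in> cball x0 ((R + 1) * r)" using F y by (auto simp: algebra_simps)
  qed
  have "r * (\<integral>x. f x \<partial>surface_measure F) = (\<integral>x. indicator (cylinder (r *\<^sub>R \<nu>)) x * f (proj_along (r *\<^sub>R \<nu>) x) \<partial>lborel)"
    unfolding cylinder_integral[OF e f] e' ..
  also have "\<dots> \<le> (\<integral>x. indicator (cball x0 ((R + 1) * r)) x * c \<partial>lborel)"
  proof (rule integral_mono)
    show "integrable lborel (\<lambda>x. indicator (cylinder (r *\<^sub>R \<nu>)) x * f (proj_along (r *\<^sub>R \<nu>) x))"
      by (rule lebesgue_on_compact(3)[OF compact_cylinder continuous_cylinder[OF e f]])
    show "integrable lborel (\<lambda>x. indicator (cball x0 ((R + 1) * r)) x * c)"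
      by (rule lebesgue_on_compact(3)) auto
    fix x show "indicator (cylinder (r *\<^sub>R \<nu>)) x * f (proj_along (r *\<^sub>R \<nu>) x) \<le> indicator (cball x0 ((R + 1) * r)) x * c"
      using sub c by (auto simp: indicator_def mem_cylinder[OF e])
  qed
  also have "\<dots> = c * (unit_ball_vol CARD('n) * ((R + 1) * r) ^ CARD('n))"
    using r R by (simp add: content_cball mult.commute)
  also have "\<dots> = c * (unit_ball_vol CARD('n) * (R + 1) ^ CARD('n)) * r ^ CARD('n)"
    by (simp only: power_mult_distrib mult.assoc)
  finally show ?thesis using r by (simp add: pos_le_divide_eq mult.commute)
qed

section \<open>Definiteness of the surface product on polynomials\<close>

lemma polys_proj: "p \<in> polys k \<Longrightarrow> (\<lambda>x. p (proj_along e x)) \<in> polys k"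
proof (rule polys_compose_affine)
  fix i
  have "(\<lambda>x. proj_along e x $ i) = (\<lambda>x. x $ i + ((- (e $ i / (\<nu> \<bullet> e))) *\<^sub>R \<nu> \<bullet> x + (\<nu> \<bullet> base_point) * (e $ i / (\<nu> \<bullet> e))))"
    by (auto simp: fun_eq_iff proj_along_def height_def inner_diff_right algebra_simps diff_divide_distrib)
  also have "\<dots> \<in> polys 1" by (intro polys_add[OF polys_component polys_affine_inner]) simp
  finally show "(\<lambda>x. proj_along e x $ i) \<in> polys 1" .
qed

text \<open>The prism is convex, and its affine hull contains the hyperplane of F and the normal
  direction, hence is the whole space. A nonempty convex set of full dimension has interior
  points.\<close>

lemma ball_in_cylinder:
  assumes "convex F"
  obtains x r where "0 < r" "ball x r \<subseteq> cylinder \<nu>"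
proof -
  have conv: "convex (cylinder \<nu>)"
  proof -
    have "cylinder \<nu> = (\<Union>x\<in>F. \<Union>y\<in>(\<lambda>t. t *\<^sub>R \<nu>) ` {0..1}. {x + y})"
      by (force simp: cylinder_def)
    moreover have "convex ((\<lambda>t. t *\<^sub>R \<nu>) ` {0..1})"
      by (intro convex_linear_image linearI) (auto simp: scaleR_add_left)
    ultimately show ?thesis using convex_sums[OF assms] by (simp only:)
  qed
  have sub: "F \<subseteq> cylinder \<nu>" unfolding cylinder_def by force
  have "base_point + 1 *\<^sub>R \<nu> \<in> cylinder \<nu>" 
    unfolding cylinder_def using base_point_in by (intro image_eqI[of _ _ "(base_point, 1)"]) auto
  then have top: "base_point + \<nu> \<in> affine hull (cylinder \<nu>)" by (simp add: hull_inc)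
  have "affine hull (cylinder \<nu>) = UNIV"
  proof (intro set_eqI iffI UNIV_I)
    fix x :: "real^'n::_"
    let ?S = "span ((\<lambda>z. z - base_point) ` cylinder \<nu>)"
    have b: "base_point \<in> cylinder \<nu>" using base_point_in sub by blast
    have aff: "affine hull (cylinder \<nu>) = (+) base_point ` ?S"
      using affine_hull_span_gen[OF hull_inc[OF b, of affine]] by (simp add: add.commute)
    have inS: "z - base_point \<in> ?S" if "z \<in> cylinder \<nu>" for z using that by (intro span_base) blast
    have "span {x - y | x y. x \<in> F \<and> y \<in> F} \<subseteq> ?S"
    proof (rule span_minimal)
      show "{x - y | x y. x \<in> F \<and> y \<in> F} \<subseteq> ?S"
      proof clarify
        fix x y assume "x \<in> F" "y \<in> F"
        then have "(x - base_point) - (y - base_point) \<in> ?S" 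
          using span_diff[OF inS[of x] inS[of y]] sub by blast
        then show "x - y \<in> ?S" by simp
      qed
    qed (rule subspace_span)
    then have "{v. \<nu> \<bullet> v = 0} \<subseteq> ?S" by (simp add: direction)
    moreover have "\<nu> \<in> ?S" using inS[of "base_point + \<nu>"] \<open>base_point + 1 *\<^sub>R \<nu> \<in> cylinder \<nu>\<close> by simp
    moreover define w where "w = x - base_point - (\<nu> \<bullet> (x - base_point)) *\<^sub>R \<nu>"
    have "\<nu> \<bullet> w = 0" using normal_self by (simp add: w_def inner_diff_right)
    ultimately have "w + (\<nu> \<bullet> (x - base_point)) *\<^sub>R \<nu> \<in> ?S" by (intro span_add span_scale) auto
    then have "x - base_point \<in> ?S" by (simp add: w_def)
    then show "x \<in> affine hull (cylinder \<nu>)" unfolding aff by (auto simp: image_iff intro!: bexI[of _ "x - base_point"])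
  qed
  then have "rel_interior (cylinder \<nu>) = interior (cylinder \<nu>)" by (rule rel_interior_interior)
  moreover have "rel_interior (cylinder \<nu>) \<noteq> {}"
    using rel_interior_eq_empty[OF conv] sub nonempty by auto
  ultimately obtain x where "x \<in> interior (cylinder \<nu>)" by auto
  then show ?thesis using that by (auto simp: mem_interior)
qed

text \<open>Replacing p by its constant extension along \<nu> gives a polynomial whose square
  integrates to zero over the prism, so definiteness for volumes applies. It determines p only on
  F.\<close>

lemma surface_L2_definite:
  assumes "convex F" "p \<in> polys k" and 0: "(\<integral>x. p x * p x \<partial>surface_measure F) = 0" and x: "x \<in> F"
  shows "p x = 0"
proof -
  let ?q = "\<lambda>x. p (proj_along \<nu> x)"
  have n: "\<nu> \<bullet> \<nu> \<noteq> 0" using normal_self by simp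
  have q: "?q \<in> polys k" by (rule polys_proj[OF assms(2)])
  have c: "continuous_on S (\<lambda>x. p x * p x)" "continuous_on S (\<lambda>x. ?q x * ?q x)" for S
    by (intro continuous_intros continuous_on_polys[OF assms(2)] continuous_on_polys[OF q])+
  have "(\<integral>x. ?q x * ?q x \<partial>lebesgue_on (cylinder \<nu>)) = 0"
    using cylinder_integral[OF n c(1)] 0 by (subst lebesgue_on_compact(2)[OF compact_cylinder c(2)]) simp
  moreover obtain y r where "0 < r" "ball y r \<subseteq> cylinder \<nu>" using ball_in_cylinder[OF assms(1)] .
  ultimately have "?q = (\<lambda>x. 0)" using polys_L2_definite[OF compact_cylinder _ _ q] by blast
  then show ?thesis using proj_in[OF x, of \<nu>] by metis
qed

end

section \<open>Divergence theorem on a simplex\<close>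

locale full_simplex =
  fixes C :: "(real^'n::{finite,wellorder}) set"
  assumes independent: "\<not> affine_dependent C" and card: "card C = Suc CARD('n)"
begin

definition T :: "(real^'n::_) set" where "T = convex hull C"

definition facet :: "real^'n::_ \<Rightarrow> (real^'n::_) set" where "facet u = convex hull (C - {u})"

text \<open>Barycentric coordinates of every point of the space, inside or outside T, since n + 1
  affinely independent points span it affinely. Only the values on C are determined.\<close>

definition bary :: "real^'n::_ \<Rightarrow> real^'n::_ \<Rightarrow> real" where
  "bary x = (SOME c. sum c C = 1 \<and> (\<Sum>u\<in>C. c u *\<^sub>R u) = x)"

lemma finite: "finite C"
  using card by (metis card.infinite nat.distinct(1))

lemma bary: "sum (bary x) C = 1" "(\<Sum>u\<in>C. bary x u *\<^sub>R u) = x"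
proof -
  have "x \<in> affine hull C" using affine_independent_span_eq[OF independent] card by simp
  then have "\<exists>c. sum c C = 1 \<and> (\<Sum>u\<in>C. c u *\<^sub>R u) = x"
    unfolding affine_hull_finite[OF finite] by blast
  from someI_ex[OF this] show "sum (bary x) C = 1" "(\<Sum>u\<in>C. bary x u *\<^sub>R u) = x"
    unfolding bary_def by blast+
qed

lemma bary_unique:
  assumes "sum c C = 1" "(\<Sum>u\<in>C. c u *\<^sub>R u) = x" "u \<in> C"
  shows "bary x u = c u"
proof (rule ccontr)
  assume "bary x u \<noteq> c u"
  then have "\<exists>v\<in>C. (\<lambda>v. bary x v - c v) v \<noteq> 0" using assms(3) by auto
  moreover have "(\<Sum>v\<in>C. bary x v - c v) = 0" using bary(1)[of x] assms(1) by (simp add: sum_subtractf)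
  moreover have "(\<Sum>v\<in>C. (bary x v - c v) *\<^sub>R v) = 0"
    using bary(2)[of x] assms(2) by (simp add: sum_subtractf scaleR_diff_left)
  ultimately have "affine_dependent C"
    unfolding affine_dependent_explicit_finite[OF finite] by (intro exI[of _ "\<lambda>v. bary x v - c v"]) simp
  then show False using independent by simp
qed

text \<open>Along an edge direction only two coordinates change, at unit rates of opposite sign, so
  the section of T by such a line is an explicit interval.\<close>

lemma bary_line:
  assumes "a \<in> C" "b \<in> C" "a \<noteq> b" "u \<in> C"
  shows "bary (x + t *\<^sub>R (a - b)) u = bary x u + t * ((if u = a then 1 else 0) - (if u = b then 1 else 0))"
proof (rule bary_unique[OF _ _ assms(4)])
  have eq: "(\<Sum>u\<in>C. ((if u = a then 1 else 0) - (if u = b then 1 else 0)) *\<^sub>R u) = a - b"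
    using assms finite by (simp add: scaleR_diff_left sum_subtractf if_distrib[of "\<lambda>r. r *\<^sub>R _"] cong: if_cong)
  have eq1: "(\<Sum>u\<in>C. (if u = a then 1 else 0) - (if u = b then 1 else 0)) = (0 :: real)"
    using assms finite by (simp add: sum_subtractf)
  show "(\<Sum>u\<in>C. bary x u + t * ((if u = a then 1 else 0) - (if u = b then 1 else 0))) = 1"
    by (simp only: sum.distrib sum_distrib_left[symmetric] eq1 bary(1) mult_zero_right add_0_right)
  show "(\<Sum>u\<in>C. (bary x u + t * ((if u = a then 1 else 0) - (if u = b then 1 else 0))) *\<^sub>R u) = x + t *\<^sub>R (a - b)"
    by (simp only: scaleR_add_left sum.distrib scaleR_scaleR[symmetric] scaleR_sum_right[symmetric] eq bary(2))
qed

lemma bary_vertex: "u \<in> C \<Longrightarrow> w \<in> C \<Longrightarrow> bary u w = (if w = u then 1 else 0)"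
  by (rule bary_unique) (auto simp: finite if_distrib[of "\<lambda>r. r *\<^sub>R _"] cong: if_cong)

lemma mem_T: "x \<in> T \<longleftrightarrow> (\<forall>u\<in>C. 0 \<le> bary x u)"
proof
  assume "x \<in> T"
  then obtain c where c: "\<forall>u\<in>C. 0 \<le> c u" "sum c C = 1" "(\<Sum>u\<in>C. c u *\<^sub>R u) = x"
    unfolding T_def convex_hull_finite[OF finite] by blast
  then show "\<forall>u\<in>C. 0 \<le> bary x u" using bary_unique[OF c(2,3)] by simp
next
  assume "\<forall>u\<in>C. 0 \<le> bary x u"
  then show "x \<in> T"
    unfolding T_def convex_hull_finite[OF finite] using bary[of x] by blast
qed

lemma mem_facet:
  assumes "u \<in> C"
  shows "x \<in> facet u \<longleftrightarrow> x \<in> T \<and> bary x u = 0"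
proof
  assume "x \<in> facet u"
  then obtain c where c: "\<forall>w\<in>C - {u}. 0 \<le> c w" "sum c (C - {u}) = 1" "(\<Sum>w\<in>C - {u}. c w *\<^sub>R w) = x"
    unfolding facet_def convex_hull_finite[OF finite_Diff[OF finite]] by blast
  have "sum (c(u := 0)) (C - {u}) = 1" "(\<Sum>w\<in>C - {u}. (c(u := 0)) w *\<^sub>R w) = x"
    unfolding c(2,3)[symmetric] by (intro sum.cong; simp)+
  then have "sum (c(u := 0)) C = 1" "(\<Sum>w\<in>C. (c(u := 0)) w *\<^sub>R w) = x"
    using assms finite by (auto simp: sum.remove[of C u])
  note un = bary_unique[OF this]
  have "0 \<le> bary x w" if "w \<in> C" for w using un[OF that] c(1) that by (cases "w = u") auto
  then show "x \<in> T \<and> bary x u = 0" using un[OF assms] by (simp add: mem_T)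
next
  assume x: "x \<in> T \<and> bary x u = 0"
  have "sum (bary x) (C - {u}) = 1" "(\<Sum>w\<in>C - {u}. bary x w *\<^sub>R w) = x"
    using bary[of x] x assms finite by (auto simp: sum.remove[of C u])
  then show "x \<in> facet u"
    unfolding facet_def convex_hull_finite[OF finite_Diff[OF finite]] using x by (auto simp: mem_T)
qed

lemma facet_subset: "facet u \<subseteq> T"
  unfolding facet_def T_def by (intro hull_mono) auto

lemma vertex_in_facet: "w \<in> C \<Longrightarrow> w \<noteq> u \<Longrightarrow> w \<in> facet u"
  unfolding facet_def by (intro hull_inc) auto

lemma obtain_vertex:
  obtains w where "w \<in> C" "w \<noteq> u"
proof -
  have "C - {u} \<noteq> {}"
  proof
    assume "C - {u} = {}"
    then have "C \<subseteq> {u}" by blast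
    then have "card C \<le> 1" using card_mono[of "{u}" C] by simp
    then show False using card by (metis One_nat_def Suc_le_mono le_zero_eq zero_less_card_finite less_irrefl)
  qed
  then show ?thesis using that by blast
qed

lemma compact_T: "compact T" unfolding T_def using finite by (intro compact_convex_hull finite_imp_compact)
lemma convex_T: "convex T" unfolding T_def by simp
lemma convex_facet: "convex (facet u)" unfolding facet_def by simp
lemma compact_facet: "compact (facet u)"
  unfolding facet_def using finite by (intro compact_convex_hull finite_imp_compact) auto

text \<open>A linear functional that is constant on the vertices other than u sees only the
  coordinate of u. For a normal of the facet, this identifies that coordinate with a scaled signed
  distance to its hyperplane.\<close>

lemma inner_eq_bary:
  assumes u: "u \<in> C" and y: "y \<in> C" "y \<noteq> u" and orth: "\<And>w. w \<in> C \<Longrightarrow> w \<noteq> u \<Longrightarrow> a \<bullet> (w - y) = 0"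
  shows "a \<bullet> (x - y) = bary x u * (a \<bullet> (u - y))"
proof -
  have "x - y = (\<Sum>w\<in>C. bary x w *\<^sub>R w) - (\<Sum>w\<in>C. bary x w) *\<^sub>R y" by (simp add: bary)
  also have "\<dots> = (\<Sum>w\<in>C. bary x w *\<^sub>R (w - y))"
    by (simp add: scaleR_diff_right sum_subtractf scaleR_sum_left)
  finally have "a \<bullet> (x - y) = (\<Sum>w\<in>C. bary x w * (a \<bullet> (w - y)))" by (simp add: inner_sum_right)
  also have "\<dots> = bary x u * (a \<bullet> (u - y)) + (\<Sum>w\<in>C - {u}. bary x w * (a \<bullet> (w - y)))"
    by (rule sum.remove[OF finite u])
  also have "(\<Sum>w\<in>C - {u}. bary x w * (a \<bullet> (w - y))) = 0" using orth by (intro sum.neutral) auto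
  finally show ?thesis by simp
qed

section \<open>Outer normals\<close>

abbreviation directions :: "real^'n::_ \<Rightarrow> (real^'n::_) set" where
  "directions u \<equiv> {x - y | x y. x \<in> facet u \<and> y \<in> facet u}"

text \<open>The n vertices other than u lie in a hyperplane. The vertex u does not, since otherwise
  the functional a would vanish on the whole space.\<close>

lemma normal_exists:
  assumes u: "u \<in> C"
  obtains \<nu> where "norm \<nu> = 1" "span (directions u) = {v. \<nu> \<bullet> v = 0}"
    "\<And>y. y \<in> facet u \<Longrightarrow> \<nu> \<bullet> (u - y) < 0"
proof -
  obtain y0 where y0: "y0 \<in> C" "y0 \<noteq> u" using obtain_vertex .
  have "aff_dim (C - {u}) \<le> int (card (C - {u})) - 1" by (rule aff_dim_le_card) (simp add: finite)
  then have "aff_dim (C - {u}) < DIM(real^'n::_)" using u card by simp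
  then obtain a b where a: "a \<noteq> 0" "C - {u} \<subseteq> {x. a \<bullet> x = b}" by (rule aff_lowdim_subset_hyperplane)
  have orth: "a \<bullet> (w - y0) = 0" if "w \<in> C" "w \<noteq> u" for w
    using a(2) that y0 by (auto simp: inner_diff_right)
  note ib = inner_eq_bary[OF u y0 orth]
  have ne: "a \<bullet> (u - y0) \<noteq> 0"
  proof
    assume "a \<bullet> (u - y0) = 0"
    then have "a \<bullet> (x - y0) = 0" for x using ib[of x] by simp
    from this[of "y0 + a"] show False using a(1) by simp
  qed
  \<comment> \<open>Unit length, with the sign that puts u strictly on the negative side.\<close>
  define \<nu> where "\<nu> = (- sgn (a \<bullet> (u - y0)) / norm a) *\<^sub>R a"
  have n1: "norm \<nu> = 1" using a(1) ne by (simp add: \<nu>_def abs_sgn_eq)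
  have zero: "\<nu> \<bullet> v = 0 \<longleftrightarrow> a \<bullet> v = 0" for v using a(1) ne by (simp add: \<nu>_def sgn_0_0)
  have "\<nu> \<bullet> (u - y0) = - \<bar>a \<bullet> (u - y0)\<bar> / norm a" by (simp add: \<nu>_def abs_sgn mult.commute)
  then have neg: "\<nu> \<bullet> (u - y0) < 0" using a(1) ne by (simp add: divide_neg_pos)
  have in_zero: "a \<bullet> (x - y0) = 0" if "x \<in> facet u" for x
    using ib[of x] that by (simp add: mem_facet[OF u])
  have "span (directions u) = {v. \<nu> \<bullet> v = 0}"
  proof (intro subset_antisym span_minimal)
    show "(directions u) \<subseteq> {v. \<nu> \<bullet> v = 0}"
    proof clarify
      fix x y assume "x \<in> facet u" "y \<in> facet u"
      then have "a \<bullet> (x - y0) - a \<bullet> (y - y0) = 0" using in_zero by simp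
      then have "a \<bullet> (x - y) = 0" by (simp add: inner_diff_right)
      then show "\<nu> \<bullet> (x - y) = 0" by (simp only: zero)
    qed
    show "subspace {v. \<nu> \<bullet> v = 0}" by (rule subspace_hyperplane)
    \<comment> \<open>The point y0 + v has u-coordinate zero, so v is a combination of edges from y0
      to vertices of the facet.\<close>
    show "{v. \<nu> \<bullet> v = 0} \<subseteq> span (directions u)"
    proof
      fix v assume "v \<in> {v. \<nu> \<bullet> v = 0}"
      then have "bary (y0 + v) u = 0" using ib[of "y0 + v"] ne by (simp add: zero)
      have "v = (\<Sum>w\<in>C. bary (y0 + v) w *\<^sub>R w) - (\<Sum>w\<in>C. bary (y0 + v) w) *\<^sub>R y0" by (simp add: bary)
      also have "\<dots> = (\<Sum>w\<in>C. bary (y0 + v) w *\<^sub>R (w - y0))"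
        by (simp add: scaleR_diff_right sum_subtractf scaleR_sum_left)
      also have "\<dots> \<in> span (directions u)"
      proof (rule span_sum)
        fix w assume "w \<in> C"
        show "bary (y0 + v) w *\<^sub>R (w - y0) \<in> span (directions u)"
        proof (cases "w = u")
          case True
          then show ?thesis using \<open>bary (y0 + v) u = 0\<close> by (simp add: span_zero)
        next
          case False
          then show ?thesis using \<open>w \<in> C\<close> y0 vertex_in_facet
            by (intro span_scale span_base) blast
        qed
      qed
      finally show "v \<in> span (directions u)" .
    qed
  qed
  moreover have "\<nu> \<bullet> (u - y) < 0" if "y \<in> facet u" for y
  proof -
    have "\<nu> \<bullet> (y - y0) = 0" using in_zero[OF that] by (simp add: zero)
    then have "\<nu> \<bullet> (u - y) = \<nu> \<bullet> (u - y0)" by (simp add: inner_diff_right)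
    then show ?thesis using neg by simp
  qed
  ultimately show ?thesis using that n1 by blast
qed

abbreviation normal :: "real^'n::_ \<Rightarrow> real^'n::_" where "normal u \<equiv> outer_normal T (facet u)"
abbreviation \<sigma> :: "real^'n::_ \<Rightarrow> (real^'n::_) measure" where "\<sigma> u \<equiv> surface_measure (facet u)"

text \<open>Uniqueness behind the definite description: a candidate \<mu> is orthogonal to all
  differences of facet points, because both orders of the two points are allowed. Hence it is a
  multiple of \<nu>, and the position of u fixes the sign.\<close>

lemma outer_normal:
  assumes u: "u \<in> C"
  shows "flat_piece (facet u) (normal u)" "\<And>y. y \<in> facet u \<Longrightarrow> normal u \<bullet> (u - y) < 0"
proof -
  obtain \<nu> where \<nu>: "norm \<nu> = 1" "span (directions u) = {v. \<nu> \<bullet> v = 0}"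
    "\<And>y. y \<in> facet u \<Longrightarrow> \<nu> \<bullet> (u - y) < 0" by (rule normal_exists[OF u]) (rule that)
  obtain y0 where y0: "y0 \<in> C" "y0 \<noteq> u" using obtain_vertex .
  have y0f: "y0 \<in> facet u" using vertex_in_facet y0 by blast
  interpret P: flat_piece "facet u" \<nu>
    using \<nu> y0f by unfold_locales (auto intro: compact_facet)
  have orth: "\<nu> \<bullet> (w - y0) = 0" if "w \<in> C" "w \<noteq> u" for w
    by (rule P.normal_orthogonal[OF vertex_in_facet[OF that] y0f])
  have "normal u = \<nu>"
    unfolding outer_normal_def
  proof (rule the_equality)
    show "norm \<nu> = 1 \<and> (\<forall>x\<in>facet u. \<forall>y\<in>T. (y - x) \<bullet> \<nu> \<le> 0)"
    proof (intro conjI ballI \<nu>(1))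
      fix x y assume x: "x \<in> facet u" and y: "y \<in> T"
      have "\<nu> \<bullet> (y - x) = \<nu> \<bullet> (y - y0) - \<nu> \<bullet> (x - y0)" by (simp add: inner_diff_right)
      also have "\<dots> = bary y u * (\<nu> \<bullet> (u - y0))"
        using inner_eq_bary[OF u y0 orth, of y] P.normal_orthogonal[OF x y0f] by simp
      also have "\<dots> \<le> 0" using \<nu>(3)[OF y0f] y u by (simp add: mem_T mult_nonneg_nonpos)
      finally show "(y - x) \<bullet> \<nu> \<le> 0" by (simp add: inner_commute)
    qed
    fix \<mu> assume \<mu>: "norm \<mu> = 1 \<and> (\<forall>x\<in>facet u. \<forall>y\<in>T. (y - x) \<bullet> \<mu> \<le> 0)"
    have "\<mu> \<bullet> (x - y) = 0" if "x \<in> facet u" "y \<in> facet u" for x y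
    proof -
      have "(y - x) \<bullet> \<mu> \<le> 0" "(x - y) \<bullet> \<mu> \<le> 0" using \<mu> that facet_subset by blast+
      then show ?thesis by (simp add: inner_diff_left inner_diff_right inner_commute)
    qed
    then have "span (directions u) \<subseteq> {v. \<mu> \<bullet> v = 0}"
      by (intro span_minimal subspace_hyperplane) blast
    then have sub: "\<mu> \<bullet> v = 0" if "\<nu> \<bullet> v = 0" for v using that \<nu>(2) by blast
    have \<nu>1: "\<nu> \<bullet> \<nu> = 1" using \<nu>(1) by (simp add: norm_eq_1)
    \<comment> \<open>The part of \<mu> orthogonal to \<nu> lies in the hyperplane, hence is
      orthogonal to \<mu>, hence to itself.\<close>
    define w where "w = \<mu> - (\<nu> \<bullet> \<mu>) *\<^sub>R \<nu>"
    have w: "\<nu> \<bullet> w = 0" using \<nu>1 by (simp add: w_def inner_diff_right)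
    have "w \<bullet> w = \<mu> \<bullet> w - (\<nu> \<bullet> \<mu>) * (\<nu> \<bullet> w)" by (subst (1) w_def) (simp add: inner_diff_left)
    then have "w = 0" using sub[OF w] w by simp
    then have eq: "\<mu> = (\<nu> \<bullet> \<mu>) *\<^sub>R \<nu>" by (simp add: w_def)
    then have "\<bar>\<nu> \<bullet> \<mu>\<bar> = 1" using \<mu> \<nu>(1) by (metis norm_scaleR mult.right_neutral)
    moreover have "u \<in> T" unfolding T_def using u by (rule hull_inc)
    then have "(u - y0) \<bullet> \<mu> \<le> 0" using \<mu> y0f by blast
    then have "(\<nu> \<bullet> \<mu>) * (\<nu> \<bullet> (u - y0)) \<le> 0" by (subst (asm) eq) (simp add: inner_commute)
    then have "0 \<le> \<nu> \<bullet> \<mu>" using \<nu>(3)[OF y0f] by (simp add: mult_le_0_iff)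
    ultimately show "\<mu> = \<nu>" using eq by simp
  qed
  then show "flat_piece (facet u) (normal u)" "\<And>y. y \<in> facet u \<Longrightarrow> normal u \<bullet> (u - y) < 0"
    using P.flat_piece_axioms \<nu>(3) by auto
qed

lemma normal_bary:
  assumes u: "u \<in> C" and y: "y \<in> facet u"
  shows "normal u \<bullet> (x - y) = bary x u * (normal u \<bullet> (u - y))"
proof -
  interpret P: flat_piece "facet u" "normal u" by (rule outer_normal(1)[OF u])
  obtain y0 where y0: "y0 \<in> C" "y0 \<noteq> u" using obtain_vertex .
  have y0f: "y0 \<in> facet u" using vertex_in_facet y0 by blast
  have "normal u \<bullet> (w - y0) = 0" if "w \<in> C" "w \<noteq> u" for w
    by (rule P.normal_orthogonal[OF vertex_in_facet[OF that] y0f])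
  note ib = inner_eq_bary[OF u y0 this, of x]
  have "normal u \<bullet> y = normal u \<bullet> y0" using P.normal_orthogonal[OF y y0f] by (simp add: inner_diff_right)
  then show ?thesis using ib by (simp add: inner_diff_right)
qed

text \<open>From y in the facet opposite a, the line in direction a - b stays in T exactly up to the
  parameter \<open>bary y b\<close>, where it leaves through the facet opposite b. The fundamental
  theorem gives the difference of p at both ends, and \<open>surface_shear\<close> moves the
  integral of the exit values to the facet opposite b.\<close>

lemma integral_grad_edge:
  assumes a: "a \<in> C" and b: "b \<in> C" and ab: "a \<noteq> b" and p: "p \<in> polys k"
  shows "(\<integral>x. grad p x \<bullet> (a - b) \<partial>lebesgue_on T)
    = (normal a \<bullet> (a - b)) * (\<integral>x. p x \<partial>\<sigma> a)
    + (normal b \<bullet> (a - b)) * (\<integral>x. p x \<partial>\<sigma> b)"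
proof -
  define e where "e = a - b"
  interpret A: flat_piece "facet a" "normal a" by (rule outer_normal(1)[OF a])
  interpret B: flat_piece "facet b" "normal b" by (rule outer_normal(1)[OF b])
  have bF: "b \<in> facet a" and aF: "a \<in> facet b" using vertex_in_facet a b ab by auto
  have na: "normal a \<bullet> e < 0" using outer_normal(2)[OF a bF] by (simp add: e_def)
  have nb: "normal b \<bullet> e > 0" using outer_normal(2)[OF b aF] by (simp add: e_def inner_diff_right)
  note line = bary_line[OF a b ab, folded e_def]
  have cp: "continuous_on S p" for S by (rule continuous_on_polys[OF p])
  have cg: "continuous_on S (\<lambda>x. grad p x \<bullet> e)" for S
    by (rule continuous_on_polys[OF polys_grad_inner[OF polys_mono[OF p]], of k]) simp
  have hyp: "normal a \<bullet> (y - b) = 0 \<longleftrightarrow> bary y a = 0" for y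
    using normal_bary[OF a bF, of y] na by (auto simp: e_def)
  \<comment> \<open>In multiples of e, the height over the facet opposite b is minus the
    b-coordinate; the projection along e is therefore the exit point.\<close>
  have heightB: "B.height e y = - bary y b" for y
  proof -
    have "normal b \<bullet> (y - B.base_point) = bary y b * (normal b \<bullet> (b - B.base_point))"
      by (rule normal_bary[OF b B.base_point_in])
    also have "normal b \<bullet> (b - B.base_point) = - (normal b \<bullet> e)"
      using B.normal_orthogonal[OF aF B.base_point_in] by (simp add: e_def inner_diff_right)
    finally show ?thesis using nb by (simp add: B.height_def)
  qed
  have projB: "B.proj_along e y = y + bary y b *\<^sub>R e" for y by (simp add: B.proj_along_def heightB)
  have inT: "y + s *\<^sub>R e \<in> T \<longleftrightarrow> y \<in> facet a \<and> s \<in> {0..bary y b}" if y: "bary y a = 0" for y s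
  proof -
    have "y + s *\<^sub>R e \<in> T \<longleftrightarrow> 0 \<le> s \<and> s \<le> bary y b \<and> (\<forall>u\<in>C - {a, b}. 0 \<le> bary y u)"
      unfolding mem_T using a b ab y by (auto simp: line)
    moreover have "y \<in> facet a \<longleftrightarrow> 0 \<le> bary y b \<and> (\<forall>u\<in>C - {a, b}. 0 \<le> bary y u)"
      unfolding mem_facet[OF a] mem_T using b y by auto
    ultimately show ?thesis by auto
  qed
  have projF: "y \<in> facet a \<longleftrightarrow> B.proj_along e y \<in> facet b" if y: "bary y a = 0" for y
    unfolding projB mem_facet[OF b] inT[OF y] using mem_facet[OF a] b a ab by (auto simp: line mem_T)
  have g: "integrable lborel (\<lambda>x. indicator T x * (grad p x \<bullet> e))"
    by (rule lebesgue_on_compact(3)[OF compact_T cg])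
  have h: "(\<integral>s. indicator T (y + s *\<^sub>R e) * (grad p (y + s *\<^sub>R e) \<bullet> e) \<partial>lborel)
     = p (B.proj_along e y) - p y" if y: "y \<in> facet a" for y
  proof -
    have y0: "bary y a = 0" and yb: "0 \<le> bary y b" using y b by (auto simp: mem_facet[OF a] mem_T)
    have cl: "continuous_on UNIV (\<lambda>s. grad p (y + s *\<^sub>R e) \<bullet> e)"
      by (rule continuous_on_compose2[OF cg[of UNIV]]) (auto intro!: continuous_intros)
    have "(\<integral>s. indicator T (y + s *\<^sub>R e) * (grad p (y + s *\<^sub>R e) \<bullet> e) \<partial>lborel)
      = (\<integral>s. (grad p (y + s *\<^sub>R e) \<bullet> e) * indicator {0..bary y b} s \<partial>lborel)"
      using y by (intro Bochner_Integration.integral_cong) (auto simp: indicator_def inT[OF y0])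
    also have "\<dots> = p (y + bary y b *\<^sub>R e) - p (y + 0 *\<^sub>R e)"
    proof (rule integral_FTC_Icc_real[OF yb])
      fix s show "((\<lambda>s. p (y + s *\<^sub>R e)) has_real_derivative grad p (y + s *\<^sub>R e) \<bullet> e) (at s)"
        by (rule polys_line_derivative[OF p])
      show "isCont (\<lambda>s. grad p (y + s *\<^sub>R e) \<bullet> e) s"
        using cl by (simp add: continuous_on_eq_continuous_at)
    qed
    finally show ?thesis by (simp add: projB)
  qed
  have 0: "(\<integral>s. indicator T (y + s *\<^sub>R e) * (grad p (y + s *\<^sub>R e) \<bullet> e) \<partial>lborel) = 0"
    if "normal a \<bullet> (y - b) = 0" "y \<notin> facet a" for y
    using inT[of y] that by (simp add: hyp)
  have cF: "continuous_on (facet a) (\<lambda>y. p (B.proj_along e y))"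
    by (rule continuous_on_compose2[OF cp[of UNIV] B.continuous_proj]) simp
  have "(\<integral>x. grad p x \<bullet> e \<partial>lebesgue_on T) = (\<integral>x. indicator T x * (grad p x \<bullet> e) \<partial>lborel)"
    by (rule lebesgue_on_compact(2)[OF compact_T cg])
  also have "\<dots> = \<bar>normal a \<bullet> e\<bar> * (\<integral>y. p (B.proj_along e y) - p y \<partial>\<sigma> a)"
    using surface_measure_fubini(2)[OF A.compact A.direction A.unit _ bF g h 0
      A.borel_measurable_piece[OF continuous_on_diff[OF cF cp]]] na by simp
  also have "(\<integral>y. p (B.proj_along e y) - p y \<partial>\<sigma> a)
    = (\<integral>y. p (B.proj_along e y) \<partial>\<sigma> a) - (\<integral>y. p y \<partial>\<sigma> a)"
    by (intro Bochner_Integration.integral_diff A.integrable_surface cF cp)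
  also have "\<bar>normal a \<bullet> e\<bar> * \<dots> = \<bar>normal a \<bullet> e\<bar> * (\<integral>y. p (B.proj_along e y) \<partial>\<sigma> a)
    + (normal a \<bullet> e) * (\<integral>y. p y \<partial>\<sigma> a)"
    using na by (simp add: algebra_simps)
  \<comment> \<open>Both sides equal the integral over the prism with base \<open>facet b\<close>,
    cut once along \<open>facet a\<close> and once along \<open>facet b\<close>.\<close>
  also have "\<bar>normal a \<bullet> e\<bar> * (\<integral>y. p (B.proj_along e y) \<partial>\<sigma> a)
    = (normal b \<bullet> e) * (\<integral>y. p y \<partial>\<sigma> b)"
    using B.surface_shear(2)[OF A.flat_piece_axioms _ _ _ bF cp, of e] projF B.cylinder_integral[OF _ cp, of e] na nb
    by (simp add: hyp)
  finally show ?thesis by (simp add: e_def)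
qed

text \<open>The edges at one vertex b span all directions, and both sides are linear in the
  direction v.\<close>

lemma integral_grad:
  assumes p: "p \<in> polys k"
  shows "(\<integral>x. grad p x \<bullet> v \<partial>lebesgue_on T) = (\<Sum>u\<in>C. \<integral>x. p x * (v \<bullet> normal u) \<partial>\<sigma> u)"
proof -
  obtain b where b: "b \<in> C" using obtain_vertex .
  have gi: "integrable (lebesgue_on T) (\<lambda>x. grad p x \<bullet> w)" for w
    by (rule integrable_polys[OF compact_T polys_grad_inner[OF polys_mono[OF p]], of k]) simp
  have edge: "(\<integral>x. grad p x \<bullet> (a - b) \<partial>lebesgue_on T)
    = (\<Sum>u\<in>C. (normal u \<bullet> (a - b)) * (\<integral>x. p x \<partial>\<sigma> u))" if a: "a \<in> C" for a
  proof (cases "a = b")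
    case True
    then show ?thesis by simp
  next
    case False
    have "(\<Sum>u\<in>C. (normal u \<bullet> (a - b)) * (\<integral>x. p x \<partial>\<sigma> u))
      = (\<Sum>u\<in>{a, b}. (normal u \<bullet> (a - b)) * (\<integral>x. p x \<partial>\<sigma> u))"
    proof (rule sum.mono_neutral_right[OF finite])
      show "\<forall>u\<in>C - {a, b}. (normal u \<bullet> (a - b)) * (\<integral>x. p x \<partial>\<sigma> u) = 0"
      proof
        fix u assume u: "u \<in> C - {a, b}"
        interpret P: flat_piece "facet u" "normal u" by (rule outer_normal(1)) (use u in auto)
        have "normal u \<bullet> (a - b) = 0"
          using u a b by (intro P.normal_orthogonal vertex_in_facet) auto
        then show "(normal u \<bullet> (a - b)) * (\<integral>x. p x \<partial>\<sigma> u) = 0" by simp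
      qed
    qed (use a b in auto)
    then show ?thesis using integral_grad_edge[OF a b False p] False by simp
  qed
  \<comment> \<open>The barycentric coordinates of b + v sum to one, which makes v a combination of
    the edges w - b.\<close>
  define c where "c = bary (b + v)"
  have "v = (\<Sum>w\<in>C. c w *\<^sub>R w) - (\<Sum>w\<in>C. c w) *\<^sub>R b" by (simp add: bary c_def)
  also have "\<dots> = (\<Sum>w\<in>C. c w *\<^sub>R (w - b))"
    by (simp add: scaleR_diff_right sum_subtractf scaleR_sum_left)
  finally have v: "v = (\<Sum>w\<in>C. c w *\<^sub>R (w - b))" .
  have "(\<integral>x. grad p x \<bullet> v \<partial>lebesgue_on T) = (\<integral>x. (\<Sum>w\<in>C. c w * (grad p x \<bullet> (w - b))) \<partial>lebesgue_on T)"
    by (subst v) (simp add: inner_sum_right)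
  also have "\<dots> = (\<Sum>w\<in>C. c w * (\<integral>x. grad p x \<bullet> (w - b) \<partial>lebesgue_on T))"
    using gi by (subst Bochner_Integration.integral_sum) auto
  also have "\<dots> = (\<Sum>w\<in>C. \<Sum>u\<in>C. c w * ((normal u \<bullet> (w - b)) * (\<integral>x. p x \<partial>\<sigma> u)))"
    by (intro sum.cong refl) (simp add: edge sum_distrib_left)
  also have "\<dots> = (\<Sum>u\<in>C. \<Sum>w\<in>C. c w * ((normal u \<bullet> (w - b)) * (\<integral>x. p x \<partial>\<sigma> u)))"
    by (rule sum.swap)
  also have "\<dots> = (\<Sum>u\<in>C. (normal u \<bullet> v) * (\<integral>x. p x \<partial>\<sigma> u))"
    by (intro sum.cong refl, subst v) (simp add: inner_sum_right sum_distrib_right mult.assoc)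
  finally show ?thesis by (simp add: inner_commute mult.commute)
qed

end

section \<open>Projections and the local reconstruction\<close>

text \<open>Uniqueness in the definite description: the difference of two candidates is orthogonal
  to itself.\<close>

lemma elem_proj_eqI:
  fixes S :: "(real^'n) set"
  assumes S: "compact S" "ball a r \<subseteq> S" "0 < r" and f: "f \<in> polys m" and p: "p \<in> polys k"
    and orth: "\<And>q. q \<in> polys k \<Longrightarrow> (\<integral>x. (f x - p x) * q x \<partial>lebesgue_on S) = 0"
  shows "elem_proj k S f = p"
  unfolding elem_proj_def L2_projection_def
proof (rule the_equality)
  show "p \<in> polys k \<and> (\<forall>q\<in>polys k. (\<integral>x. (f x - p x) * q x \<partial>lebesgue_on S) = 0)" using p orth by blast
  fix p' assume p': "p' \<in> polys k \<and> (\<forall>q\<in>polys k. (\<integral>x. (f x - p' x) * q x \<partial>lebesgue_on S) = 0)"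
  let ?d = "\<lambda>x. p' x - p x"
  have d: "?d \<in> polys k" using p p' by (intro polys_diff) auto
  have fm: "f \<in> polys (m + k)" "p \<in> polys (m + k)" "p' \<in> polys (m + k)"
    using f p p' polys_mono by (auto intro: polys_mono)
  have i: "integrable (lebesgue_on S) (\<lambda>x. (f x - p x) * ?d x)" "integrable (lebesgue_on S) (\<lambda>x. (f x - p' x) * ?d x)"
    by (rule integrable_polys_mult[OF S(1) polys_diff[OF fm(1,2)] d],
        rule integrable_polys_mult[OF S(1) polys_diff[OF fm(1,3)] d])
  have "(\<integral>x. ?d x * ?d x \<partial>lebesgue_on S) = (\<integral>x. (f x - p x) * ?d x - (f x - p' x) * ?d x \<partial>lebesgue_on S)"
    by (simp add: algebra_simps)
  also have "\<dots> = 0" using i orth[OF d] p' d by simp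
  finally have "?d = (\<lambda>x. 0)" by (rule polys_L2_definite[OF S d])
  then show "p' = p" by (simp add: fun_eq_iff)
qed

lemma elem_proj:
  fixes S :: "(real^'n) set"
  assumes S: "compact S" "ball a r \<subseteq> S" "0 < r" and f: "f \<in> polys m"
  shows "elem_proj k S f \<in> polys k"
    and "q \<in> polys k \<Longrightarrow> (\<integral>x. (f x - elem_proj k S f x) * q x \<partial>lebesgue_on S) = 0"
proof -
  obtain p where p: "p \<in> polys k" and "\<forall>q\<in>polys k. (\<integral>x. (f x - p x) * q x \<partial>lebesgue_on S) = 0"
    by (rule L2_projection_exists[where M = "lebesgue_on S", OF integrable_polys[OF S(1)] f])
  then have orth: "(\<integral>x. (f x - p x) * q x \<partial>lebesgue_on S) = 0" if "q \<in> polys k" for q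
    using that by blast
  have "elem_proj k S f = p" by (rule elem_proj_eqI[OF S f p orth])
  then show "elem_proj k S f \<in> polys k"
    and "q \<in> polys k \<Longrightarrow> (\<integral>x. (f x - elem_proj k S f x) * q x \<partial>lebesgue_on S) = 0"
    using p orth by auto
qed

text \<open>This turns the normalisation of the reconstruction into an equality of
  integrals.\<close>

lemma elem_proj_0_eq_0_iff:
  fixes S :: "(real^'n) set"
  assumes S: "compact S" "ball a r \<subseteq> S" "0 < r" and f: "f \<in> polys m"
  shows "elem_proj 0 S f = (\<lambda>x. 0) \<longleftrightarrow> integral\<^sup>L (lebesgue_on S) f = 0"
proof
  assume "elem_proj 0 S f = (\<lambda>x. 0)"
  then show "integral\<^sup>L (lebesgue_on S) f = 0"
    using elem_proj(2)[OF S f polys_const[of 1 0]] by simp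
next
  assume *: "integral\<^sup>L (lebesgue_on S) f = 0"
  show "elem_proj 0 S f = (\<lambda>x. 0)"
  proof (rule elem_proj_eqI[OF S f polys_zero])
    fix q :: "real^'n \<Rightarrow> real" assume "q \<in> polys 0"
    then obtain c where "q = (\<lambda>x. c)" by (auto simp: polys_def)
    then show "(\<integral>x. (f x - 0) * q x \<partial>lebesgue_on S) = 0" using * by simp
  qed
qed

section \<open>Projections on facets\<close>

context flat_piece
begin

lemma integrable_surface_polys: "p \<in> polys j \<Longrightarrow> integrable (surface_measure F) p"
  by (intro integrable_surface continuous_on_polys)

lemma integrable_surface_polys_mult:
  "p \<in> polys j \<Longrightarrow> q \<in> polys k \<Longrightarrow> integrable (surface_measure F) (\<lambda>x. p x * q x)"
  by (rule integrable_surface_polys[OF polys_mult])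

text \<open>The function g agrees with a polynomial f only on F, as is the case for skeletal
  functions, which are restrictions. Two candidates coincide on F, and their extensional form makes
  them equal as functions.\<close>

lemma facet_proj_eqI:
  assumes conv: "convex F" and f: "f \<in> polys m" and p: "p \<in> polys k" and gf: "\<And>x. x \<in> F \<Longrightarrow> g x = f x"
    and orth: "\<And>q. q \<in> polys k \<Longrightarrow> (\<integral>x. (f x - p x) * q x \<partial>surface_measure F) = 0"
  shows "facet_proj k F g = restrict p F"
  unfolding facet_proj_def L2_projection_def
proof (rule the_equality)
  have int_eq: "(\<integral>x. (g x - restrict p' F x) * restrict q F x \<partial>surface_measure F)
    = (\<integral>x. (f x - p' x) * q x \<partial>surface_measure F)" for p' q
    by (rule surface_integral_cong) (simp add: gf)
  show "restrict p F \<in> facet_polys k F \<and> (\<forall>q\<in>facet_polys k F. (\<integral>x. (g x - restrict p F x) * q x \<partial>surface_measure F) = 0)"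
    using p orth int_eq by (auto simp: facet_polys_def)
  fix P assume P: "P \<in> facet_polys k F \<and> (\<forall>q\<in>facet_polys k F. (\<integral>x. (g x - P x) * q x \<partial>surface_measure F) = 0)"
  then obtain p' where p': "p' \<in> polys k" "P = restrict p' F" by (auto simp: facet_polys_def)
  let ?d = "\<lambda>x. p' x - p x"
  have d: "?d \<in> polys k" using p p' by (intro polys_diff) auto
  have fm: "f \<in> polys (m + k)" "p \<in> polys (m + k)" "p' \<in> polys (m + k)"
    using f p p' by (auto intro: polys_mono)
  have i: "integrable (surface_measure F) (\<lambda>x. (f x - p x) * ?d x)" "integrable (surface_measure F) (\<lambda>x. (f x - p' x) * ?d x)"
    by (rule integrable_surface_polys_mult[OF polys_diff[OF fm(1,2)] d],
        rule integrable_surface_polys_mult[OF polys_diff[OF fm(1,3)] d])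
  have "restrict ?d F \<in> facet_polys k F" using d by (auto simp: facet_polys_def)
  then have "(\<integral>x. (f x - p' x) * ?d x \<partial>surface_measure F) = 0"
    using P int_eq[of p' ?d] by (auto simp: p'(2))
  moreover have "(\<integral>x. ?d x * ?d x \<partial>surface_measure F) = (\<integral>x. (f x - p x) * ?d x - (f x - p' x) * ?d x \<partial>surface_measure F)"
    by (simp add: algebra_simps)
  ultimately have "(\<integral>x. ?d x * ?d x \<partial>surface_measure F) = 0" using i orth[OF d] by simp
  then have "?d x = 0" if "x \<in> F" for x by (rule surface_L2_definite[OF conv d _ that])
  then show "P = restrict p F" unfolding p'(2) by (intro restrict_ext) simp
qed

lemma facet_proj:
  assumes conv: "convex F" and f: "f \<in> polys m" and gf: "\<And>x. x \<in> F \<Longrightarrow> g x = f x"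
  obtains p where "p \<in> polys k" "facet_proj k F g = restrict p F"
    "\<And>q. q \<in> polys k \<Longrightarrow> (\<integral>x. (f x - p x) * q x \<partial>surface_measure F) = 0"
proof -
  obtain p where p: "p \<in> polys k" and "\<forall>q\<in>polys k. (\<integral>x. (f x - p x) * q x \<partial>surface_measure F) = 0"
    by (rule L2_projection_exists[where M = "surface_measure F", OF integrable_surface_polys f])
  then have orth: "(\<integral>x. (f x - p x) * q x \<partial>surface_measure F) = 0" if "q \<in> polys k" for q
    using that by blast
  show ?thesis by (rule that[OF p facet_proj_eqI[OF conv f p gf orth] orth])
qed

end

section \<open>The energy product and its kernel\<close>

lemma integrable_grad_inner:
  fixes p q :: "real^'n \<Rightarrow> real"
  assumes "compact S" "p \<in> polys j" "q \<in> polys k"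
  shows "integrable (lebesgue_on S) (\<lambda>x. grad p x \<bullet> grad q x)"
  unfolding inner_vec_def inner_real_def
  by (intro Bochner_Integration.integrable_sum)
     (rule integrable_polys_mult[OF assms(1) polys_grad'[OF assms(2)] polys_grad'[OF assms(3)]])

lemma grad_zero_imp_const:
  fixes p :: "real^'n \<Rightarrow> real"
  assumes p: "p \<in> polys k" and 0: "\<And>x. grad p x = 0"
  shows "p x = p y"
proof -
  have "(p has_derivative (\<lambda>h. 0)) (at x within UNIV)" for x
    using polys_GDERIV_grad[OF p, of x] 0 by (simp add: gderiv_def)
  then show ?thesis using has_derivative_zero_constant[of UNIV p] by (metis UNIV_I convex_UNIV)
qed

text \<open>Zero energy makes every partial derivative vanish, so p is constant. The integral of p^2
  is then this constant times the integral of p.\<close>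

lemma polys_energy_definite:
  fixes p :: "real^'n \<Rightarrow> real"
  assumes S: "compact S" "ball a r \<subseteq> S" "0 < r" and p: "p \<in> polys k"
    and g: "(\<integral>x. grad p x \<bullet> grad p x \<partial>lebesgue_on S) = 0" and m: "integral\<^sup>L (lebesgue_on S) p = 0"
  shows "p = (\<lambda>x. 0)"
proof -
  let ?g = "\<lambda>i x. grad p x $ i"
  have gp: "?g i \<in> polys k" for i by (rule polys_grad'[OF p])
  have "(\<Sum>i\<in>UNIV. \<integral>x. ?g i x * ?g i x \<partial>lebesgue_on S) = 0"
    using g unfolding inner_vec_def inner_real_def
    by (subst (asm) Bochner_Integration.integral_sum) (auto intro: integrable_polys_mult[OF S(1) gp gp])
  then have "(\<integral>x. ?g i x * ?g i x \<partial>lebesgue_on S) = 0" for i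
    by (subst (asm) sum_nonneg_eq_0_iff) auto
  then have "?g i = (\<lambda>x. 0)" for i by (rule polys_L2_definite[OF S gp])
  then have "grad p x = 0" for x by (simp add: vec_eq_iff fun_eq_iff)
  then have c: "p x = p a" for x by (rule grad_zero_imp_const[OF p])
  then have "p = (\<lambda>x. p a)" by blast
  then have "(\<integral>x. p x * p x \<partial>lebesgue_on S) = p a * integral\<^sup>L (lebesgue_on S) p"
    by (metis (no_types, lifting) Bochner_Integration.integral_cong integral_mult_right_zero)
  then show ?thesis using m by (intro polys_L2_definite[OF S p]) simp
qed

lemma semi_inner_product_energy:
  fixes S :: "(real^'n) set"
  assumes "compact S"
  shows "semi_inner_product (polys m) (\<lambda>p q. (\<integral>x. grad p x \<bullet> grad q x \<partial>lebesgue_on S)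
    + integral\<^sup>L (lebesgue_on S) p * integral\<^sup>L (lebesgue_on S) q)"
proof
  fix p q r :: "real^'n \<Rightarrow> real" and c :: real
  assume p: "p \<in> polys m" and q: "q \<in> polys m" and r: "r \<in> polys m"
  show "(\<integral>x. grad (\<lambda>x. p x + q x) x \<bullet> grad r x \<partial>lebesgue_on S)
      + integral\<^sup>L (lebesgue_on S) (\<lambda>x. p x + q x) * integral\<^sup>L (lebesgue_on S) r
    = (\<integral>x. grad p x \<bullet> grad r x \<partial>lebesgue_on S) + integral\<^sup>L (lebesgue_on S) p * integral\<^sup>L (lebesgue_on S) r
      + ((\<integral>x. grad q x \<bullet> grad r x \<partial>lebesgue_on S) + integral\<^sup>L (lebesgue_on S) q * integral\<^sup>L (lebesgue_on S) r)"
    using integrable_grad_inner[OF assms p r] integrable_grad_inner[OF assms q r]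
      integrable_polys[OF assms p] integrable_polys[OF assms q]
    by (simp add: grad_add[OF p q] inner_add_left distrib_right)
  show "(\<integral>x. grad (\<lambda>x. c * p x) x \<bullet> grad r x \<partial>lebesgue_on S)
      + integral\<^sup>L (lebesgue_on S) (\<lambda>x. c * p x) * integral\<^sup>L (lebesgue_on S) r
    = c * ((\<integral>x. grad p x \<bullet> grad r x \<partial>lebesgue_on S) + integral\<^sup>L (lebesgue_on S) p * integral\<^sup>L (lebesgue_on S) r)"
    by (simp add: grad_scale[OF p] distrib_left)
qed (auto simp: polys_zero mult.commute inner_commute intro: polys_add polys_scale)

section \<open>Green's formula and the Neumann problem on one element\<close>

context full_simplex
begin

lemma facet_nonempty: "facet u \<noteq> {}"
proof -
  obtain w where "w \<in> C" "w \<noteq> u" using obtain_vertex .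
  then show ?thesis using vertex_in_facet by blast
qed

lemma facets_T: "facets T = facet ` C"
  unfolding facets_def T_def facet_of_convex_hull_affine_independent[OF independent]
  using facet_nonempty by (auto simp: facet_def)

lemma inj_facet: "inj_on facet C"
proof (rule inj_onI, rule ccontr)
  fix u w assume *: "u \<in> C" "w \<in> C" "facet u = facet w" "u \<noteq> w"
  then have "u \<in> facet u" using vertex_in_facet[of u w] by simp
  then show False using mem_facet[of u u] bary_vertex[of u u] * by simp
qed

lemma sum_facets: "(\<Sum>F\<in>facets T. f F) = (\<Sum>u\<in>C. f (facet u))"
  unfolding facets_T by (simp add: sum.reindex[OF inj_facet])

text \<open>The divergence theorem is applied to p times each partial derivative of w. The volume
  term pairs p with second derivatives of w, which lie in \<open>polys k\<close>, so orthogonality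
  removes it.\<close>

lemma green:
  assumes p: "p \<in> polys j" and w: "w \<in> polys (Suc k)"
    and orth: "\<And>q. q \<in> polys k \<Longrightarrow> (\<integral>x. p x * q x \<partial>lebesgue_on T) = 0"
  shows "(\<integral>x. grad p x \<bullet> grad w x \<partial>lebesgue_on T) = (\<Sum>u\<in>C. \<integral>x. p x * (grad w x \<bullet> normal u) \<partial>\<sigma> u)"
proof -
  let ?g = "\<lambda>i x. grad w x $ i"
  have gw: "?g i \<in> polys k" for i by (rule polys_grad[OF w])
  have gp: "(\<lambda>x. grad p x $ i) \<in> polys j" for i by (rule polys_grad'[OF p])
  have ggw: "(\<lambda>x. grad (?g i) x $ i) \<in> polys k" for i by (rule polys_grad'[OF gw])
  have comp: "(\<integral>x. grad p x $ i * ?g i x \<partial>lebesgue_on T)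
    = (\<Sum>u\<in>C. \<integral>x. p x * ?g i x * normal u $ i \<partial>\<sigma> u)" for i
  proof -
    have "(\<Sum>u\<in>C. \<integral>x. p x * ?g i x * normal u $ i \<partial>\<sigma> u)
      = (\<integral>x. grad (\<lambda>x. p x * ?g i x) x \<bullet> axis i 1 \<partial>lebesgue_on T)"
      by (subst integral_grad[OF polys_mult[OF p gw]]) (simp add: inner_axis' )
    also have "\<dots> = (\<integral>x. p x * grad (?g i) x $ i + grad p x $ i * ?g i x \<partial>lebesgue_on T)"
      by (simp add: grad_mult[OF p gw] inner_axis mult.commute)
    also have "\<dots> = (\<integral>x. p x * grad (?g i) x $ i \<partial>lebesgue_on T) + (\<integral>x. grad p x $ i * ?g i x \<partial>lebesgue_on T)"
      by (rule Bochner_Integration.integral_add[OF integrable_polys_mult[OF compact_T p ggw]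
            integrable_polys_mult[OF compact_T gp gw]])
    also have "(\<integral>x. p x * grad (?g i) x $ i \<partial>lebesgue_on T) = 0" by (rule orth[OF ggw])
    finally show ?thesis by simp
  qed
  have "(\<integral>x. grad p x \<bullet> grad w x \<partial>lebesgue_on T) = (\<Sum>i\<in>UNIV. \<integral>x. grad p x $ i * ?g i x \<partial>lebesgue_on T)"
    unfolding inner_vec_def inner_real_def
    by (intro Bochner_Integration.integral_sum integrable_polys_mult[OF compact_T gp gw])
  also have "\<dots> = (\<Sum>u\<in>C. \<Sum>i\<in>UNIV. \<integral>x. p x * ?g i x * normal u $ i \<partial>\<sigma> u)"
    unfolding comp by (rule sum.swap)
  also have "\<dots> = (\<Sum>u\<in>C. \<integral>x. p x * (grad w x \<bullet> normal u) \<partial>\<sigma> u)"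
  proof (rule sum.cong[OF refl])
    fix u assume u: "u \<in> C"
    interpret P: flat_piece "facet u" "normal u" by (rule outer_normal(1)[OF u])
    have "(\<Sum>i\<in>UNIV. \<integral>x. p x * ?g i x * normal u $ i \<partial>\<sigma> u)
      = (\<integral>x. (\<Sum>i\<in>UNIV. p x * ?g i x * normal u $ i) \<partial>\<sigma> u)"
      by (rule Bochner_Integration.integral_sum[symmetric])
         (intro integrable_mult_left impI P.integrable_surface_polys_mult[OF p gw])
    also have "\<dots> = (\<integral>x. p x * (grad w x \<bullet> normal u) \<partial>\<sigma> u)"
      by (simp add: inner_vec_def sum_distrib_left mult.assoc)
    finally show "(\<Sum>i\<in>UNIV. \<integral>x. p x * ?g i x * normal u $ i \<partial>\<sigma> u)
      = (\<integral>x. p x * (grad w x \<bullet> normal u) \<partial>\<sigma> u)" .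
  qed
  finally show ?thesis .
qed

definition boundary_term :: "(real^'n::_ \<Rightarrow> real) \<Rightarrow> ((real^'n::_) set \<Rightarrow> real^'n::_ \<Rightarrow> real) \<Rightarrow> (real^'n::_ \<Rightarrow> real) \<Rightarrow> real" where
  "boundary_term v f w = (\<Sum>F\<in>facets T. \<integral>x. (v x - f F x) * (grad w x \<bullet> outer_normal T F) \<partial>surface_measure F)"

text \<open>The Neumann problem defining the reconstruction is made uniquely solvable by adding the
  product of the integrals to the energy; testing with constants shows that the added term vanishes.\<close>

lemma local_reconstruction_exists:
  assumes r: "ball a r \<subseteq> T" "0 < r" and v: "v \<in> polys k"
    and f: "\<And>u. u \<in> C \<Longrightarrow> f (facet u) \<in> facet_polys k (facet u)"
  obtains R where "R \<in> polys (k + 1)" "integral\<^sup>L (lebesgue_on T) R = integral\<^sup>L (lebesgue_on T) v"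
    "\<And>w. w \<in> polys (k + 1) \<Longrightarrow> (\<integral>x. grad R x \<bullet> grad w x \<partial>lebesgue_on T)
      = (\<integral>x. grad v x \<bullet> grad w x \<partial>lebesgue_on T) - boundary_term v f w"
proof -
  let ?I = "integral\<^sup>L (lebesgue_on T)"
  let ?B = "\<lambda>p q. (\<integral>x. grad p x \<bullet> grad q x \<partial>lebesgue_on T) + ?I p * ?I q"
  interpret semi_inner_product "polys (k + 1)" ?B by (rule semi_inner_product_energy[OF compact_T])
  have v1: "v \<in> polys (k + 1)" using v by (rule polys_mono) simp
  have bi: "integrable (\<sigma> u) (\<lambda>x. (v x - f (facet u) x) * (grad w x \<bullet> normal u))"
    if u: "u \<in> C" and w: "w \<in> polys (k + 1)" for u w
  proof -
    interpret P: flat_piece "facet u" "normal u" by (rule outer_normal(1)[OF u])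
    obtain \<phi> where \<phi>: "\<phi> \<in> polys k" "f (facet u) = restrict \<phi> (facet u)"
      using f[OF u] by (auto simp: facet_polys_def)
    have "integrable (\<sigma> u) (\<lambda>x. (v x - \<phi> x) * (grad w x \<bullet> normal u))"
      using w by (intro P.integrable_surface_polys_mult[OF polys_diff[OF v \<phi>(1)] polys_grad_inner]) simp
    then show ?thesis by (subst P.surface_integrable_cong[where g = "\<lambda>x. (v x - \<phi> x) * (grad w x \<bullet> normal u)"]) (auto simp: \<phi>)
  qed
  have b_add: "boundary_term v f (\<lambda>x. p x + q x) = boundary_term v f p + boundary_term v f q"
    if p: "p \<in> polys (k + 1)" and q: "q \<in> polys (k + 1)" for p q
    unfolding boundary_term_def sum_facets sum.distrib[symmetric] grad_add[OF p q] inner_add_left distrib_left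
    by (intro sum.cong refl Bochner_Integration.integral_add bi p q)
  have b_scale: "boundary_term v f (\<lambda>x. c * p x) = c * boundary_term v f p"
    if p: "p \<in> polys (k + 1)" for p c
    unfolding boundary_term_def sum_facets grad_scale[OF p] sum_distrib_left
    by (intro sum.cong refl) (simp add: mult.left_commute[of _ c])
  define L where "L w = ?B v w - boundary_term v f w" for w
  have "\<exists>p\<in>lin_span monom_fun (multi_indices (k + 1)).
      \<forall>q\<in>lin_span monom_fun (multi_indices (k + 1)). ?B p q = L q"
  proof (rule riesz[where L = L, OF finite_multi_indices])
    show "monom_fun ` {\<alpha>. sum \<alpha> (UNIV :: 'n set) \<le> k + 1} \<subseteq> polys (k + 1)" by (auto intro: polys_monom)
    fix p :: "real^'n::_ \<Rightarrow> real" assume p: "p \<in> polys (k + 1)"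
    show "L (\<lambda>x. p x + q x) = L p + L q" if q: "q \<in> polys (k + 1)" for q :: "real^'n::_ \<Rightarrow> real"
      unfolding L_def add_right[OF p q v1] b_add[OF p q] by simp
    show s: "L (\<lambda>x. c * p x) = c * L p" for c
      unfolding L_def scale_right[OF p v1] b_scale[OF p] by (simp add: right_diff_distrib)
    assume "?B p p = 0"
    moreover have "0 \<le> (\<integral>x. grad p x \<bullet> grad p x \<partial>lebesgue_on T)" by simp
    moreover have "0 \<le> ?I p * ?I p" by simp
    ultimately have "(\<integral>x. grad p x \<bullet> grad p x \<partial>lebesgue_on T) = 0" "?I p = 0"
      by (smt (verit) mult_eq_0_iff)+
    then have "p = (\<lambda>x. 0)" by (rule polys_energy_definite[OF compact_T r p])
    then have "p = (\<lambda>x. 0 * p x)" by simp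
    then show "L p = 0" using s[of 0] by simp
  qed
  then obtain R where R: "R \<in> polys (k + 1)" "\<And>w. w \<in> polys (k + 1) \<Longrightarrow> ?B R w = L w"
    unfolding polys_eq_lin_span[symmetric] by blast
  have one: "(\<lambda>x :: real^'n::_. 1 :: real) \<in> polys (k + 1)" by (rule polys_const)
  have "?B R (\<lambda>x. 1) = ?B v (\<lambda>x. 1)"
    using R(2)[OF one] by (simp add: L_def boundary_term_def grad_const)
  then have "(?I R - ?I v) * ?I (\<lambda>x. 1 :: real) = 0" by (simp add: grad_const left_diff_distrib)
  moreover have "?I (\<lambda>x. 1 :: real) \<noteq> 0"
  proof
    \<comment> \<open>If the volume were zero, the constant 1 would have zero energy and zero
      integral, and would thus be the zero polynomial.\<close>
    assume z: "?I (\<lambda>x. 1 :: real) = 0"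
    have "(\<lambda>x :: real^'n::_. 1 :: real) = (\<lambda>x. 0)"
      by (rule polys_energy_definite[OF compact_T r one _ z]) (simp add: grad_const)
    then show False using fun_cong[of "\<lambda>x :: real^'n::_. 1 :: real" "\<lambda>x. 0" 0] by simp
  qed
  ultimately have m: "?I R = ?I v" by simp
  show ?thesis
  proof (rule that[OF R(1) m])
    fix w :: "real^'n::_ \<Rightarrow> real" assume "w \<in> polys (k + 1)"
    from R(2)[OF this] show "(\<integral>x. grad R x \<bullet> grad w x \<partial>lebesgue_on T)
      = (\<integral>x. grad v x \<bullet> grad w x \<partial>lebesgue_on T) - boundary_term v f w"
      by (simp add: L_def m)
  qed
qed

text \<open>The difference solves the homogeneous problem with mean zero; tested with itself, it has
  zero energy.\<close>

lemma local_reconstruction_unique: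
  assumes r: "ball a r \<subseteq> T" "0 < r" and R: "R \<in> polys m" "R' \<in> polys m"
    and "integral\<^sup>L (lebesgue_on T) R = integral\<^sup>L (lebesgue_on T) R'"
    and eq: "\<And>w. w \<in> polys m \<Longrightarrow> (\<integral>x. grad R x \<bullet> grad w x \<partial>lebesgue_on T) = (\<integral>x. grad R' x \<bullet> grad w x \<partial>lebesgue_on T)"
  shows "R = R'"
proof -
  let ?d = "\<lambda>x. R x + (- 1) * R' x"
  have s: "(\<lambda>x. (- 1) * R' x) \<in> polys m" by (rule polys_scale[OF R(2)])
  have d: "?d \<in> polys m" by (rule polys_add[OF R(1) s])
  have g: "grad ?d x = grad R x - grad R' x" for x
    unfolding grad_add[OF R(1) s] grad_scale[OF R(2)] by simp
  have "(\<integral>x. grad ?d x \<bullet> grad ?d x \<partial>lebesgue_on T)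
    = (\<integral>x. grad R x \<bullet> grad ?d x - grad R' x \<bullet> grad ?d x \<partial>lebesgue_on T)"
    by (subst (1) g) (simp add: inner_diff_left)
  also have "\<dots> = 0"
    using integrable_grad_inner[OF compact_T R(1) d] integrable_grad_inner[OF compact_T R(2) d] eq[OF d] by simp
  finally have "?d = (\<lambda>x. 0)"
    using polys_energy_definite[OF compact_T r d] assms(5) integrable_polys[OF compact_T R(1)] integrable_polys[OF compact_T R(2)]
    by simp
  then show ?thesis by (simp add: fun_eq_iff)
qed

end

section \<open>Poincare, trace and energy estimates\<close>

context full_simplex
begin

text \<open>A chord of the inscribed ball parallel to the facet, of length 2 r, is projected
  centrally from u onto the facet. This magnifies by 1 / (1 - \<beta>) \<ge> 1, where \<beta> is the
  u-coordinate of the centre.\<close>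

lemma facet_diameter:
  assumes n: "2 \<le> CARD('n)" and r: "0 < r" "cball x r \<subseteq> T" and u: "u \<in> C"
  shows "2 * r \<le> diameter (facet u)"
proof -
  obtain y0 where y0: "y0 \<in> C" "y0 \<noteq> u" using obtain_vertex .
  have y0f: "y0 \<in> facet u" using vertex_in_facet y0 by blast
  obtain d0 where d0: "d0 \<noteq> 0" "orthogonal (normal u) d0"
    using orthogonal_to_vector_exists[of "normal u"] n by auto
  define d where "d = d0 /\<^sub>R norm d0"
  have d: "norm d = 1" "normal u \<bullet> d = 0" using d0 by (auto simp: d_def orthogonal_def)
  have neg: "normal u \<bullet> (u - y0) < 0" by (rule outer_normal(2)[OF u y0f])
  define \<beta> where "\<beta> = bary x u"
  have b: "bary (x + s *\<^sub>R d) u = \<beta>" for s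
    using normal_bary[OF u y0f, of "x + s *\<^sub>R d"] normal_bary[OF u y0f, of x] neg d(2)
    by (simp add: \<beta>_def inner_add_right inner_diff_right)
  have inT: "x + s *\<^sub>R d \<in> T" if "\<bar>s\<bar> \<le> r" for s
    using r(2) that d(1) by (auto simp: dist_norm subset_iff)
  have "x \<in> T" using r by auto
  then have \<beta>: "0 \<le> \<beta>" "\<beta> \<le> 1"
    using u bary(1)[of x] member_le_sum[OF u _ finite, of "bary x"] by (auto simp: mem_T \<beta>_def)
  \<comment> \<open>Otherwise every point of the chord would have u-coordinate 1 and coincide with
    u.\<close>
  have "\<beta> \<noteq> 1"
  proof
    assume "\<beta> = 1"
    have eq: "y = u" if y: "y \<in> T" "bary y u = 1" for y
    proof -
      have "sum (bary y) (C - {u}) = 0" using bary(1)[of y] y(2) sum.remove[OF finite u, of "bary y"] by simp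
      moreover have "0 \<le> bary y w" if "w \<in> C - {u}" for w using y(1) that by (simp add: mem_T)
      ultimately have "\<forall>w\<in>C - {u}. bary y w = 0"
        using sum_nonneg_eq_0_iff[OF finite_Diff[OF finite, of "{u}"], of "bary y"] by blast
      then have z: "(\<Sum>w\<in>C - {u}. bary y w *\<^sub>R w) = 0" by (intro sum.neutral) simp
      have "y = (\<Sum>w\<in>C. bary y w *\<^sub>R w)" by (simp add: bary)
      also have "\<dots> = bary y u *\<^sub>R u + (\<Sum>w\<in>C - {u}. bary y w *\<^sub>R w)" by (rule sum.remove[OF finite u])
      finally show ?thesis using z y(2) by simp
    qed
    have "x + s *\<^sub>R d = u" if "\<bar>s\<bar> \<le> r" for s
      by (rule eq[OF inT[OF that]]) (simp only: b \<open>\<beta> = 1\<close>)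
    from this[of r] this[of 0] have "x + r *\<^sub>R d = u" "x = u" using r by simp_all
    then show False using r d(1) by auto
  qed
  then have \<beta>1: "\<beta> < 1" using \<beta> by simp
  \<comment> \<open>Dropping the u-coordinate and rescaling the others to sum one is the central
    projection from u.\<close>
  define z where "z s = (\<Sum>w\<in>C - {u}. (bary (x + s *\<^sub>R d) w / (1 - \<beta>)) *\<^sub>R w)" for s
  have zf: "z s \<in> facet u" if "\<bar>s\<bar> \<le> r" for s
    unfolding facet_def convex_hull_finite[OF finite_Diff[OF finite]]
  proof (rule CollectI, rule exI[of _ "\<lambda>w. bary (x + s *\<^sub>R d) w / (1 - \<beta>)"], intro conjI ballI)
    show "0 \<le> bary (x + s *\<^sub>R d) w / (1 - \<beta>)" if "w \<in> C - {u}" for w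
      using inT[OF \<open>\<bar>s\<bar> \<le> r\<close>] that \<beta>1 by (auto simp: mem_T)
    have "sum (bary (x + s *\<^sub>R d)) (C - {u}) = 1 - \<beta>"
      using bary(1)[of "x + s *\<^sub>R d"] sum.remove[OF finite u, of "bary (x + s *\<^sub>R d)"] b[of s] by simp
    then show "(\<Sum>w\<in>C - {u}. bary (x + s *\<^sub>R d) w / (1 - \<beta>)) = 1"
      using \<beta>1 by (simp add: sum_divide_distrib[symmetric])
  qed (simp add: z_def)
  have zs: "(1 - \<beta>) *\<^sub>R z s = x + s *\<^sub>R d - \<beta> *\<^sub>R u" for s
  proof -
    have "x + s *\<^sub>R d = (\<Sum>w\<in>C. bary (x + s *\<^sub>R d) w *\<^sub>R w)" by (simp add: bary)
    also have "\<dots> = \<beta> *\<^sub>R u + (\<Sum>w\<in>C - {u}. bary (x + s *\<^sub>R d) w *\<^sub>R w)"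
      using sum.remove[OF finite u, of "\<lambda>w. bary (x + s *\<^sub>R d) w *\<^sub>R w"] b[of s] by simp
    also have "(\<Sum>w\<in>C - {u}. bary (x + s *\<^sub>R d) w *\<^sub>R w) = (1 - \<beta>) *\<^sub>R z s"
      using \<beta>1 by (simp add: z_def scaleR_sum_right)
    finally show ?thesis by simp
  qed
  have "(1 - \<beta>) *\<^sub>R (z r - z (- r)) = (2 * r) *\<^sub>R d"
    by (simp add: scaleR_diff_right zs scaleR_2 flip: scaleR_scaleR)
  then have "norm ((1 - \<beta>) *\<^sub>R (z r - z (- r))) = norm ((2 * r) *\<^sub>R d)" by simp
  then have "(1 - \<beta>) * norm (z r - z (- r)) = 2 * r" using r \<beta>1 d(1) by simp
  then have "2 * r \<le> norm (z r - z (- r))" using \<beta> \<beta>1 mult_right_mono[of "1 - \<beta>" 1 "norm (z r - z (- r))"] by simp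
  also have "\<dots> \<le> diameter (facet u)"
    using diameter_bounded_bound[OF compact_imp_bounded[OF compact_facet] zf[of r] zf[of "- r"]] r by (simp add: dist_norm)
  finally show ?thesis .
qed

lemma facet_diameter_le: "diameter (facet u) \<le> diameter T"
  by (rule diameter_subset[OF facet_subset compact_imp_bounded[OF compact_T]])

text \<open>The ball estimate, applied to the partial derivatives of e, gives a Lipschitz constant S
  on the convex set T. The oscillation of e is then at most S times the diameter, and mean zero
  turns this into a bound of |e|. On integration the volume of T is bounded by that of the larger
  ball, and all powers of r cancel except r^2.\<close>

lemma poincare:
  assumes r: "0 < r" "cball x r \<subseteq> T" and M: "T \<subseteq> cball x (M * r)" "diameter T \<le> M * r" "0 < M"
    and e: "e \<in> polys k" and mean: "integral\<^sup>L (lebesgue_on T) e = 0" and Cp: "0 < Cp"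
    and bound: "\<And>p y. p \<in> polys k \<Longrightarrow> y \<in> cball x (M * r) \<Longrightarrow>
      (p y)\<^sup>2 \<le> Cp / r ^ CARD('n) * (\<integral>x. (p x)\<^sup>2 \<partial>lebesgue_on T)"
  shows "(\<integral>x. (e x)\<^sup>2 \<partial>lebesgue_on T)
    \<le> unit_ball_vol CARD('n) * M ^ CARD('n) * Cp * M\<^sup>2 * r\<^sup>2 * (\<integral>x. grad e x \<bullet> grad e x \<partial>lebesgue_on T)"
proof -
  define G where "G = (\<integral>x. grad e x \<bullet> grad e x \<partial>lebesgue_on T)"
  have ge: "(\<lambda>x. grad e x $ i) \<in> polys k" for i by (rule polys_grad'[OF e])
  have Gsum: "G = (\<Sum>i\<in>UNIV. \<integral>x. (grad e x $ i)\<^sup>2 \<partial>lebesgue_on T)"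
    unfolding G_def inner_vec_def inner_real_def power2_eq_square
    by (rule Bochner_Integration.integral_sum) (rule integrable_polys_mult[OF compact_T ge ge])
  have G0: "0 \<le> G" unfolding G_def by simp
  define S where "S = sqrt (Cp / r ^ CARD('n) * G)"
  have S0: "0 \<le> S" and S2: "S\<^sup>2 = Cp / r ^ CARD('n) * G" using Cp r G0 by (simp_all add: S_def)
  have gS: "norm (grad e y) \<le> S" if "y \<in> T" for y
  proof -
    have "(norm (grad e y))\<^sup>2 = (\<Sum>i\<in>UNIV. (grad e y $ i)\<^sup>2)"
      unfolding power2_norm_eq_inner by (simp add: inner_vec_def power2_eq_square)
    also have "\<dots> \<le> (\<Sum>i\<in>UNIV. Cp / r ^ CARD('n) * (\<integral>x. (grad e x $ i)\<^sup>2 \<partial>lebesgue_on T))"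
      using that M(1) by (intro sum_mono bound ge) auto
    also have "\<dots> = S\<^sup>2" by (simp add: S2 Gsum sum_distrib_left)
    finally show ?thesis by (rule power2_le_imp_le) (rule S0)
  qed
  define D where "D = S * (M * r)"
  have diff: "e y - e z \<le> D" if y: "y \<in> T" and z: "z \<in> T" for y z
  proof -
    have "norm (e y - e z) \<le> S * norm (y - z)"
    proof (rule differentiable_bound[OF convex_T _ _ y z])
      fix w assume w: "w \<in> T"
      show "(e has_derivative (\<lambda>h. h \<bullet> grad e w)) (at w within T)"
        using polys_GDERIV_grad[OF e, of w] unfolding gderiv_def by (rule has_derivative_at_withinI)
      show "onorm (\<lambda>h. h \<bullet> grad e w) \<le> S"
      proof (rule onorm_bound[OF S0])
        fix h
        have "norm (h \<bullet> grad e w) \<le> norm h * norm (grad e w)" by (simp add: Cauchy_Schwarz_ineq2)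
        also have "\<dots> \<le> norm h * S" by (intro mult_left_mono gS w) simp
        finally show "norm (h \<bullet> grad e w) \<le> S * norm h" by (simp add: mult.commute)
      qed
    qed
    also have "\<dots> \<le> D"
      unfolding D_def using diameter_bounded_bound[OF compact_imp_bounded[OF compact_T] y z] M(2) S0
      by (intro mult_left_mono) (auto simp: dist_norm)
    finally show ?thesis by simp
  qed
  define V where "V = measure lebesgue T"
  have Tl: "T \<in> lmeasurable" by (rule lmeasurable_compact[OF compact_T])
  have one: "(\<integral>x. c \<partial>lebesgue_on T) = V * c" for c :: real
    using Tl by (simp add: V_def measure_restrict_space fmeasurableD)
  have ball: "measure lebesgue (cball x r) \<le> V"
    unfolding V_def using Tl r by (intro measure_mono_fmeasurable) auto
  have "0 < measure lebesgue (cball x r)"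
    using r content_cball[of r x] by simp
  then have V: "0 < V" by (rule order_less_le_trans[OF _ ball])
  have ei: "integrable (lebesgue_on T) e" by (rule integrable_polys[OF compact_T e])
  have ci: "integrable (lebesgue_on T) (\<lambda>z. c)" for c :: real by (rule integrable_polys[OF compact_T polys_const])
  \<comment> \<open>Averaging e y - e z over z leaves e y, since e has mean zero.\<close>
  have up: "e y \<le> D" "- e y \<le> D" if y: "y \<in> T" for y
  proof -
    have sp: "space (lebesgue_on T) = T" by simp
    have "V * e y = (\<integral>z. e y - e z \<partial>lebesgue_on T)"
      unfolding Bochner_Integration.integral_diff[OF ci ei] one mean by simp
    also have "\<dots> \<le> (\<integral>z. D \<partial>lebesgue_on T)"
      using ei ci diff[OF y] by (intro integral_mono) auto
    finally show "e y \<le> D" using V by (simp only: one mult_le_cancel_left_pos)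
    have "V * (- e y) = (\<integral>z. e z - e y \<partial>lebesgue_on T)"
      unfolding Bochner_Integration.integral_diff[OF ei ci] one mean by simp
    also have "\<dots> \<le> (\<integral>z. D \<partial>lebesgue_on T)"
      using ei ci diff[OF _ y] by (intro integral_mono) auto
    finally show "- e y \<le> D" using V by (simp only: one mult_le_cancel_left_pos)
  qed
  have e2: "(e y)\<^sup>2 \<le> D\<^sup>2" if "y \<in> T" for y
    using up[OF that] by (intro abs_le_square_iff[THEN iffD1]) auto
  have "(\<integral>x. (e x)\<^sup>2 \<partial>lebesgue_on T) \<le> (\<integral>x. D\<^sup>2 \<partial>lebesgue_on T)"
    using ci e2 integrable_polys_mult[OF compact_T e e] by (intro integral_mono) (auto simp: power2_eq_square)
  also have "\<dots> = V * D\<^sup>2" by (rule one)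
  also have "\<dots> \<le> (unit_ball_vol CARD('n) * (M * r) ^ CARD('n)) * D\<^sup>2"
  proof (rule mult_right_mono)
    have "V \<le> measure lebesgue (cball x (M * r))"
      unfolding V_def using Tl M by (intro measure_mono_fmeasurable) (auto simp: fmeasurableD)
    also have "\<dots> = unit_ball_vol CARD('n) * (M * r) ^ CARD('n)"
      using r M content_cball[of "M * r" x] by simp
    finally show "V \<le> unit_ball_vol CARD('n) * (M * r) ^ CARD('n)" .
  qed simp
  also have "D\<^sup>2 = (M * r)\<^sup>2 * (Cp / r ^ CARD('n) * G)" by (simp add: D_def power_mult_distrib S2 mult_ac)
  also have "unit_ball_vol CARD('n) * (M * r) ^ CARD('n) * ((M * r)\<^sup>2 * (Cp / r ^ CARD('n) * G))
    = unit_ball_vol CARD('n) * M ^ CARD('n) * Cp * M\<^sup>2 * r\<^sup>2 * G"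
    using r by (simp add: power_mult_distrib field_simps)
  finally show ?thesis unfolding G_def .
qed

text \<open>The pointwise bound of order r^(-n) on the larger ball is multiplied by an area bound of
  order r^(n-1); the factor 1 / r remains.\<close>

lemma discrete_trace:
  assumes r: "0 < r" and M: "T \<subseteq> cball x (M * r)" "0 < M" and Cp: "0 < Cp" and u: "u \<in> C" and q: "q \<in> polys k"
    and bound: "\<And>p y. p \<in> polys k \<Longrightarrow> y \<in> cball x (M * r) \<Longrightarrow>
      (p y)\<^sup>2 \<le> Cp / r ^ CARD('n) * (\<integral>x. (p x)\<^sup>2 \<partial>lebesgue_on T)"
  shows "(\<integral>x. (q x)\<^sup>2 \<partial>\<sigma> u)
    \<le> Cp * (unit_ball_vol CARD('n) * (M + 1) ^ CARD('n)) / r * (\<integral>x. (q x)\<^sup>2 \<partial>lebesgue_on T)"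
proof -
  interpret P: flat_piece "facet u" "normal u" by (rule outer_normal(1)[OF u])
  define c where "c = Cp / r ^ CARD('n) * (\<integral>x. (q x)\<^sup>2 \<partial>lebesgue_on T)"
  have sub: "facet u \<subseteq> cball x (M * r)" using facet_subset M by blast
  have "(\<integral>x. (q x)\<^sup>2 \<partial>\<sigma> u) \<le> c * (unit_ball_vol CARD('n) * (M + 1) ^ CARD('n)) * r ^ CARD('n) / r"
  proof (rule P.surface_integral_bound[OF r _ sub])
    show "continuous_on (facet u) (\<lambda>x. (q x)\<^sup>2)" by (intro continuous_intros continuous_on_polys[OF q])
    show "(q y)\<^sup>2 \<le> c" if "y \<in> facet u" for y unfolding c_def using that sub by (intro bound q) auto
    show "0 \<le> c" unfolding c_def using Cp r by simp
  qed (use M in simp)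
  also have "\<dots> = Cp * (unit_ball_vol CARD('n) * (M + 1) ^ CARD('n)) / r * (\<integral>x. (q x)\<^sup>2 \<partial>lebesgue_on T)"
    using r by (simp add: c_def field_simps)
  finally show ?thesis .
qed

text \<open>The flux \<open>\<integral> s (grad e \<bullet> \<nu>)\<close> is absorbed by Young's inequality, with a weight chosen so that
  the discrete trace inequality returns half of the energy of \<open>e\<close>.\<close>

lemma energy_bound:
  fixes C1 r :: real
  assumes r: "0 < r" and C1: "0 < C1" and e: "e \<in> polys k"
    and s: "\<And>u. u \<in> C \<Longrightarrow> s u \<in> polys k"
    and trace: "\<And>u q. u \<in> C \<Longrightarrow> q \<in> polys k \<Longrightarrow>
      (\<integral>x. (q x)\<^sup>2 \<partial>\<sigma> u) \<le> C1 / r * (\<integral>x. (q x)\<^sup>2 \<partial>lebesgue_on T)"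
    and energy: "(\<integral>x. grad e x \<bullet> grad e x \<partial>lebesgue_on T)
      = (\<Sum>u\<in>C. \<integral>x. s u x * (grad e x \<bullet> normal u) \<partial>\<sigma> u)"
  shows "(\<integral>x. grad e x \<bullet> grad e x \<partial>lebesgue_on T)
    \<le> real (CARD('n) + 1) * C1 / r * (\<Sum>u\<in>C. \<integral>x. (s u x)\<^sup>2 \<partial>\<sigma> u)"
proof -
  define G where "G = (\<integral>x. grad e x \<bullet> grad e x \<partial>lebesgue_on T)"
  define N where "N = real (CARD('n) + 1)"
  define \<epsilon> where "\<epsilon> = r / (N * C1)"
  have N: "0 < N" and cN: "real (card C) = N" using card by (simp_all add: N_def)
  have \<epsilon>: "0 < \<epsilon>" using r C1 N by (simp add: \<epsilon>_def)
  have flux: "(\<integral>x. s u x * (grad e x \<bullet> normal u) \<partial>\<sigma> u)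
    \<le> 1 / (2 * \<epsilon>) * (\<integral>x. (s u x)\<^sup>2 \<partial>\<sigma> u) + \<epsilon> / 2 * (C1 / r * G)" if u: "u \<in> C" for u
  proof -
    interpret P: flat_piece "facet u" "normal u" by (rule outer_normal(1)[OF u])
    let ?q = "\<lambda>x. grad e x \<bullet> normal u"
    have q: "?q \<in> polys k" by (rule polys_grad_inner[OF polys_mono[OF e]]) simp
    have i: "integrable (\<sigma> u) (\<lambda>x. (p x)\<^sup>2)" if "p \<in> polys k" for p
      using P.integrable_surface_polys_mult[OF that that] by (simp add: power2_eq_square)
    have "(\<integral>x. s u x * ?q x \<partial>\<sigma> u)
      \<le> (\<integral>x. 1 / (2 * \<epsilon>) * (s u x)\<^sup>2 + \<epsilon> / 2 * (?q x)\<^sup>2 \<partial>\<sigma> u)"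
    proof (rule integral_mono)
      show "integrable (\<sigma> u) (\<lambda>x. s u x * ?q x)"
        by (rule P.integrable_surface_polys_mult[OF s[OF u] q])
      show "integrable (\<sigma> u) (\<lambda>x. 1 / (2 * \<epsilon>) * (s u x)\<^sup>2 + \<epsilon> / 2 * (?q x)\<^sup>2)"
        using i[OF s[OF u]] i[OF q] by (intro Bochner_Integration.integrable_add integrable_mult_right) auto
      fix x
      have "0 \<le> (s u x - \<epsilon> * ?q x)\<^sup>2" by simp
      then have "2 * \<epsilon> * (s u x * ?q x) \<le> (s u x)\<^sup>2 + \<epsilon>\<^sup>2 * (?q x)\<^sup>2"
        by (simp add: power2_diff power_mult_distrib mult_ac)
      then have "(2 * \<epsilon> * (s u x * ?q x)) / (2 * \<epsilon>) \<le> ((s u x)\<^sup>2 + \<epsilon>\<^sup>2 * (?q x)\<^sup>2) / (2 * \<epsilon>)"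
        using \<epsilon> by (intro divide_right_mono) auto
      also have "\<dots> = 1 / (2 * \<epsilon>) * (s u x)\<^sup>2 + \<epsilon> / 2 * (?q x)\<^sup>2"
        using \<epsilon> by (simp add: field_simps power2_eq_square)
      finally show "s u x * ?q x \<le> 1 / (2 * \<epsilon>) * (s u x)\<^sup>2 + \<epsilon> / 2 * (?q x)\<^sup>2"
        using \<epsilon> by simp
    qed
    also have "\<dots> = 1 / (2 * \<epsilon>) * (\<integral>x. (s u x)\<^sup>2 \<partial>\<sigma> u)
        + \<epsilon> / 2 * (\<integral>x. (?q x)\<^sup>2 \<partial>\<sigma> u)"
      using i[OF s[OF u]] i[OF q] by (subst Bochner_Integration.integral_add) auto
    finally have flux1: "(\<integral>x. s u x * ?q x \<partial>\<sigma> u)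
      \<le> 1 / (2 * \<epsilon>) * (\<integral>x. (s u x)\<^sup>2 \<partial>\<sigma> u)
        + \<epsilon> / 2 * (\<integral>x. (?q x)\<^sup>2 \<partial>\<sigma> u)" .
    have tr: "(\<integral>x. (?q x)\<^sup>2 \<partial>\<sigma> u) \<le> C1 / r * (\<integral>x. (?q x)\<^sup>2 \<partial>lebesgue_on T)"
      by (rule trace[OF u q])
    have qG: "(\<integral>x. (?q x)\<^sup>2 \<partial>lebesgue_on T) \<le> G"
      unfolding G_def
    proof (rule integral_mono)
      show "integrable (lebesgue_on T) (\<lambda>x. (?q x)\<^sup>2)"
        using integrable_polys_mult[OF compact_T q q] by (simp add: power2_eq_square)
      show "integrable (lebesgue_on T) (\<lambda>x. grad e x \<bullet> grad e x)" by (rule integrable_grad_inner[OF compact_T e e])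
      fix x show "(?q x)\<^sup>2 \<le> grad e x \<bullet> grad e x"
        using Cauchy_Schwarz_ineq[of "grad e x" "normal u"] P.normal_self by simp
    qed
    from mult_left_mono[OF qG, of "C1 / r"] have "C1 / r * (\<integral>x. (?q x)\<^sup>2 \<partial>lebesgue_on T) \<le> C1 / r * G"
      using C1 r by simp
    with tr have "(\<integral>x. (?q x)\<^sup>2 \<partial>\<sigma> u) \<le> C1 / r * G" by linarith
    from mult_left_mono[OF this, of "\<epsilon> / 2"] flux1 show ?thesis using \<epsilon> by linarith
  qed
  have "G \<le> (\<Sum>u\<in>C. 1 / (2 * \<epsilon>) * (\<integral>x. (s u x)\<^sup>2 \<partial>\<sigma> u) + \<epsilon> / 2 * (C1 / r * G))"
    unfolding G_def energy by (intro sum_mono order.trans[OF flux]) (simp_all add: G_def energy)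
  also have "\<dots> = 1 / (2 * \<epsilon>) * (\<Sum>u\<in>C. \<integral>x. (s u x)\<^sup>2 \<partial>\<sigma> u) + N * (\<epsilon> / 2 * (C1 / r * G))"
    by (simp add: sum.distrib sum_distrib_left cN)
  also have "N * (\<epsilon> / 2 * (C1 / r * G)) = G / 2" using r C1 N by (simp add: \<epsilon>_def field_simps)
  finally have "G \<le> 2 * (1 / (2 * \<epsilon>) * (\<Sum>u\<in>C. \<integral>x. (s u x)\<^sup>2 \<partial>\<sigma> u))" by simp
  also have "\<dots> = N * C1 / r * (\<Sum>u\<in>C. \<integral>x. (s u x)\<^sup>2 \<partial>\<sigma> u)"
    using r C1 N by (simp add: \<epsilon>_def)
  finally show ?thesis by (simp add: G_def N_def)
qed

end

section \<open>Equivalence on one element\<close>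

text \<open>E, \<open>S i\<close> and \<open>G i\<close> stand for the squared norms of e, S_TF and
  g, and \<open>d i\<close> for the facet diameters. In K, the factor 2 comes from the triangle
  inequality, N counts the facets, C1 is the trace constant, and M^2 pays for replacing r by
  h.\<close>

lemma stabilization_arithmetic:
  fixes S G d :: "'i \<Rightarrow> real" and E h r M C1 C2 :: real
  assumes fin: "finite I" and r: "0 < r" and h: "2 * r \<le> h" "h \<le> M * r" and pos: "0 < M" "0 < C1" "0 < C2"
    and d: "\<And>i. i \<in> I \<Longrightarrow> 2 * r \<le> d i" "\<And>i. i \<in> I \<Longrightarrow> d i \<le> h"
    and E: "0 \<le> E" and S: "\<And>i. i \<in> I \<Longrightarrow> 0 \<le> S i" and G: "\<And>i. i \<in> I \<Longrightarrow> 0 \<le> G i"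
    and SG: "\<And>i. i \<in> I \<Longrightarrow> S i \<le> 2 * G i + 2 * (C1 / r * E)"
    and GS: "\<And>i. i \<in> I \<Longrightarrow> G i \<le> 2 * S i + 2 * (C1 / r * E)"
    and ES: "E \<le> C2 * r\<^sup>2 * (N * C1 / r * (\<Sum>i\<in>I. S i))" and N: "real (card I) = N"
  defines "K \<equiv> 2 * N * C1 * M\<^sup>2"
  shows "E / h\<^sup>2 + (\<Sum>i\<in>I. G i / d i) \<le> (2 + (1 + K) * (C2 * N * C1 * M)) * (\<Sum>i\<in>I. S i / d i)"
    and "(\<Sum>i\<in>I. S i / d i) \<le> (2 + K) * (E / h\<^sup>2 + (\<Sum>i\<in>I. G i / d i))"
proof -
  have N0: "0 \<le> N" using N by linarith
  have h0: "0 < h" using r h by linarith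
  have d0: "0 < d i" if "i \<in> I" for i using d(1)[OF that] r by linarith
  have "h\<^sup>2 \<le> (M * r)\<^sup>2" using h h0 by (intro power_mono) auto
  then have hr: "E / r\<^sup>2 \<le> M\<^sup>2 * (E / h\<^sup>2)"
    using E r h0 by (simp add: field_simps power_mult_distrib mult_left_mono)
  have tr: "(C1 / r * E) / d i \<le> C1 * M\<^sup>2 * (E / h\<^sup>2)" if i: "i \<in> I" for i
  proof -
    have "(C1 / r * E) / d i \<le> (C1 / r * E) / r"
      using d(1)[OF i] r pos E by (intro divide_left_mono) auto
    also have "\<dots> = C1 * (E / r\<^sup>2)" by (simp add: power2_eq_square)
    also have "\<dots> \<le> C1 * (M\<^sup>2 * (E / h\<^sup>2))" using hr pos by (intro mult_left_mono) auto
    finally show ?thesis by (simp add: mult.assoc)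
  qed
  have sum_bound: "(\<Sum>i\<in>I. X i / d i) \<le> 2 * (\<Sum>i\<in>I. Y i / d i) + K * (E / h\<^sup>2)"
    if XY: "\<And>i. i \<in> I \<Longrightarrow> X i \<le> 2 * Y i + 2 * (C1 / r * E)" for X Y :: "'i \<Rightarrow> real"
  proof -
    have "(\<Sum>i\<in>I. X i / d i) \<le> (\<Sum>i\<in>I. 2 * (Y i / d i) + 2 * (C1 * M\<^sup>2 * (E / h\<^sup>2)))"
    proof (rule sum_mono)
      fix i assume i: "i \<in> I"
      have "X i / d i \<le> (2 * Y i + 2 * (C1 / r * E)) / d i"
        using XY[OF i] d0[OF i] by (intro divide_right_mono) auto
      also have "\<dots> = 2 * (Y i / d i) + 2 * ((C1 / r * E) / d i)" by (simp add: add_divide_distrib)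
      also have "\<dots> \<le> 2 * (Y i / d i) + 2 * (C1 * M\<^sup>2 * (E / h\<^sup>2))" using tr[OF i] by simp
      finally show "X i / d i \<le> 2 * (Y i / d i) + 2 * (C1 * M\<^sup>2 * (E / h\<^sup>2))" .
    qed
    also have "\<dots> = 2 * (\<Sum>i\<in>I. Y i / d i) + K * (E / h\<^sup>2)"
      using N by (simp add: sum.distrib sum_distrib_left K_def mult_ac)
    finally show ?thesis .
  qed
  have K0: "0 \<le> K" using N0 pos by (simp add: K_def)
  have Eh0: "0 \<le> E / h\<^sup>2" using E by simp
  have SS0: "0 \<le> (\<Sum>i\<in>I. S i / d i)" and GG0: "0 \<le> (\<Sum>i\<in>I. G i / d i)"
    using S G d0 by (auto intro!: sum_nonneg divide_nonneg_pos)
  \<comment> \<open>Here the upper bounds d i \<le> h \<le> M r turn 1 / r into M / d i, whereas the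
    trace terms use the lower bound on d i.\<close>
  have Eh: "E / h\<^sup>2 \<le> C2 * N * C1 * M * (\<Sum>i\<in>I. S i / d i)"
  proof -
    have "r\<^sup>2 \<le> h\<^sup>2" using h r by (intro power_mono) auto
    then have "E / h\<^sup>2 \<le> E / r\<^sup>2" using E r h0 by (intro divide_left_mono) auto
    also have "\<dots> \<le> (C2 * r\<^sup>2 * (N * C1 / r * (\<Sum>i\<in>I. S i))) / r\<^sup>2" using ES by (intro divide_right_mono) auto
    also have "\<dots> = C2 * N * C1 * (\<Sum>i\<in>I. S i / r)" using r by (simp add: sum_divide_distrib[symmetric])
    also have "\<dots> \<le> C2 * N * C1 * (\<Sum>i\<in>I. M * (S i / d i))"
    proof (intro mult_left_mono sum_mono)
      fix i assume i: "i \<in> I"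
      have "d i \<le> M * r" using d(2)[OF i] h by linarith
      then have "S i * d i \<le> S i * (M * r)" using S[OF i] by (rule mult_left_mono)
      then show "S i / r \<le> M * (S i / d i)" using r d0[OF i] by (simp add: field_simps)
    qed (use pos N0 in simp)
    also have "\<dots> = C2 * N * C1 * M * (\<Sum>i\<in>I. S i / d i)" by (simp add: sum_distrib_left mult.assoc)
    finally show ?thesis .
  qed
  have GS': "(\<Sum>i\<in>I. G i / d i) \<le> 2 * (\<Sum>i\<in>I. S i / d i) + K * (E / h\<^sup>2)"
    by (rule sum_bound) (rule GS)
  have "E / h\<^sup>2 + (\<Sum>i\<in>I. G i / d i) \<le> 2 * (\<Sum>i\<in>I. S i / d i) + (1 + K) * (E / h\<^sup>2)"
    using GS' unfolding distrib_right mult_1_left by linarith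
  also have "\<dots> \<le> 2 * (\<Sum>i\<in>I. S i / d i) + (1 + K) * (C2 * N * C1 * M * (\<Sum>i\<in>I. S i / d i))"
    using mult_left_mono[OF Eh, of "1 + K"] K0 by simp
  finally show "E / h\<^sup>2 + (\<Sum>i\<in>I. G i / d i) \<le> (2 + (1 + K) * (C2 * N * C1 * M)) * (\<Sum>i\<in>I. S i / d i)"
    by (simp add: distrib_right mult.assoc)
  have "(\<Sum>i\<in>I. S i / d i) \<le> 2 * (\<Sum>i\<in>I. G i / d i) + K * (E / h\<^sup>2)"
    by (rule sum_bound) (rule SG)
  also have "\<dots> \<le> (2 + K) * (E / h\<^sup>2 + (\<Sum>i\<in>I. G i / d i))"
    using mult_nonneg_nonneg[OF K0 GG0] Eh0 unfolding distrib_left distrib_right by linarith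
  finally show "(\<Sum>i\<in>I. S i / d i) \<le> (2 + K) * (E / h\<^sup>2 + (\<Sum>i\<in>I. G i / d i))" .
qed

lemma L2_norm_squared: "(L2_norm M f)\<^sup>2 = (\<integral>x. (f x)\<^sup>2 \<partial>M)"
  unfolding L2_norm_def by simp

context full_simplex
begin

text \<open>R enters only through its degree, its mean and its local equation. The constants are
  explicit in n, M and \<open>Cp\<close>, so nothing of the individual simplex remains in
  them.\<close>

lemma element_equivalence:
  fixes r M Cp :: real
  assumes n: "2 \<le> CARD('n)" and r: "0 < r" "cball x r \<subseteq> T" and M: "diameter T \<le> M * r" "0 < M" and Cp: "0 < Cp"
    and bound: "\<And>p y. p \<in> polys k \<Longrightarrow> y \<in> cball x (M * r) \<Longrightarrow>
      (p y)\<^sup>2 \<le> Cp / r ^ CARD('n) * (\<integral>x. (p x)\<^sup>2 \<partial>lebesgue_on T)"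
    and v: "v \<in> polys k" and f: "\<And>u. u \<in> C \<Longrightarrow> f (facet u) \<in> facet_polys k (facet u)"
    and R: "R \<in> polys (k + 1)" and mean: "integral\<^sup>L (lebesgue_on T) R = integral\<^sup>L (lebesgue_on T) v"
    and eq: "\<And>w. w \<in> polys (k + 1) \<Longrightarrow> (\<integral>x. grad R x \<bullet> grad w x \<partial>lebesgue_on T)
      = (\<integral>x. grad v x \<bullet> grad w x \<partial>lebesgue_on T) - boundary_term v f w"
  defines "A \<equiv> (L2_norm (lebesgue_on T) (elem_proj k T (\<lambda>x. v x - R x)))\<^sup>2 / (diameter T)\<^sup>2 +
         (\<Sum>F\<in>facets T. (L2_norm (surface_measure F) (facet_proj k F (\<lambda>x. f F x - R x)))\<^sup>2 / diameter F)"
    and "Q \<equiv> (\<Sum>F\<in>facets T. (L2_norm (surface_measure F)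
           (\<lambda>x. facet_proj k F (\<lambda>y. v y + (R y - elem_proj k T R y)) x - f F x))\<^sup>2 / diameter F)"
    and "C1 \<equiv> Cp * (unit_ball_vol CARD('n) * (M + 1) ^ CARD('n))"
    and "C2 \<equiv> unit_ball_vol CARD('n) * M ^ CARD('n) * Cp * M\<^sup>2"
    and "N \<equiv> real (CARD('n) + 1)"
  shows "A \<le> (2 + (1 + 2 * N * C1 * M\<^sup>2) * (C2 * N * C1 * M)) * Q"
    and "Q \<le> (2 + 2 * N * C1 * M\<^sup>2) * A"
proof -
  have ball: "ball x r \<subseteq> T" using r(2) ball_subset_cball by blast
  note proj = elem_proj[OF compact_T ball r(1) R, where k = k]
  define z where "z = (\<lambda>x. R x - elem_proj k T R x)"
  define e where "e = (\<lambda>x. v x - elem_proj k T R x)"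
  have e: "e \<in> polys k" unfolding e_def by (rule polys_diff[OF v proj(1)])
  have v1: "v \<in> polys (k + 1)" and pr1: "elem_proj k T R \<in> polys (k + 1)" and e1: "e \<in> polys (k + 1)"
    using polys_mono[OF v] polys_mono[OF proj(1)] polys_mono[OF e] by auto
  have z: "z \<in> polys (k + 1)" unfolding z_def by (rule polys_diff[OF R pr1])
  have zorth: "(\<integral>x. z x * q x \<partial>lebesgue_on T) = 0" if "q \<in> polys k" for q
    unfolding z_def by (rule proj(2)[OF that])
  \<comment> \<open>The projection leaves v unchanged, and R differs from its projection by z, which
    is orthogonal to \<open>polys k\<close>.\<close>
  have eproj: "elem_proj k T (\<lambda>x. v x - R x) = e"
  proof (rule elem_proj_eqI[OF compact_T ball r(1) polys_diff[OF v1 R] e])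
    fix q :: "real^'n::_ \<Rightarrow> real" assume "q \<in> polys k"
    have "(\<integral>x. (v x - R x - e x) * q x \<partial>lebesgue_on T) = (\<integral>x. - (z x * q x) \<partial>lebesgue_on T)"
      by (simp add: e_def z_def algebra_simps)
    then show "(\<integral>x. (v x - R x - e x) * q x \<partial>lebesgue_on T) = 0" using zorth[OF \<open>q \<in> polys k\<close>] by simp
  qed
  have emean: "integral\<^sup>L (lebesgue_on T) e = 0"
  proof -
    have "(\<integral>x. z x * 1 \<partial>lebesgue_on T) = 0" by (rule zorth[OF polys_const])
    then have "integral\<^sup>L (lebesgue_on T) (elem_proj k T R) = integral\<^sup>L (lebesgue_on T) R"
      using integrable_polys[OF compact_T R] integrable_polys[OF compact_T proj(1)] by (simp add: z_def)
    then show ?thesis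
      using integrable_polys[OF compact_T v] integrable_polys[OF compact_T proj(1)] mean by (simp add: e_def)
  qed
  \<comment> \<open>On the facet, \<phi> represents f and g represents the projection of f - R.
    Bundling their properties permits one simultaneous choice for all u.\<close>
  define P where "P u \<phi> g \<longleftrightarrow> \<phi> \<in> polys k \<and> f (facet u) = restrict \<phi> (facet u) \<and> g \<in> polys k
      \<and> facet_proj k (facet u) (\<lambda>x. f (facet u) x - R x) = restrict g (facet u)
      \<and> (\<forall>q\<in>polys k. (\<integral>x. (\<phi> x - R x - g x) * q x \<partial>\<sigma> u) = 0)" for u \<phi> g
  have "\<exists>\<phi> g. P u \<phi> g" if u: "u \<in> C" for u
  proof -
    interpret P: flat_piece "facet u" "normal u" by (rule outer_normal(1)[OF u])
    obtain \<phi> where \<phi>: "\<phi> \<in> polys k" "f (facet u) = restrict \<phi> (facet u)"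
      using f[OF u] by (auto simp: facet_polys_def)
    have \<phi>R: "(\<lambda>x. \<phi> x - R x) \<in> polys (k + 1)" by (rule polys_diff[OF polys_mono[OF \<phi>(1)] R]) simp
    have fR: "f (facet u) x - R x = \<phi> x - R x" if "x \<in> facet u" for x using that by (simp add: \<phi>(2))
    obtain g where "g \<in> polys k" "facet_proj k (facet u) (\<lambda>x. f (facet u) x - R x) = restrict g (facet u)"
      "\<And>q. q \<in> polys k \<Longrightarrow> (\<integral>x. (\<phi> x - R x - g x) * q x \<partial>\<sigma> u) = 0"
      by (rule P.facet_proj[OF convex_facet \<phi>R fR, where k = k]) (assumption | rule that | blast)+
    with \<phi> have "P u \<phi> g" by (simp add: P_def)
    then show ?thesis by blast
  qed
  then obtain \<phi> g where P: "\<And>u. u \<in> C \<Longrightarrow> P u (\<phi> u) (g u)" by metis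
  then have \<phi>: "\<And>u. u \<in> C \<Longrightarrow> \<phi> u \<in> polys k" "\<And>u. u \<in> C \<Longrightarrow> f (facet u) = restrict (\<phi> u) (facet u)"
    and g: "\<And>u. u \<in> C \<Longrightarrow> g u \<in> polys k"
      "\<And>u. u \<in> C \<Longrightarrow> facet_proj k (facet u) (\<lambda>x. f (facet u) x - R x) = restrict (g u) (facet u)"
    and gorth: "\<And>u q. u \<in> C \<Longrightarrow> q \<in> polys k \<Longrightarrow> (\<integral>x. (\<phi> u x - R x - g u x) * q x \<partial>\<sigma> u) = 0"
    unfolding P_def by blast+
  define s where "s u = (\<lambda>x. e x - g u x)" for u
  have s: "s u \<in> polys k" if "u \<in> C" for u unfolding s_def by (rule polys_diff[OF e g(1)[OF that]])
  have S_eq: "(L2_norm (\<sigma> u)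
      (\<lambda>x. facet_proj k (facet u) (\<lambda>y. v y + (R y - elem_proj k T R y)) x - f (facet u) x))\<^sup>2
    = (\<integral>x. (s u x)\<^sup>2 \<partial>\<sigma> u)" if u: "u \<in> C" for u
  proof -
    interpret P: flat_piece "facet u" "normal u" by (rule outer_normal(1)[OF u])
    let ?p = "\<lambda>x. s u x + \<phi> u x"
    \<comment> \<open>The projected function minus s + \<phi> is the negative of \<phi> - R - g,
      which is orthogonal to \<open>polys k\<close> on the facet.\<close>
    have "facet_proj k (facet u) (\<lambda>y. v y + (R y - elem_proj k T R y)) = restrict ?p (facet u)"
    proof (rule P.facet_proj_eqI[OF convex_facet _ polys_add[OF s[OF u] \<phi>(1)[OF u]] refl])
      show "(\<lambda>y. v y + (R y - elem_proj k T R y)) \<in> polys (k + 1)"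
        by (rule polys_add[OF v1 polys_diff[OF R pr1]])
      fix q :: "real^'n::_ \<Rightarrow> real" assume q: "q \<in> polys k"
      have "(\<integral>x. (v x + (R x - elem_proj k T R x) - ?p x) * q x \<partial>\<sigma> u)
        = (\<integral>x. - ((\<phi> u x - R x - g u x) * q x) \<partial>\<sigma> u)"
        by (simp add: s_def e_def algebra_simps)
      then show "(\<integral>x. (v x + (R x - elem_proj k T R x) - ?p x) * q x \<partial>\<sigma> u) = 0"
        using gorth[OF u q] by simp
    qed
    then show ?thesis unfolding L2_norm_squared
      by (intro P.surface_integral_cong) (simp add: \<phi>(2)[OF u])
  qed
  have G_eq: "(L2_norm (\<sigma> u) (facet_proj k (facet u) (\<lambda>x. f (facet u) x - R x)))\<^sup>2
    = (\<integral>x. (g u x)\<^sup>2 \<partial>\<sigma> u)" if u: "u \<in> C" for u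
  proof -
    interpret P: flat_piece "facet u" "normal u" by (rule outer_normal(1)[OF u])
    show ?thesis unfolding L2_norm_squared g(2)[OF u] by (intro P.surface_integral_cong) simp
  qed
  \<comment> \<open>Here e = (v - R) + z: the first part contributes the boundary term of the local
    equation, the second is treated by Green's formula.\<close>
  have energy: "(\<integral>x. grad e x \<bullet> grad w x \<partial>lebesgue_on T)
    = (\<Sum>u\<in>C. \<integral>x. s u x * (grad w x \<bullet> normal u) \<partial>\<sigma> u)" if w: "w \<in> polys (k + 1)" for w
  proof -
    have w': "w \<in> polys (Suc k)" using w by simp
    note gi = integrable_grad_inner[OF compact_T _ w]
    have ge: "grad e x = grad v x - grad R x + grad z x" for x
    proof -
      have n: "(\<lambda>x. (- 1) * R x) \<in> polys (k + 1)" by (rule polys_scale[OF R])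
      have "e = (\<lambda>x. (v x + (- 1) * R x) + z x)" by (simp add: e_def z_def fun_eq_iff)
      then show ?thesis
        using grad_add[OF polys_add[OF v1 n] z, of x] grad_add[OF v1 n, of x] grad_scale[OF R, of "- 1" x] by simp
    qed
    have "(\<integral>x. grad e x \<bullet> grad w x \<partial>lebesgue_on T)
      = (\<integral>x. grad v x \<bullet> grad w x \<partial>lebesgue_on T) - (\<integral>x. grad R x \<bullet> grad w x \<partial>lebesgue_on T)
        + (\<integral>x. grad z x \<bullet> grad w x \<partial>lebesgue_on T)"
      unfolding ge using gi[OF v1] gi[OF R] gi[OF z] by (simp add: inner_add_left inner_diff_left)
    also have "\<dots> = boundary_term v f w
        + (\<Sum>u\<in>C. \<integral>x. z x * (grad w x \<bullet> normal u) \<partial>\<sigma> u)"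
      using eq[OF w] green[OF z w' zorth] by simp
    also have "\<dots> = (\<Sum>u\<in>C. \<integral>x. s u x * (grad w x \<bullet> normal u) \<partial>\<sigma> u)"
      unfolding boundary_term_def sum_facets sum.distrib[symmetric]
    proof (rule sum.cong[OF refl])
      fix u assume u: "u \<in> C"
      interpret P: flat_piece "facet u" "normal u" by (rule outer_normal(1)[OF u])
      let ?q = "\<lambda>x. grad w x \<bullet> normal u"
      have q: "?q \<in> polys k" by (rule polys_grad_inner[OF w'])
      have \<phi>1: "\<phi> u \<in> polys (k + 1)" "g u \<in> polys (k + 1)"
        using polys_mono[OF \<phi>(1)[OF u]] polys_mono[OF g(1)[OF u]] by auto
      have "(\<integral>x. (v x - f (facet u) x) * ?q x \<partial>\<sigma> u)
        = (\<integral>x. (v x - \<phi> u x) * ?q x \<partial>\<sigma> u)"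
        by (intro P.surface_integral_cong) (simp add: \<phi>(2)[OF u])
      moreover have "(\<integral>x. (v x - \<phi> u x) * ?q x \<partial>\<sigma> u) + (\<integral>x. z x * ?q x \<partial>\<sigma> u)
        = (\<integral>x. (v x - \<phi> u x) * ?q x + z x * ?q x \<partial>\<sigma> u)"
        by (rule Bochner_Integration.integral_add[symmetric, OF
              P.integrable_surface_polys_mult[OF polys_diff[OF v1 \<phi>1(1)] q] P.integrable_surface_polys_mult[OF z q]])
      \<comment> \<open>As polynomials, v - \<phi> + z = s - (\<phi> - R - g), and the bracket is
        orthogonal to the normal derivative of w, which lies in \<open>polys k\<close>.\<close>
      moreover have "(\<integral>x. (v x - \<phi> u x) * ?q x + z x * ?q x \<partial>\<sigma> u)
        = (\<integral>x. s u x * ?q x - (\<phi> u x - R x - g u x) * ?q x \<partial>\<sigma> u)"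
        by (simp add: s_def e_def z_def algebra_simps)
      moreover have "\<dots> = (\<integral>x. s u x * ?q x \<partial>\<sigma> u)
          - (\<integral>x. (\<phi> u x - R x - g u x) * ?q x \<partial>\<sigma> u)"
        by (rule Bochner_Integration.integral_diff[OF P.integrable_surface_polys_mult[OF s[OF u] q]
              P.integrable_surface_polys_mult[OF polys_diff[OF polys_diff[OF \<phi>1(1) R] \<phi>1(2)] q]])
      ultimately show "(\<integral>x. (v x - f (facet u) x) * ?q x \<partial>\<sigma> u)
          + (\<integral>x. z x * ?q x \<partial>\<sigma> u) = (\<integral>x. s u x * ?q x \<partial>\<sigma> u)"
        using gorth[OF u q] by simp
    qed
    finally show ?thesis .
  qed
  have "x \<in> T" using r by auto
  then have sub: "T \<subseteq> cball x (M * r)"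
    using diameter_bounded_bound[OF compact_imp_bounded[OF compact_T]] M by fastforce
  have C1: "0 < C1" and C2: "0 < C2" using Cp M(2) by (simp_all add: C1_def C2_def)
  have trace: "(\<integral>x. (q x)\<^sup>2 \<partial>\<sigma> u) \<le> C1 / r * (\<integral>x. (q x)\<^sup>2 \<partial>lebesgue_on T)"
    if "u \<in> C" "q \<in> polys k" for u q
    unfolding C1_def by (rule discrete_trace[OF r(1) sub M(2) Cp that bound])
  define E where "E = (\<integral>x. (e x)\<^sup>2 \<partial>lebesgue_on T)"
  define S where "S u = (\<integral>x. (s u x)\<^sup>2 \<partial>\<sigma> u)" for u
  define G where "G u = (\<integral>x. (g u x)\<^sup>2 \<partial>\<sigma> u)" for u
  have A_eq: "A = E / (diameter T)\<^sup>2 + (\<Sum>u\<in>C. G u / diameter (facet u))"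
    unfolding A_def sum_facets eproj L2_norm_squared[of "lebesgue_on T"] E_def G_def
    by (simp add: G_eq cong: sum.cong)
  have Q_eq: "Q = (\<Sum>u\<in>C. S u / diameter (facet u))"
    unfolding Q_def sum_facets S_def by (simp add: S_eq cong: sum.cong)
  have bounds: "S u \<le> 2 * G u + 2 * (C1 / r * E)" "G u \<le> 2 * S u + 2 * (C1 / r * E)" if u: "u \<in> C" for u
  proof -
    interpret P: flat_piece "facet u" "normal u" by (rule outer_normal(1)[OF u])
    have i: "integrable (\<sigma> u) (\<lambda>x. (p x)\<^sup>2)" if "p \<in> polys k" for p
      using P.integrable_surface_polys_mult[OF that that] by (simp add: power2_eq_square)
    have two: "(\<integral>x. (p x)\<^sup>2 \<partial>\<sigma> u)
        \<le> 2 * (\<integral>x. (q x)\<^sup>2 \<partial>\<sigma> u) + 2 * (C1 / r * E)"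
      if p: "p \<in> polys k" and q: "q \<in> polys k" and pq: "\<And>x. (p x)\<^sup>2 \<le> 2 * (q x)\<^sup>2 + 2 * (e x)\<^sup>2" for p q
    proof -
      have "(\<integral>x. (p x)\<^sup>2 \<partial>\<sigma> u) \<le> (\<integral>x. 2 * (q x)\<^sup>2 + 2 * (e x)\<^sup>2 \<partial>\<sigma> u)"
        using i[OF p] i[OF q] i[OF e] pq by (intro integral_mono) auto
      also have "\<dots> = 2 * (\<integral>x. (q x)\<^sup>2 \<partial>\<sigma> u) + 2 * (\<integral>x. (e x)\<^sup>2 \<partial>\<sigma> u)"
        using i[OF q] i[OF e] by simp
      finally show ?thesis using trace[OF u e] by (simp add: E_def)
    qed
    have "(e x - g u x)\<^sup>2 \<le> 2 * (g u x)\<^sup>2 + 2 * (e x)\<^sup>2" for x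
      using zero_le_power2[of "e x + g u x"] by (simp add: power2_diff power2_sum)
    then show "S u \<le> 2 * G u + 2 * (C1 / r * E)"
      unfolding S_def G_def by (intro two s g(1) u) (simp add: s_def)
    have "(g u x)\<^sup>2 \<le> 2 * (s u x)\<^sup>2 + 2 * (e x)\<^sup>2" for x
      using zero_le_power2[of "e x + s u x"] by (simp add: s_def power2_diff power2_sum algebra_simps power2_eq_square)
    then show "G u \<le> 2 * S u + 2 * (C1 / r * E)"
      unfolding S_def G_def by (intro two s g(1) u)
  qed
  have ES: "E \<le> C2 * r\<^sup>2 * (N * C1 / r * (\<Sum>u\<in>C. S u))"
  proof -
    have "E \<le> C2 * r\<^sup>2 * (\<integral>x. grad e x \<bullet> grad e x \<partial>lebesgue_on T)"
      unfolding E_def C2_def by (rule poincare[OF r sub M e emean Cp bound])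
    also have "\<dots> \<le> C2 * r\<^sup>2 * (N * C1 / r * (\<Sum>u\<in>C. S u))"
      unfolding N_def S_def using C2
      by (intro mult_left_mono energy_bound[OF r(1) C1 e s trace energy[OF e1]]) auto
    finally show ?thesis .
  qed
  have hT: "2 * r \<le> diameter T"
    using facet_diameter[OF n r] facet_diameter_le obtain_vertex by (metis order_trans)
  have cardN: "real (card C) = N" using card by (simp add: N_def)
  have E0: "0 \<le> E" "\<And>u. 0 \<le> S u" "\<And>u. 0 \<le> G u" by (simp_all add: E_def S_def G_def)
  note arith = stabilization_arithmetic[OF finite r(1) hT M(1) M(2) C1 C2 facet_diameter[OF n r] facet_diameter_le
      E0 bounds ES cardN]
  show "A \<le> (2 + (1 + 2 * N * C1 * M\<^sup>2) * (C2 * N * C1 * M)) * Q" unfolding A_eq Q_eq by (rule arith(1))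
  show "Q \<le> (2 + 2 * N * C1 * M\<^sup>2) * A" unfolding A_eq Q_eq by (rule arith(2))
qed

end

section \<open>Equivalence on a mesh\<close>

lemma triangulation_element:
  fixes \<T> :: "(real^'n::{finite,wellorder}) set set"
  assumes "triangulation_of \<T> \<Omega>" "K \<in> \<T>"
  obtains C where "full_simplex C" "K = full_simplex.T C"
proof -
  have "int DIM(real^'n::_) simplex K" using assms by (simp add: triangulation_of_def)
  then obtain C where C: "\<not> affine_dependent C" "int (card C) = int DIM(real^'n::_) + 1" "K = convex hull C"
    unfolding simplex_def by blast
  then have "full_simplex C" by unfold_locales auto
  then show ?thesis using that C(3) by (simp add: full_simplex.T_def)
qed

text \<open>The share of one element in the definition of the reconstruction: a Neumann problem with
  facet data f, normalised by the integral.\<close>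

definition local_reconstruction ::
  "nat \<Rightarrow> (real^'n) set \<Rightarrow> (real^'n \<Rightarrow> real) \<Rightarrow> ((real^'n) set \<Rightarrow> real^'n \<Rightarrow> real) \<Rightarrow> (real^'n \<Rightarrow> real) \<Rightarrow> bool" where
  "local_reconstruction k K v f R \<longleftrightarrow> R \<in> polys (k + 1)
    \<and> integral\<^sup>L (lebesgue_on K) R = integral\<^sup>L (lebesgue_on K) v
    \<and> (\<forall>w\<in>polys (k + 1). (\<integral>x. grad R x \<bullet> grad w x \<partial>lebesgue_on K)
      = (\<integral>x. grad v x \<bullet> grad w x \<partial>lebesgue_on K)
        - (\<Sum>F\<in>facets K. \<integral>x. (v x - f F x) * (grad w x \<bullet> outer_normal K F) \<partial>surface_measure F))"

lemma local_reconstruction_ex1: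
  fixes \<T> :: "(real^'n::{finite,wellorder}) set set"
  assumes tri: "triangulation_of \<T> \<Omega>" and sr: "shape_regular \<gamma> \<T>" and vf: "(v, f) \<in> V_h k \<Omega> \<T>" and K: "K \<in> \<T>"
  shows "\<exists>!R. local_reconstruction k K (v K) f R"
proof -
  obtain C where C: "full_simplex C" and KC: "K = full_simplex.T C" by (rule triangulation_element[OF tri K])
  interpret full_simplex C by fact
  obtain x r where r: "0 < r" "cball x r \<subseteq> T"
    using sr K unfolding shape_regular_def KC by blast
  then have ball: "ball x r \<subseteq> T" using ball_subset_cball by blast
  have v: "v K \<in> polys k" using vf K by (auto simp: V_h_def pw_polys_def)
  have f: "f (facet u) \<in> facet_polys k (facet u)" if "u \<in> C" for u
  proof -
    have "facet u \<in> mesh_facets \<T>" using K that facets_T by (auto simp: mesh_facets_def KC)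
    then show ?thesis using vf by (auto simp: V_h_def skeleton_polys_def)
  qed
  obtain R where R: "R \<in> polys (k + 1)" "integral\<^sup>L (lebesgue_on T) R = integral\<^sup>L (lebesgue_on T) (v K)"
    "\<And>w. w \<in> polys (k + 1) \<Longrightarrow> (\<integral>x. grad R x \<bullet> grad w x \<partial>lebesgue_on T)
      = (\<integral>x. grad (v K) x \<bullet> grad w x \<partial>lebesgue_on T) - boundary_term (v K) f w"
    by (rule local_reconstruction_exists[OF ball r(1) v f]) (assumption | rule that | blast)+
  show ?thesis
  proof (rule ex1I[of _ R])
    show "local_reconstruction k K (v K) f R"
      unfolding local_reconstruction_def KC[symmetric] using R by (simp add: KC boundary_term_def)
    fix R' assume "local_reconstruction k K (v K) f R'"
    then have R': "R' \<in> polys (k + 1)" "integral\<^sup>L (lebesgue_on T) R' = integral\<^sup>L (lebesgue_on T) (v K)"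
      "\<And>w. w \<in> polys (k + 1) \<Longrightarrow> (\<integral>x. grad R' x \<bullet> grad w x \<partial>lebesgue_on T)
        = (\<integral>x. grad (v K) x \<bullet> grad w x \<partial>lebesgue_on T) - boundary_term (v K) f w"
      unfolding local_reconstruction_def by (simp_all add: KC boundary_term_def)
    show "R' = R"
      by (rule local_reconstruction_unique[OF ball r(1) R'(1) R(1)]) (simp_all add: R R')
  qed
qed

text \<open>The global equation decouples because test functions may be supported on one element.\<close>

lemma reconstruction_iff_local:
  fixes \<T> :: "(real^'n::{finite,wellorder}) set set"
  assumes tri: "triangulation_of \<T> \<Omega>" and sr: "shape_regular \<gamma> \<T>" and vf: "(v, f) \<in> V_h k \<Omega> \<T>"
    and R: "R \<in> pw_polys (k + 1) \<T>"
  shows "(\<forall>T\<in>\<T>. elem_proj 0 T (\<lambda>x. R T x - v T x) = (\<lambda>x. 0)) \<and>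
      (\<forall>w\<in>pw_polys (k + 1) \<T>. pw_grad_inner \<T> R w = pw_grad_inner \<T> v w -
          (\<Sum>T\<in>\<T>. \<Sum>F\<in>facets T.
             \<integral>x. (v T x - f F x) * (grad (w T) x \<bullet> outer_normal T F) \<partial>surface_measure F))
    \<longleftrightarrow> (\<forall>T\<in>\<T>. local_reconstruction k T (v T) f (R T))" (is "?mean \<and> ?glob \<longleftrightarrow> ?loc")
proof -
  have fin: "finite \<T>" using tri by (simp add: triangulation_of_def triangulation_def)
  have Rp: "R K \<in> polys (k + 1)" and vp: "v K \<in> polys k" if "K \<in> \<T>" for K
    using R vf that by (auto simp: V_h_def pw_polys_def)
  have mean: "elem_proj 0 K (\<lambda>x. R K x - v K x) = (\<lambda>x. 0)
      \<longleftrightarrow> integral\<^sup>L (lebesgue_on K) (R K) = integral\<^sup>L (lebesgue_on K) (v K)" if K: "K \<in> \<T>" for K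
  proof -
    obtain x r where r: "0 < r" "cball x r \<subseteq> K" using sr K unfolding shape_regular_def by blast
    then have ball: "ball x r \<subseteq> K" using ball_subset_cball by blast
    obtain C where "full_simplex C" "K = full_simplex.T C" by (rule triangulation_element[OF tri K])
    then have comp: "compact K" using full_simplex.compact_T by blast
    have d: "(\<lambda>x. R K x - v K x) \<in> polys (k + 1)"
      by (rule polys_diff[OF Rp[OF K] polys_mono[OF vp[OF K]]]) simp
    show ?thesis
      unfolding elem_proj_0_eq_0_iff[OF comp ball r(1) d]
      using integrable_polys[OF comp Rp[OF K]] integrable_polys[OF comp vp[OF K]] by simp
  qed
  define bt where "bt K w = (\<Sum>F\<in>facets K. \<integral>x. (v K x - f F x) * (grad w x \<bullet> outer_normal K F) \<partial>surface_measure F)"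
    for K w
  define a where "a K w = (\<integral>x. grad (R K) x \<bullet> grad w x \<partial>lebesgue_on K)" for K w
  define b where "b K w = (\<integral>x. grad (v K) x \<bullet> grad w x \<partial>lebesgue_on K)" for K w
  have glob: "?glob \<longleftrightarrow> (\<forall>w\<in>pw_polys (k + 1) \<T>. (\<Sum>K\<in>\<T>. a K (w K)) = (\<Sum>K\<in>\<T>. b K (w K) - bt K (w K)))"
    by (simp add: pw_grad_inner_def a_def b_def bt_def sum_subtractf)
  have loc: "local_reconstruction k K (v K) f (R K) \<longleftrightarrow>
      elem_proj 0 K (\<lambda>x. R K x - v K x) = (\<lambda>x. 0) \<and> (\<forall>w\<in>polys (k + 1). a K w = b K w - bt K w)" if K: "K \<in> \<T>" for K
    unfolding mean[OF K] local_reconstruction_def a_def b_def bt_def using Rp[OF K] by blast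
  show ?thesis
  proof
    assume "?mean \<and> ?glob"
    then have m: ?mean and g: "\<And>w. w \<in> pw_polys (k + 1) \<T> \<Longrightarrow> (\<Sum>K\<in>\<T>. a K (w K)) = (\<Sum>K\<in>\<T>. b K (w K) - bt K (w K))"
      unfolding glob by blast+
    have "a K w0 = b K w0 - bt K w0" if K: "K \<in> \<T>" and w0: "w0 \<in> polys (k + 1)" for K w0
    proof -
      \<comment> \<open>On the other elements the test function is the zero polynomial, so their
        terms vanish. The restriction to the mesh makes the family extensional.\<close>
      define w where "w = (\<lambda>K'\<in>\<T>. if K' = K then w0 else (\<lambda>x. 0))"
      have "w \<in> pw_polys (k + 1) \<T>" using w0 by (auto simp: w_def pw_polys_def polys_zero)
      from g[OF this] have "(\<Sum>K'\<in>\<T>. a K' (w K')) = (\<Sum>K'\<in>\<T>. b K' (w K') - bt K' (w K'))" .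
      moreover have "a K' (w K') = (if K' = K then a K w0 else 0)"
        "b K' (w K') - bt K' (w K') = (if K' = K then b K w0 - bt K w0 else 0)" if "K' \<in> \<T>" for K'
        using that by (auto simp: w_def a_def b_def bt_def grad_const)
      ultimately show ?thesis using K fin by (simp cong: sum.cong)
    qed
    then show ?loc using m loc by blast
  next
    assume l: ?loc
    then have ?mean using loc by blast
    moreover have ?glob
      unfolding glob
    proof
      fix w assume "w \<in> pw_polys (k + 1) \<T>"
      then have "w K \<in> polys (k + 1)" if "K \<in> \<T>" for K using that by (auto simp: pw_polys_def)
      then show "(\<Sum>K\<in>\<T>. a K (w K)) = (\<Sum>K\<in>\<T>. b K (w K) - bt K (w K))"
        using l loc by (intro sum.cong) auto
    qed
    ultimately show "?mean \<and> ?glob" by blast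
  qed
qed

text \<open>The local solutions glue to an extensional family satisfying the global conditions. Any
  other such family is a local solution on each element, hence the same. This resolves the definite
  description in \<open>reconstruction\<close>.\<close>

lemma reconstruction_local:
  fixes \<T> :: "(real^'n::{finite,wellorder}) set set"
  assumes tri: "triangulation_of \<T> \<Omega>" and sr: "shape_regular \<gamma> \<T>" and vf: "(v, f) \<in> V_h k \<Omega> \<T>" and K: "K \<in> \<T>"
  shows "local_reconstruction k K (v K) f (reconstruction k \<T> (v, f) K)"
proof -
  define R0 where "R0 = (\<lambda>K\<in>\<T>. THE R. local_reconstruction k K (v K) f R)"
  have L: "local_reconstruction k K (v K) f (R0 K)" if "K \<in> \<T>" for K
    using theI'[OF local_reconstruction_ex1[OF tri sr vf that]] that by (simp add: R0_def)
  have R0: "R0 \<in> pw_polys (k + 1) \<T>"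
    using L by (auto simp: pw_polys_def local_reconstruction_def R0_def)
  have "reconstruction k \<T> (v, f) = R0"
    unfolding reconstruction_def prod.case
  proof (rule the_equality, goal_cases)
    case 1
    show ?case using R0 L reconstruction_iff_local[OF tri sr vf R0] by blast
  next
    case (2 R)
    then have R: "R \<in> pw_polys (k + 1) \<T>" by blast
    with 2 have "local_reconstruction k K (v K) f (R K)" if "K \<in> \<T>" for K
      using reconstruction_iff_local[OF tri sr vf R] that by blast
    then have "R K = R0 K" if "K \<in> \<T>" for K
      using local_reconstruction_ex1[OF tri sr vf that] L[OF that] that by blast
    then show ?case by (rule PiE_ext[OF R[unfolded pw_polys_def] R0[unfolded pw_polys_def]])
  qed
  then show ?thesis using L[OF K] by simp
qed

definition stabilization ::
  "nat \<Rightarrow> (real^'n) set set \<Rightarrow> (real^'n) set \<Rightarrow> 'n pw_fun \<times> 'n pw_fun \<Rightarrow> real" where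
  "stabilization k \<T> T vh =
     (\<Sum>F\<in>facets T. (L2_norm (surface_measure F) (S_TF k \<T> T F vh))\<^sup>2 / diameter F)"

text \<open>The constants are fixed before domain, mesh and element. Nonnegativity of
  \<open>s_tilde\<close> is recorded because the constants of two dimensions are later replaced by
  their maximum.\<close>

lemma stabilization_equivalence:
  fixes k :: nat and \<gamma> :: real
  assumes n: "2 \<le> CARD('n::{finite,wellorder})"
  obtains C C' where "0 < C" "0 < C'"
    "\<And>(\<Omega> :: (real^'n::_) set) \<T> vh T. triangulation_of \<T> \<Omega> \<Longrightarrow> shape_regular \<gamma> \<T> \<Longrightarrow> vh \<in> V_h k \<Omega> \<T> \<Longrightarrow> T \<in> \<T> \<Longrightarrow>
      0 \<le> s_tilde k \<T> T vh \<and> s_tilde k \<T> T vh \<le> C * stabilization k \<T> T vh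
      \<and> stabilization k \<T> T vh \<le> C' * s_tilde k \<T> T vh"
proof -
  \<comment> \<open>The value 2 \<gamma> comes from h_T \<le> \<gamma> * (2 r); the maximum with 1
    makes M positive for every \<gamma>.\<close>
  define M where "M = max 1 (2 * \<gamma>)"
  have M: "0 < M" "2 * \<gamma> \<le> M" by (auto simp: M_def)
  obtain Cp where Cp: "0 < Cp"
    "\<And>p (a :: real^'n::_) r T x. p \<in> polys k \<Longrightarrow> 0 < r \<Longrightarrow> cball a r \<subseteq> T \<Longrightarrow> compact T \<Longrightarrow> x \<in> cball a (M * r)
      \<Longrightarrow> (p x)\<^sup>2 \<le> Cp / r ^ CARD('n) * (\<integral>x. (p x)\<^sup>2 \<partial>lebesgue_on T)"
    by (rule polys_pointwise_bound[where k = k and M = M and 'n = 'n]) (assumption | rule that | blast)+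
  define C1 where "C1 = Cp * (unit_ball_vol CARD('n) * (M + 1) ^ CARD('n))"
  define C2 where "C2 = unit_ball_vol CARD('n) * M ^ CARD('n) * Cp * M\<^sup>2"
  define N where "N = real (CARD('n) + 1)"
  have pos: "0 < C1" "0 < C2" "0 < N" using Cp(1) M by (simp_all add: C1_def C2_def N_def)
  show ?thesis
  proof (rule that)
    show "0 < 2 + (1 + 2 * N * C1 * M\<^sup>2) * (C2 * N * C1 * M)" "0 < 2 + 2 * N * C1 * M\<^sup>2"
      using pos M by (auto intro!: add_pos_nonneg mult_nonneg_nonneg)
    fix \<Omega> :: "(real^'n::_) set" and \<T> vh T
    assume tri: "triangulation_of \<T> \<Omega>" and sr: "shape_regular \<gamma> \<T>" and vh: "vh \<in> V_h k \<Omega> \<T>" and T: "T \<in> \<T>"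
    obtain v f where vf: "vh = (v, f)" by (cases vh)
    note vh' = vh[unfolded vf]
    define R where "R = reconstruction k \<T> (v, f) T"
    obtain C where C: "full_simplex C" and TC: "T = full_simplex.T C" by (rule triangulation_element[OF tri T])
    interpret full_simplex C by fact
    obtain x r where r: "0 < r" "cball x r \<subseteq> T" "diameter T \<le> \<gamma> * (2 * r)"
      using sr T unfolding shape_regular_def by blast
    have "\<gamma> * (2 * r) \<le> M * r" using r(1) M(2) by (simp add: mult.assoc[symmetric] mult.commute[of \<gamma>])
    then have h: "diameter T \<le> M * r" using r(3) by linarith
    have comp: "compact T" using compact_T TC by simp
    define v0 where "v0 = v T"
    have v: "v0 \<in> polys k" using vh' T by (auto simp: v0_def V_h_def pw_polys_def)
    have f: "f (facet u) \<in> facet_polys k (facet u)" if "u \<in> C" for u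
    proof -
      have "facet u \<in> mesh_facets \<T>" using T that facets_T by (auto simp: mesh_facets_def TC)
      then show ?thesis using vh' by (auto simp: V_h_def skeleton_polys_def)
    qed
    have loc: "local_reconstruction k T v0 f R"
      unfolding R_def v0_def by (rule reconstruction_local[OF tri sr vh' T])
    have R: "R \<in> polys (k + 1)" "integral\<^sup>L (lebesgue_on T) R = integral\<^sup>L (lebesgue_on T) v0"
      "\<And>w. w \<in> polys (k + 1) \<Longrightarrow> (\<integral>x. grad R x \<bullet> grad w x \<partial>lebesgue_on T)
        = (\<integral>x. grad v0 x \<bullet> grad w x \<partial>lebesgue_on T) - boundary_term v0 f w"
      using loc unfolding local_reconstruction_def boundary_term_def TC by auto
    note est = element_equivalence[OF n r(1) r(2)[unfolded TC] h[unfolded TC] M(1) Cp(1)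
        Cp(2)[OF _ r(1) r(2)[unfolded TC] compact_T] v f R(1) R(2)[unfolded TC] R(3)[unfolded TC],
        folded TC C1_def C2_def N_def]
    have A: "s_tilde k \<T> T vh = (L2_norm (lebesgue_on T) (elem_proj k T (\<lambda>x. v0 x - R x)))\<^sup>2 / (diameter T)\<^sup>2 +
         (\<Sum>F\<in>facets T. (L2_norm (surface_measure F) (facet_proj k F (\<lambda>x. f F x - R x)))\<^sup>2 / diameter F)"
      unfolding s_tilde_def Let_def vf R_def v0_def by simp
    have Q: "stabilization k \<T> T vh
      = (\<Sum>F\<in>facets T. (L2_norm (surface_measure F)
           (\<lambda>x. facet_proj k F (\<lambda>y. v0 y + (R y - elem_proj k T R y)) x - f F x))\<^sup>2 / diameter F)"
      unfolding stabilization_def S_TF_def Let_def vf R_def v0_def by simp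
    have "0 \<le> diameter F" if F: "F \<in> facets T" for F
    proof -
      obtain u where "u \<in> C" "F = facet u" using F unfolding TC facets_T by blast
      then show ?thesis using facet_diameter[OF n r(1) r(2)[unfolded TC]] r(1) by fastforce
    qed
    then have "0 \<le> s_tilde k \<T> T vh"
      unfolding A by (intro add_nonneg_nonneg sum_nonneg divide_nonneg_nonneg) auto
    then show "0 \<le> s_tilde k \<T> T vh \<and> s_tilde k \<T> T vh \<le> (2 + (1 + 2 * N * C1 * M\<^sup>2) * (C2 * N * C1 * M))
          * stabilization k \<T> T vh
      \<and> stabilization k \<T> T vh
        \<le> (2 + 2 * N * C1 * M\<^sup>2) * s_tilde k \<T> T vh"
      unfolding A Q using est by blast
  qed
qed

theorem theorem4:
  fixes k :: nat and \<gamma> :: real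
  shows "\<exists>C>0. \<exists>C'>0.
    (\<forall>(\<Omega> :: (real^2) set) \<T>.
       bounded_polyhedral_lipschitz_domain \<Omega> \<and> triangulation_of \<T> \<Omega> \<and> shape_regular \<gamma> \<T> \<longrightarrow>
       (\<forall>vh\<in>V_h k \<Omega> \<T>. \<forall>T\<in>\<T>.
          inverse C * s_tilde k \<T> T vh
            \<le> (\<Sum>F\<in>facets T. (L2_norm (surface_measure F) (S_TF k \<T> T F vh))\<^sup>2 / diameter F) \<and>
          (\<Sum>F\<in>facets T. (L2_norm (surface_measure F) (S_TF k \<T> T F vh))\<^sup>2 / diameter F)
            \<le> C' * s_tilde k \<T> T vh)) \<and>
    (\<forall>(\<Omega> :: (real^3) set) \<T>.
       bounded_polyhedral_lipschitz_domain \<Omega> \<and> triangulation_of \<T> \<Omega> \<and> shape_regular \<gamma> \<T> \<longrightarrow>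
       (\<forall>vh\<in>V_h k \<Omega> \<T>. \<forall>T\<in>\<T>.
          inverse C * s_tilde k \<T> T vh
            \<le> (\<Sum>F\<in>facets T. (L2_norm (surface_measure F) (S_TF k \<T> T F vh))\<^sup>2 / diameter F) \<and>
          (\<Sum>F\<in>facets T. (L2_norm (surface_measure F) (S_TF k \<T> T F vh))\<^sup>2 / diameter F)
            \<le> C' * s_tilde k \<T> T vh))"
proof -
  have two: "2 \<le> CARD(2)" and three: "2 \<le> CARD(3)" by simp_all
  obtain C2 C2' where C2: "0 < C2" "0 < C2'"
    "\<And>(\<Omega> :: (real^2) set) \<T> vh T. triangulation_of \<T> \<Omega> \<Longrightarrow> shape_regular \<gamma> \<T> \<Longrightarrow> vh \<in> V_h k \<Omega> \<T> \<Longrightarrow> T \<in> \<T> \<Longrightarrow>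
      0 \<le> s_tilde k \<T> T vh \<and> s_tilde k \<T> T vh \<le> C2 * stabilization k \<T> T vh
      \<and> stabilization k \<T> T vh \<le> C2' * s_tilde k \<T> T vh"
    using stabilization_equivalence[OF two, of \<gamma> k thesis] by blast
  obtain C3 C3' where C3: "0 < C3" "0 < C3'"
    "\<And>(\<Omega> :: (real^3) set) \<T> vh T. triangulation_of \<T> \<Omega> \<Longrightarrow> shape_regular \<gamma> \<T> \<Longrightarrow> vh \<in> V_h k \<Omega> \<T> \<Longrightarrow> T \<in> \<T> \<Longrightarrow>
      0 \<le> s_tilde k \<T> T vh \<and> s_tilde k \<T> T vh \<le> C3 * stabilization k \<T> T vh
      \<and> stabilization k \<T> T vh \<le> C3' * s_tilde k \<T> T vh"
    using stabilization_equivalence[OF three, of \<gamma> k thesis] by blast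
  \<comment> \<open>One pair of constants serves both dimensions. Enlarging a constant needs
    nonnegative quantities: s is so by assumption, and q because c q \<ge> s \<ge> 0.\<close>
  have combine: "inverse (max C2 C3) * s \<le> q \<and> q \<le> max C2' C3' * s"
    if c: "c = C2 \<and> c' = C2' \<or> c = C3 \<and> c' = C3'" and sq: "0 \<le> s \<and> s \<le> c * q \<and> q \<le> c' * s" for s q c c' :: real
  proof
    have c0: "0 < c" using c C2 C3 by auto
    have "0 \<le> c * q" using sq by linarith
    then have q: "0 \<le> q" using c0 by (simp add: zero_le_mult_iff)
    have "s \<le> max C2 C3 * q" using sq c q mult_right_mono[of c "max C2 C3" q] by auto
    then show "inverse (max C2 C3) * s \<le> q" using C2 C3 by (simp add: field_simps less_max_iff_disj)
    show "q \<le> max C2' C3' * s" using sq c mult_right_mono[of c' "max C2' C3'" s] by auto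
  qed
  have dim2: "inverse (max C2 C3) * s_tilde k \<T> T vh
        \<le> stabilization k \<T> T vh \<and>
      stabilization k \<T> T vh
        \<le> max C2' C3' * s_tilde k \<T> T vh"
    if "triangulation_of \<T> \<Omega>" "shape_regular \<gamma> \<T>" "vh \<in> V_h k \<Omega> \<T>" "T \<in> \<T>" for \<Omega> :: "(real^2) set" and \<T> vh T
    by (rule combine[OF _ C2(3)[OF that]]) simp
  have dim3: "inverse (max C2 C3) * s_tilde k \<T> T vh
        \<le> stabilization k \<T> T vh \<and>
      stabilization k \<T> T vh
        \<le> max C2' C3' * s_tilde k \<T> T vh"
    if "triangulation_of \<T> \<Omega>" "shape_regular \<gamma> \<T>" "vh \<in> V_h k \<Omega> \<T>" "T \<in> \<T>" for \<Omega> :: "(real^3) set" and \<T> vh T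
    by (rule combine[OF _ C3(3)[OF that]]) simp
  have "0 < max C2 C3" "0 < max C2' C3'" using C2 by auto
  then show ?thesis unfolding stabilization_def[symmetric] using dim2 dim3 by (intro exI[of _ "max C2 C3"] exI[of _ "max C2' C3'"]) blast
qed

end
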